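(* Assume that $F$ is uniformly elliptic and positively $1$-homogeneous and that $g\in C^{\gamma}(\Sigma_0)$ (for some $\gamma\in(0,1)$) is almost periodic on $\Sigma_0$. For $\varepsilon>0$ let $u^\varepsilon$ be the unique bounded viscosity solution of $$F(D^2u^\varepsilon)=0\ \text{in}\ \Sigma^1,\qquad u^\varepsilon=0\ \text{on}\ \Sigma_1,\qquad \partial_\nu u^\varepsilon(x)=g\left(\tfrac{x}{\varepsilon}\right)\ \text{on}\ \Sigma_0 .$$ Then there exists a unique constant $\bar{\mathcal I}(0)\in\mathbb{R}$ such that $$\big\|u^\varepsilon|_{\Sigma_0}-\bar{\mathcal I}(0)\big\|_{L^\infty(\Sigma_0)}\to0\quad\text{as}\ \varepsilon\to0 .$$
   Context: Let $d\ge 1$ and let $\nu\in\mathbb{R}^{d+1}$ be a fixed unit vector. For $r>0$ set $\Sigma^r=\{X\in\mathbb{R}^{d+1}: 0<X\cdot\nu<r\}$, $\Sigma_r=\{X: X\cdot\nu=r\}$, $\Sigma_0=\{X: X\cdot\nu=0\}$. $\partial_\nu$ denotes the derivative in the direction $\nu$. $C^\gamma(\Sigma_0)$ is the space of bounded functions with finite $\gamma$-Hölder norm. The symbol $\bar{\mathcal I}(0)$ is just the name of the constant. $F$ is a real-valued function on symmetric $(d+1)\times(d+1)$ matrices. Uniform ellipticity: for some $\Lambda\ge\lambda>0$, $\mathcal{M}^-(M-N)\le F(M)-F(N)\le\mathcal{M}^+(M-N)$ for all symmetric $M,N$, where $\mathcal{M}^-(M)=\inf_{\lambda \mathrm{Id}\le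 A\le\Lambda \mathrm{Id}}\mathrm{Tr}(AM)$ and $\mathcal{M}^+(M)=\sup_{\lambda \mathrm{Id}\le A\le\Lambda \mathrm{Id}}\mathrm{Tr}(AM)$. Positive $1$-homogeneity: $F(\alpha M)=\alpha F(M)$ for all $\alpha\ge0$. A function $f:\Sigma_0\to\mathbb{R}$ is almost periodic if it can be uniformly approximated on $\Sigma_0$ by trigonometric polynomials. Existence and uniqueness of bounded viscosity solutions of this boundary value problem are standard facts. Sign convention: subsolutions satisfy $F(D^2u)\ge0$. *)

theory Defs
  imports "HOL-Analysis.Analysis"
begin

definition strip :: "real^'n \<Rightarrow> real \<Rightarrow> (real^'n) set" where
  "strip \<nu> r = {X. 0 < X \<bullet> \<nu> \<and> X \<bullet> \<nu> < r}"

definition hyperplane :: "real^'n \<Rightarrow> real \<Rightarrow> (real^'n) set" where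
  "hyperplane \<nu> r = {X. X \<bullet> \<nu> = r}"

definition symmetric_matrix :: "real^'n^'n \<Rightarrow> bool" where
  "symmetric_matrix A \<longleftrightarrow> transpose A = A"

definition loewner_le :: "real^'n^'n \<Rightarrow> real^'n^'n \<Rightarrow> bool" where
  "loewner_le A B \<longleftrightarrow> (\<forall>x. x \<bullet> (A *v x) \<le> x \<bullet> (B *v x))"

(* mat l is l times the identity.  For 0 < lam <= Lam the set is nonempty and compact, so the
   conditionally complete INF and SUP below are the actual infimum and supremum. *)
definition elliptic_matrices :: "real \<Rightarrow> real \<Rightarrow> (real^'n^'n) set" where
  "elliptic_matrices lam Lam =
     {A. symmetric_matrix A \<and> loewner_le (mat lam) A \<and> loewner_le A (mat Lam)}"

definition pucci_minus :: "real \<Rightarrow> real \<Rightarrow> real^'n^'n \<Rightarrow> real" where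
  "pucci_minus lam Lam M = (INF A\<in>elliptic_matrices lam Lam. trace (A ** M))"

definition pucci_plus :: "real \<Rightarrow> real \<Rightarrow> real^'n^'n \<Rightarrow> real" where
  "pucci_plus lam Lam M = (SUP A\<in>elliptic_matrices lam Lam. trace (A ** M))"

(* Operators are total functions on matrices, but only their values on symmetric matrices are
   ever constrained or used. *)
definition uniformly_elliptic :: "(real^'n^'n \<Rightarrow> real) \<Rightarrow> bool" where
  "uniformly_elliptic F \<longleftrightarrow>
     (\<exists>lam Lam. 0 < lam \<and> lam \<le> Lam \<and>
       (\<forall>M N. symmetric_matrix M \<longrightarrow> symmetric_matrix N \<longrightarrow>
          pucci_minus lam Lam (M - N) \<le> F M - F N \<and>
          F M - F N \<le> pucci_plus lam Lam (M - N)))"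

definition positively_homogeneous :: "(real^'n^'n \<Rightarrow> real) \<Rightarrow> bool" where
  "positively_homogeneous F \<longleftrightarrow>
     (\<forall>M a. symmetric_matrix M \<longrightarrow> 0 \<le> a \<longrightarrow> F (a *\<^sub>R M) = a * F M)"

definition holder_space :: "real \<Rightarrow> (real^'n) set \<Rightarrow> (real^'n \<Rightarrow> real) set" where
  "holder_space \<gamma> S =
     {g. bounded (g ` S) \<and>
         (\<exists>C. \<forall>x\<in>S. \<forall>y\<in>S. \<bar>g x - g y\<bar> \<le> C * norm (x - y) powr \<gamma>)}"

definition trig_polynomial :: "(real^'n \<Rightarrow> complex) \<Rightarrow> bool" where
  "trig_polynomial p \<longleftrightarrow>
     (\<exists>K c. finite K \<and> p = (\<lambda>x. \<Sum>\<xi>\<in>K. c \<xi> * cis (\<xi> \<bullet> x)))"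

definition almost_periodic_on :: "(real^'n) set \<Rightarrow> (real^'n \<Rightarrow> real) \<Rightarrow> bool" where
  "almost_periodic_on S g \<longleftrightarrow>
     (\<forall>e>0. \<exists>p. trig_polynomial p \<and> (\<forall>x\<in>S. cmod (complex_of_real (g x) - p x) \<le> e))"

(* phi is C^2 on U with gradient G and Hessian H; if U is open, each H x with x in U is
   symmetric by Schwarz's theorem. *)
definition C2_on ::
  "(real^'n) set \<Rightarrow> (real^'n \<Rightarrow> real) \<Rightarrow> (real^'n \<Rightarrow> real^'n) \<Rightarrow> (real^'n \<Rightarrow> real^'n^'n) \<Rightarrow> bool"
where
  "C2_on U \<phi> G H \<longleftrightarrow>
     (\<forall>x\<in>U. (\<phi> has_derivative (\<lambda>h. G x \<bullet> h)) (at x)) \<and>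
     (\<forall>x\<in>U. (G has_derivative (\<lambda>h. H x *v h)) (at x)) \<and>
     continuous_on U H"

definition usc_on :: "(real^'n) set \<Rightarrow> (real^'n \<Rightarrow> real) \<Rightarrow> bool" where
  "usc_on S u \<longleftrightarrow> (\<forall>a. openin (top_of_set S) {x\<in>S. u x < a})"

definition lsc_on :: "(real^'n) set \<Rightarrow> (real^'n \<Rightarrow> real) \<Rightarrow> bool" where
  "lsc_on S u \<longleftrightarrow> (\<forall>a. openin (top_of_set S) {x\<in>S. a < u x})"

(* Viscosity sub- and supersolutions of
     F(D^2 u) = 0 in the strip,  u = 0 on hyperplane nu r,  d_nu u = h on hyperplane nu 0.
   The Neumann condition is understood in the usual relaxed viscosity sense.  The vector nu points
   into the strip at hyperplane nu 0, so a smooth u touched from above there by phi has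
   d_nu phi >= d_nu u; hence the direction of the boundary inequalities.  Test functions are C^2
   in a full neighbourhood U of the contact point, and contact is relative to the closed strip. *)
definition visc_subsolution ::
  "(real^'n^'n \<Rightarrow> real) \<Rightarrow> real^'n \<Rightarrow> real \<Rightarrow> (real^'n \<Rightarrow> real) \<Rightarrow> (real^'n \<Rightarrow> real) \<Rightarrow> bool"
where
  "visc_subsolution F \<nu> r h u \<longleftrightarrow>
     usc_on (closure (strip \<nu> r)) u \<and>
     (\<forall>x\<in>hyperplane \<nu> r. u x \<le> 0) \<and>
     (\<forall>U \<phi> G H x. open U \<longrightarrow> x \<in> U \<longrightarrow> C2_on U \<phi> G H \<longrightarrow>
        (\<forall>y\<in>U \<inter> closure (strip \<nu> r). u y - \<phi> y \<le> u x - \<phi> x) \<longrightarrow>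
          (x \<in> strip \<nu> r \<longrightarrow> F (H x) \<ge> 0) \<and>
          (x \<in> hyperplane \<nu> 0 \<longrightarrow> F (H x) \<ge> 0 \<or> G x \<bullet> \<nu> \<ge> h x))"

definition visc_supersolution ::
  "(real^'n^'n \<Rightarrow> real) \<Rightarrow> real^'n \<Rightarrow> real \<Rightarrow> (real^'n \<Rightarrow> real) \<Rightarrow> (real^'n \<Rightarrow> real) \<Rightarrow> bool"
where
  "visc_supersolution F \<nu> r h u \<longleftrightarrow>
     lsc_on (closure (strip \<nu> r)) u \<and>
     (\<forall>x\<in>hyperplane \<nu> r. u x \<ge> 0) \<and>
     (\<forall>U \<phi> G H x. open U \<longrightarrow> x \<in> U \<longrightarrow> C2_on U \<phi> G H \<longrightarrow>
        (\<forall>y\<in>U \<inter> closure (strip \<nu> r). u y - \<phi> y \<ge> u x - \<phi> x) \<longrightarrow>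
          (x \<in> strip \<nu> r \<longrightarrow> F (H x) \<le> 0) \<and>
          (x \<in> hyperplane \<nu> 0 \<longrightarrow> F (H x) \<le> 0 \<or> G x \<bullet> \<nu> \<le> h x))"

definition bounded_visc_solution ::
  "(real^'n^'n \<Rightarrow> real) \<Rightarrow> real^'n \<Rightarrow> real \<Rightarrow> (real^'n \<Rightarrow> real) \<Rightarrow> (real^'n \<Rightarrow> real) \<Rightarrow> bool"
where
  "bounded_visc_solution F \<nu> r h u \<longleftrightarrow>
     bounded (u ` closure (strip \<nu> r)) \<and>
     visc_subsolution F \<nu> r h u \<and> visc_supersolution F \<nu> r h u"

end

theory Submission
  imports Defs "HOL-Complex_Analysis.Great_Picard"
begin

text \<open>
  The trace of \<open>u \<epsilon>\<close> on the bottom hyperplane flattens out for three reasons.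

  First, its infimum increases and its supremum decreases as \<open>\<epsilon>\<close> decreases to \<open>0\<close>
  (\<open>bottom_infimum_monotone\<close>). Shrink \<open>u \<epsilon>\<close> to the thinner strip of height \<open>\<epsilon>' / \<epsilon>\<close>; it
  then has the Neumann data of scale \<open>\<epsilon>'\<close>. Add a constant and take the maximum with the linear
  function in the normal coordinate that vanishes on the top and lies slightly below the infimum of
  \<open>u \<epsilon>\<close> on the bottom. The result is a subsolution in the whole strip: near the bottom the rescaled solution wins, near the
  top of the thin strip the linear function wins. Comparison with \<open>u \<epsilon>'\<close> gives the claim.

  Second, the oscillation on the bottom tends to \<open>0\<close>. Translates of an almost periodic function form
  a totally bounded family, so that almost periods are relatively dense
  (\<open>relatively_dense_almost_periods\<close>). Translating \<open>u \<epsilon>\<close> by \<open>\<epsilon>\<close> times an almost period changes the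
  data by at most \<open>\<delta>\<close>, hence the solution by at most \<open>\<delta>\<close> (\<open>comparison\<close>). Any two points of the
  bottom are, up to such a translation, at distance \<open>O(\<epsilon>)\<close>, and on that scale a modulus of continuity
  that depends only on the ellipticity and on the bound of \<open>g\<close> applies
  (\<open>equicontinuity_at_bottom\<close>, an Ishii--Lions argument).

  Third, nested intervals whose lengths tend to \<open>0\<close> have one common point, the constant.

  Comparison and equicontinuity double the variables. Both need second-order jets of two
  semicontinuous functions at a maximum of \<open>u1 x + u2 y - \<phi> (x, y)\<close>, ordered by the Hessian of \<open>\<phi>\<close>:
  the Crandall--Ishii lemma (\<open>theorem_on_sums\<close>). Its usual proof evaluates semiconvex functions at
  points of second differentiability, which Aleksandrov's theorem provides. A compactness argument
  replaces that theorem here. The sup-convolution of the sum is semiconvex and touches affine functions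
  from above on a set of positive measure (\<open>contact_set_not_negligible\<close>). Such a set is almost dense in
  suitable small balls (\<open>nonnegligible_dense_at_small_scale\<close>), and blowing up there yields a function
  that is pinched between two quadratic forms at every point (\<open>blow_up_at_contact_points\<close>). The class of
  all functions obtained by further blow-ups and limits contains a true quadratic form: maximise the
  second difference in one direction after the other (\<open>blowup_closed_contains_quadratic\<close>). The Hessian
  blocks of that form are the required jets, because touching from above by a quadratic passes to blow-ups
  and limits and, by the translation property of sup-convolutions, back to \<open>u1\<close> and \<open>u2\<close>.

  A subsolution for the operator \<open>F\<close> and the negative of a supersolution are treated alike: each
  is described by the set of Hessians admitted in its superjets, and the two sets are linked by the
  maximal Pucci operator only (locale \<open>elliptic_pair\<close>).
\<close>

section \<open>Sets of positive measure are nearly dense in some small ball\<close>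

text \<open>
  Otherwise every small ball centred in \<open>S\<close> has a hole, disjoint from \<open>S\<close>, of comparable size. Take an
  open neighbourhood of \<open>S\<close> of almost the same measure and a disjoint Vitali cover of \<open>S\<close> inside it: the
  holes fill a fixed fraction of the cover, for which the neighbourhood has no room.
\<close>
lemma nonnegligible_dense_at_small_scale:
  fixes S :: "'a::euclidean_space set"
  assumes S: "S \<in> lmeasurable" and nn: "\<not> negligible S"
    and \<rho>: "0 < \<rho>" "\<rho> \<le> 1" and s0: "0 < s0"
  obtains x s where "x \<in> S" "0 < s" "s \<le> s0" "\<And>y. y \<in> cball x s \<Longrightarrow> \<exists>z\<in>S. dist y z \<le> \<rho> * s"
proof -
  have "\<exists>x\<in>S. \<exists>s. 0 < s \<and> s \<le> s0 \<and> (\<forall>y\<in>cball x s. \<exists>z\<in>S. dist y z \<le> \<rho> * s)"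
  proof (rule ccontr)
    assume neg: "\<not> ?thesis"
    have "\<exists>y. y \<in> cball x (s/2) \<and> ball y (\<rho> * s / 2) \<inter> S = {}" if "x \<in> S" "0 < s" "s \<le> s0" for x s
    proof -
      have "0 < s/2" "s/2 \<le> s0" using that by auto
      with neg that(1) obtain y where "y \<in> cball x (s/2)" "\<forall>z\<in>S. \<not> dist y z \<le> \<rho> * (s/2)"
        by blast
      then show ?thesis by (intro exI[of _ y]) force
    qed
    then obtain hole where hole: "\<And>x s. \<lbrakk>x \<in> S; 0 < s; s \<le> s0\<rbrakk> \<Longrightarrow>
        hole x s \<in> cball x (s/2) \<and> ball (hole x s) (\<rho> * s / 2) \<inter> S = {}"
      by metis
    \<comment> \<open>the fraction of a ball that its hole fills\<close>
    define c where "c = (\<rho>/2) ^ DIM('a)"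
    have c: "0 < c" using \<rho> by (simp add: c_def)
    define \<mu> where "\<mu> = measure lebesgue S"
    have \<mu>: "0 < \<mu>"
      using nn S unfolding \<mu>_def by (metis negligible_iff_measure zero_less_measure_iff)
    obtain T where T: "open T" "S \<subseteq> T" "T \<in> lmeasurable" "measure lebesgue T < \<mu> + c * \<mu>"
    proof -
      obtain T where T: "open T" "S \<subseteq> T" "T - S \<in> lmeasurable" "emeasure lebesgue (T - S) < ennreal (c * \<mu>)"
        using sets_lebesgue_outer_open[of S "c * \<mu>"] S c \<mu> by (auto simp: fmeasurableD)
      have eq: "T = S \<union> (T - S)" using T by blast
      have T': "T \<in> lmeasurable" using S T(3) by (subst eq) (rule fmeasurable.Un)
      have "measure lebesgue (T - S) < c * \<mu>"
        using T(3,4) c \<mu> by (simp add: emeasure_eq_measure2 ennreal_less_iff)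
      moreover have "measure lebesgue T = \<mu> + measure lebesgue (T - S)"
        using S T(3) unfolding \<mu>_def by (subst eq, subst measure_Un3) auto
      ultimately show thesis using that[of T] T T' by simp
    qed
    define K where "K = {(x, d). x \<in> S \<and> 0 < d \<and> d \<le> s0 \<and> ball x d \<subseteq> T}"
    have fine: "\<exists>i. i \<in> K \<and> x \<in> ball (fst i) (snd i) \<and> snd i < d" if "x \<in> S" "0 < d" for x d
    proof -
      obtain e where e: "e > 0" "ball x e \<subseteq> T" using T \<open>x \<in> S\<close> by (meson open_contains_ball subsetD)
      define t where "t = min (min e s0) (d/2)"
      have "0 < t" "t \<le> s0" "t < d" "ball x t \<subseteq> T"
        using e s0 that unfolding t_def by (auto simp: min_def split: if_splits)
      then show ?thesis using that by (intro exI[of _ "(x, t)"]) (auto simp: K_def)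
    qed
    obtain C where C: "countable C" "C \<subseteq> K"
      and pw: "pairwise (\<lambda>i j. disjnt (ball (fst i) (snd i)) (ball (fst j) (snd j))) C"
      and ng: "negligible (S - (\<Union>i\<in>C. ball (fst i) (snd i)))"
      using Vitali_covering_theorem_balls[of S K fst snd, OF fine] by blast
    let ?B = "\<lambda>i. ball (fst i) (snd i)"
    let ?H = "\<lambda>i. ball (hole (fst i) (snd i)) (\<rho> * snd i / 2)"
    have HB: "?H i \<subseteq> ?B i" "?H i \<inter> S = {}" "?B i \<subseteq> T" if "i \<in> C" for i
    proof -
      have i: "fst i \<in> S" "0 < snd i" "snd i \<le> s0" and "?B i \<subseteq> T"
        using subsetD[OF C(2) that] by (auto simp: K_def split_beta)
      note h = hole[OF i]
      show "?B i \<subseteq> T" by fact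
      show "?H i \<inter> S = {}" using h by blast
      have r: "\<rho> * snd i / 2 \<le> snd i / 2" using \<rho> i by (simp add: mult_left_le_one_le)
      show "?H i \<subseteq> ?B i"
      proof
        fix z assume "z \<in> ?H i"
        then have "dist (hole (fst i) (snd i)) z < snd i / 2" using r by simp
        moreover have "dist (fst i) (hole (fst i) (snd i)) \<le> snd i / 2" using h by simp
        ultimately show "z \<in> ?B i"
          using dist_triangle[of "fst i" z "hole (fst i) (snd i)"] by simp
      qed
    qed
    have djB: "disjoint_family_on ?B C"
      using pw by (auto simp: disjoint_family_on_def pairwise_def disjnt_def)
    have djH: "disjoint_family_on ?H C"
      using djB HB(1) unfolding disjoint_family_on_def by blast
    have volH: "emeasure lebesgue (?H i) = ennreal c * emeasure lebesgue (?B i)" if "i \<in> C" for i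
    proof -
      have "0 < snd i" using that C by (auto simp: K_def)
      then have "emeasure lborel (?H i) = ennreal c * emeasure lborel (?B i)"
        using \<rho> c by (simp add: emeasure_ball c_def power_mult_distrib power_divide field_simps flip: ennreal_mult)
      then show ?thesis by simp
    qed
    have "emeasure lebesgue (\<Union>i\<in>C. ?H i) = (\<integral>\<^sup>+i. emeasure lebesgue (?H i) \<partial>count_space C)"
      by (rule emeasure_UN_countable[OF _ C(1) djH]) auto
    also have "\<dots> = (\<integral>\<^sup>+i. ennreal c * emeasure lebesgue (?B i) \<partial>count_space C)"
      using volH by (intro nn_integral_cong) simp
    also have "\<dots> = ennreal c * (\<integral>\<^sup>+i. emeasure lebesgue (?B i) \<partial>count_space C)"
      by (rule nn_integral_cmult) simp
    also have "(\<integral>\<^sup>+i. emeasure lebesgue (?B i) \<partial>count_space C) = emeasure lebesgue (\<Union>i\<in>C. ?B i)"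
      by (rule emeasure_UN_countable[OF _ C(1) djB, symmetric]) auto
    finally have eH: "emeasure lebesgue (\<Union>i\<in>C. ?H i) = ennreal c * emeasure lebesgue (\<Union>i\<in>C. ?B i)" .
    have mB: "(\<Union>i\<in>C. ?B i) \<in> lmeasurable" and mH: "(\<Union>i\<in>C. ?H i) \<in> lmeasurable"
    proof -
      have "(\<Union>i\<in>C. ?B i) \<in> sets lebesgue" "(\<Union>i\<in>C. ?H i) \<in> sets lebesgue"
        using C(1) by (auto intro!: sets.countable_UN')
      moreover have "(\<Union>i\<in>C. ?B i) \<subseteq> T" "(\<Union>i\<in>C. ?H i) \<subseteq> T" using HB by blast+
      ultimately show "(\<Union>i\<in>C. ?B i) \<in> lmeasurable" "(\<Union>i\<in>C. ?H i) \<in> lmeasurable"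
        using T(3) fmeasurableI2 by blast+
    qed
    have "measure lebesgue (\<Union>i\<in>C. ?H i) = c * measure lebesgue (\<Union>i\<in>C. ?B i)"
      using eH c by (simp add: measure_def enn2real_mult)
    moreover have "\<mu> \<le> measure lebesgue (\<Union>i\<in>C. ?B i)"
    proof -
      have "measure lebesgue S \<le> measure lebesgue ((\<Union>i\<in>C. ?B i) \<union> (S - (\<Union>i\<in>C. ?B i)))"
        using S mB ng by (intro measure_mono_fmeasurable) (auto intro: negligible_imp_measurable)
      also have "\<dots> \<le> measure lebesgue (\<Union>i\<in>C. ?B i) + measure lebesgue (S - (\<Union>i\<in>C. ?B i))"
        using S mB by (intro measure_Un_le) (auto simp: fmeasurableD)
      finally show ?thesis using ng by (simp add: \<mu>_def negligible_imp_measure0)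
    qed
    moreover have "measure lebesgue S + measure lebesgue (\<Union>i\<in>C. ?H i) \<le> measure lebesgue T"
    proof -
      have "S \<inter> (\<Union>i\<in>C. ?H i) = {}" using HB(2) by blast
      then have "measure lebesgue S + measure lebesgue (\<Union>i\<in>C. ?H i) = measure lebesgue (S \<union> (\<Union>i\<in>C. ?H i))"
        using S mH by (simp add: measure_Un3)
      also have "\<dots> \<le> measure lebesgue T"
      proof (rule measure_mono_fmeasurable)
        show "S \<union> (\<Union>i\<in>C. ?H i) \<subseteq> T" using T(2) HB by blast
        show "S \<union> (\<Union>i\<in>C. ?H i) \<in> sets lebesgue" using S mH by (blast intro: fmeasurableD)
      qed (rule T(3))
      finally show ?thesis .
    qed
    ultimately have "\<mu> + c * \<mu> \<le> measure lebesgue T"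
      using c unfolding \<mu>_def by (smt (verit) mult_left_mono)
    with T(4) show False by simp
  qed
  then show thesis using that by blast
qed

section \<open>Contact sets of semiconvex functions\<close>

text \<open>
  Equivalently, \<open>f + C \<bar>\<cdot>\<bar>\<^sup>2\<close> is convex. Stating the supporting paraboloids themselves is convenient because
  sup-convolutions come with them and because they pass to limits.
\<close>
definition semiconvex :: "real \<Rightarrow> ('a::real_inner \<Rightarrow> real) \<Rightarrow> bool" where
  "semiconvex C f \<longleftrightarrow> (\<forall>z. \<exists>p. \<forall>h. f z + p \<bullet> h - C * (norm h)\<^sup>2 \<le> f (z + h))"

text \<open>
  This identifies slopes: if a function is touched at a point by paraboloids from above and from below, their
  gradients agree.
\<close>
lemma linear_below_quadratic_eq_0:
  fixes v :: "'a::real_inner"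
  assumes "0 < r" and le: "\<And>h. norm h < r \<Longrightarrow> v \<bullet> h \<le> C * (norm h)\<^sup>2"
  shows "v = 0"
proof (rule ccontr)
  assume v: "v \<noteq> 0"
  define t where "t = min (r / (2 * norm v)) (1 / (2 * (\<bar>C\<bar> + 1)))"
  have t: "0 < t" "t * norm v < r" "t * (\<bar>C\<bar> + 1) < 1"
  proof -
    show "0 < t" using v assms by (simp add: t_def)
    have "t * norm v \<le> r / (2 * norm v) * norm v" by (intro mult_right_mono) (auto simp: t_def)
    also have "\<dots> < r" using v assms by (simp add: field_simps)
    finally show "t * norm v < r" .
    have "t * (\<bar>C\<bar> + 1) \<le> 1 / (2 * (\<bar>C\<bar> + 1)) * (\<bar>C\<bar> + 1)" by (intro mult_right_mono) (auto simp: t_def)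
    also have "\<dots> < 1" by (simp add: field_simps)
    finally show "t * (\<bar>C\<bar> + 1) < 1" .
  qed
  have "t * (norm v)\<^sup>2 \<le> C * (t * norm v)\<^sup>2"
    using le[of "t *\<^sub>R v"] t by (simp add: power2_norm_eq_inner)
  also have "\<dots> = (C * t) * (t * (norm v)\<^sup>2)" by (simp add: power2_eq_square algebra_simps)
  also have "\<dots> < 1 * (t * (norm v)\<^sup>2)"
  proof (rule mult_strict_right_mono)
    have "C * t \<le> (\<bar>C\<bar> + 1) * t" using t by (intro mult_right_mono) auto
    then show "C * t < 1" using t(3) by (simp add: mult.commute)
    show "0 < t * (norm v)\<^sup>2" using t v by simp
  qed
  finally show False by simp
qed

text \<open>
  The points where \<open>w\<close> agrees with its concave envelope over the ball, the envelope having a slope of size at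
  most \<open>s\<close> there.
\<close>
definition contact_set :: "real \<Rightarrow> real \<Rightarrow> ('a::real_inner \<Rightarrow> real) \<Rightarrow> 'a set" where
  "contact_set \<rho> s w =
     {z \<in> cball 0 \<rho>. \<exists>p\<in>cball 0 s. \<forall>z'\<in>cball 0 \<rho>. w z' \<le> w z + p \<bullet> (z' - z)}"

lemma contact_set_subset_ball:
  assumes "0 < \<rho>" and gap: "\<And>z. norm z = \<rho> \<Longrightarrow> w z + s * \<rho> < w 0"
  shows "contact_set \<rho> s w \<subseteq> ball 0 \<rho>"
proof
  fix z assume "z \<in> contact_set \<rho> s w"
  then obtain p where z: "norm z \<le> \<rho>" and p: "norm p \<le> s"
    and "\<forall>z'\<in>cball 0 \<rho>. w z' \<le> w z + p \<bullet> (z' - z)"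
    by (auto simp: contact_set_def)
  then have le: "w 0 \<le> w z + p \<bullet> (0 - z)" using \<open>0 < \<rho>\<close> by (meson centre_in_cball less_imp_le)
  have "norm z \<noteq> \<rho>"
  proof
    assume "norm z = \<rho>"
    moreover have "p \<bullet> (0 - z) \<le> norm p * norm z"
      using norm_cauchy_schwarz[of p "- z"] by simp
    moreover have "norm p * norm z \<le> s * norm z" using p by (simp add: mult_right_mono)
    ultimately show False using le gap[of z] by simp
  qed
  then show "z \<in> ball 0 \<rho>" using z by simp
qed

lemma compact_contact_set:
  fixes w :: "'a::euclidean_space \<Rightarrow> real"
  assumes "continuous_on UNIV w"
  shows "compact (contact_set \<rho> s w)"
proof -
  have cw: "continuous_on A (\<lambda>x. w (g x))" if "continuous_on A g" for A :: "('a \<times> 'a) set" and g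
    using continuous_on_compose2[OF assms that] by auto
  have "closed {q::'a \<times> 'a. w z' \<le> w (fst q) + snd q \<bullet> (z' - fst q)}" for z'
    by (intro closed_Collect_le continuous_intros cw)
  then have "closed (\<Inter>z'\<in>cball 0 \<rho>. {q::'a \<times> 'a. w z' \<le> w (fst q) + snd q \<bullet> (z' - fst q)})"
    by blast
  then have "compact ((cball 0 \<rho> \<times> cball 0 s) \<inter> (\<Inter>z'\<in>cball 0 \<rho>. {q::'a \<times> 'a. w z' \<le> w (fst q) + snd q \<bullet> (z' - fst q)}))"
    by (intro compact_Int_closed compact_Times) auto
  then have "compact (fst ` ((cball 0 \<rho> \<times> cball 0 s) \<inter> (\<Inter>z'\<in>cball 0 \<rho>. {q::'a \<times> 'a. w z' \<le> w (fst q) + snd q \<bullet> (z' - fst q)})))"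
    by (intro compact_continuous_image continuous_intros)
  also have "fst ` ((cball 0 \<rho> \<times> cball 0 s) \<inter> (\<Inter>z'\<in>cball 0 \<rho>. {q::'a \<times> 'a. w z' \<le> w (fst q) + snd q \<bullet> (z' - fst q)}))
     = contact_set \<rho> s w"
    by (force simp: contact_set_def)
  finally show ?thesis .
qed

text \<open>
  The idea of Aleksandrov, Bakelman and Pucci. For every slope \<open>p\<close> in the ball of radius \<open>s\<close> the function
  \<open>w - p\<close> has an interior maximum, so that the map from contact points to slopes is onto this ball. At contact
  points \<open>w\<close> lies between an affine function and a paraboloid, which makes the map locally Lipschitz. A Lipschitz
  image of a null set is null.
\<close>
lemma contact_set_not_negligible:
  fixes w :: "'a::euclidean_space \<Rightarrow> real"
  assumes cw: "continuous_on UNIV w" and sc: "semiconvex C w" and \<rho>: "0 < \<rho>" and s: "0 < s"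
    and gap: "\<And>z. norm z = \<rho> \<Longrightarrow> w z + s * \<rho> < w 0"
  shows "\<not> negligible (contact_set \<rho> s w)"
proof
  let ?K = "contact_set \<rho> s w"
  assume neg: "negligible ?K"
  have Kb: "?K \<subseteq> ball 0 \<rho>" using contact_set_subset_ball[of \<rho> w s] \<rho> gap by blast
  obtain q where q: "\<And>z h. w z + q z \<bullet> h - C * (norm h)\<^sup>2 \<le> w (z + h)"
    using sc unfolding semiconvex_def by metis
  have q_unique: "q z = p"
    if z: "z \<in> ball 0 \<rho>" and p: "\<And>z'. z' \<in> cball 0 \<rho> \<Longrightarrow> w z' \<le> w z + p \<bullet> (z' - z)" for z p
  proof -
    obtain e where e: "0 < e" "ball z e \<subseteq> ball 0 \<rho>" using z open_ball open_contains_ball by blast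
    have "q z - p = 0"
    proof (rule linear_below_quadratic_eq_0[OF e(1), of _ C])
      fix h :: 'a assume "norm h < e"
      then have "z + h \<in> ball z e" by (simp add: dist_norm)
      then have "z + h \<in> ball 0 \<rho>" using e(2) by blast
      then have "w (z + h) \<le> w z + p \<bullet> h" using p[of "z + h"] by simp
      with q[of z h] show "(q z - p) \<bullet> h \<le> C * (norm h)\<^sup>2" by (simp add: inner_diff_left)
    qed
    then show ?thesis by simp
  qed
  have upper: "w z' \<le> w z + q z \<bullet> (z' - z)" if "z \<in> ?K" "z' \<in> cball 0 \<rho>" for z z'
  proof -
    from that(1) obtain p where "\<And>z'. z' \<in> cball 0 \<rho> \<Longrightarrow> w z' \<le> w z + p \<bullet> (z' - z)"
      unfolding contact_set_def by blast
    with q_unique[of z p] Kb that show ?thesis by blast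
  qed
  have onto: "cball 0 s \<subseteq> q ` ?K"
  proof
    fix p :: 'a assume p: "p \<in> cball 0 s"
    have "continuous_on (cball 0 \<rho>) (\<lambda>z. w z - p \<bullet> z)"
      by (intro continuous_intros continuous_on_subset[OF cw]) auto
    then obtain z where z: "z \<in> cball 0 \<rho>" "\<And>z'. z' \<in> cball 0 \<rho> \<Longrightarrow> w z' - p \<bullet> z' \<le> w z - p \<bullet> z"
      using continuous_attains_sup[of "cball 0 \<rho>" "\<lambda>z. w z - p \<bullet> z"] \<rho> by auto
    have le: "w z' \<le> w z + p \<bullet> (z' - z)" if "z' \<in> cball 0 \<rho>" for z'
      using z(2)[OF that] by (simp add: inner_diff_right)
    have zK: "z \<in> ?K" unfolding contact_set_def using p z(1) le by blast
    then have "q z = p" using q_unique[OF _ le] Kb by blast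
    then show "p \<in> q ` ?K" using zK by blast
  qed
  have "negligible (q ` ?K)"
  proof (rule negligible_locally_Lipschitz_image[OF _ neg])
    show "DIM('a) \<le> DIM('a)" by simp
    fix x assume x: "x \<in> ?K"
    then have "x \<in> ball 0 \<rho>" using Kb by blast
    then obtain e where e: "0 < e" "ball x e \<subseteq> ball 0 \<rho>" using open_ball open_contains_ball by blast
    have "norm (q y - q x) \<le> (4 * C) * norm (y - x)" if "y \<in> ?K \<inter> ball x (e/2)" for y
    proof (cases "y = x \<or> q y = q x")
      case True
      moreover have "0 \<le> C"
      proof (rule ccontr)
        assume C: "\<not> 0 \<le> C"
        obtain b :: 'a where "b \<in> Basis" using nonempty_Basis by blast
        define t where "t = e / 2"
        have b: "x + t *\<^sub>R b \<in> cball 0 \<rho>"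
        proof -
          have "x + t *\<^sub>R b \<in> ball x e" using \<open>b \<in> Basis\<close> e by (simp add: dist_norm t_def)
          then show ?thesis using e by auto
        qed
        have "- C * t\<^sup>2 \<le> 0"
          using upper[OF x b] q[of x "t *\<^sub>R b"] \<open>b \<in> Basis\<close> by simp
        moreover have "0 < - C * t\<^sup>2" using C e by (intro mult_pos_pos) (auto simp: t_def)
        ultimately show False by simp
      qed
      ultimately show ?thesis by auto
    next
      case False
      define d where "d = norm (y - x)"
      define \<Delta> where "\<Delta> = q x - q y"
      \<comment> \<open>at twice the distance of the two points the difference of slopes dominates the quadratic error\<close>
      define v where "v = (2 * d / norm \<Delta>) *\<^sub>R \<Delta>"
      have d: "0 < d" and \<Delta>: "norm \<Delta> > 0" using False by (auto simp: d_def \<Delta>_def)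
      have nv: "norm v = 2 * d" using d \<Delta> by (simp add: v_def)
      have dv: "\<Delta> \<bullet> v = 2 * d * norm \<Delta>" using \<Delta> by (simp add: v_def flip: power2_norm_eq_inner) (simp add: power2_eq_square)
      have "x + v \<in> ball x e" using that nv by (simp add: dist_norm d_def norm_minus_commute)
      then have xv: "x + v \<in> cball 0 \<rho>" using e by auto
      have y: "y \<in> ?K" using that by blast
      then have y': "y \<in> cball 0 \<rho>" using Kb by auto
      have "w (x + v) \<le> w y + q y \<bullet> (x + v - y)" by (rule upper[OF y xv])
      moreover have "w y \<le> w x + q x \<bullet> (y - x)" by (rule upper[OF x y'])
      moreover have "w x + q x \<bullet> v - C * (norm v)\<^sup>2 \<le> w (x + v)" by (rule q)
      ultimately have "\<Delta> \<bullet> v \<le> \<Delta> \<bullet> (y - x) + C * (norm v)\<^sup>2"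
        by (simp add: \<Delta>_def inner_diff_left inner_diff_right inner_add_right)
      also have "\<Delta> \<bullet> (y - x) \<le> norm \<Delta> * d" unfolding d_def by (rule norm_cauchy_schwarz)
      finally have "d * norm \<Delta> \<le> d * (4 * C * d)"
        by (simp add: dv nv power2_eq_square algebra_simps)
      then have "norm \<Delta> \<le> 4 * C * d" using d by simp
      then show ?thesis by (simp add: \<Delta>_def d_def norm_minus_commute)
    qed
    then show "\<exists>T B. open T \<and> x \<in> T \<and> (\<forall>y\<in>?K \<inter> T. norm (q y - q x) \<le> B * norm (y - x))"
      using e by (intro exI[of _ "ball x (e/2)"] exI[of _ "4 * C"]) auto
  qed
  then have "negligible (cball (0::'a) s)" using onto negligible_subset by blast
  then have "negligible (ball (0::'a) s)" using ball_subset_cball negligible_subset by blast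
  then show False using s open_not_negligible[of "ball (0::'a) s"] by simp
qed

section \<open>Compactness of semiconvex functions\<close>

text \<open>
  A supporting paraboloid with a large slope would violate the bound at a fixed distance from its vertex.
\<close>
lemma semiconvex_bounded_imp_equi_Lipschitz:
  fixes F :: "nat \<Rightarrow> 'a::euclidean_space \<Rightarrow> real"
  assumes sc: "\<And>m. semiconvex C (F m)"
    and bd: "\<And>R. \<exists>B. \<forall>\<^sub>F m in sequentially. \<forall>h. norm h \<le> R \<longrightarrow> \<bar>F m h\<bar> \<le> B"
  shows "\<exists>L. \<forall>\<^sub>F m in sequentially. \<forall>x\<in>cball 0 R. \<forall>y\<in>cball 0 R. \<bar>F m x - F m y\<bar> \<le> L * norm (x - y)"
proof -
  define R' where "R' = \<bar>R\<bar> + 1"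
  obtain B where B: "\<forall>\<^sub>F m in sequentially. \<forall>h. norm h \<le> 2 * R' \<longrightarrow> \<bar>F m h\<bar> \<le> B" using bd by blast
  define P where "P = (2 * B + \<bar>C\<bar> * R'\<^sup>2) / R'"
  define L where "L = P + \<bar>C\<bar> * (2 * R')"
  have R': "0 < R'" "\<bar>R\<bar> \<le> R'" by (auto simp: R'_def)
  have "\<forall>\<^sub>F m in sequentially. \<forall>x\<in>cball 0 R. \<forall>y\<in>cball 0 R. \<bar>F m x - F m y\<bar> \<le> L * norm (x - y)"
    using B
  proof eventually_elim
    case (elim m)
    have one: "F m x - F m y \<le> L * norm (x - y)" if xy: "x \<in> cball 0 R" "y \<in> cball 0 R" for x y
    proof -
      obtain p where p: "\<And>h. F m x + p \<bullet> h - C * (norm h)\<^sup>2 \<le> F m (x + h)"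
        using sc unfolding semiconvex_def by metis
      have "norm p \<le> P"
      proof (cases "p = 0")
        case True
        have "0 \<le> B" using elim[rule_format, of 0] R' by auto
        then show ?thesis using True R' by (simp add: P_def)
      next
        case False
        define h where "h = (R' / norm p) *\<^sub>R p"
        have nh: "norm h = R'" using False R' by (simp add: h_def)
        have ph: "p \<bullet> h = R' * norm p"
          using False by (simp add: h_def flip: power2_norm_eq_inner) (simp add: power2_eq_square)
        have "norm (x + h) \<le> 2 * R'" using xy nh R' norm_triangle_ineq[of x h] by simp
        then have "\<bar>F m (x + h)\<bar> \<le> B" "\<bar>F m x\<bar> \<le> B" using elim xy R' by auto
        with p[of h] have "R' * norm p \<le> 2 * B + C * R'\<^sup>2" by (simp add: nh ph)
        also have "\<dots> \<le> 2 * B + \<bar>C\<bar> * R'\<^sup>2" by (simp add: mult_right_mono)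
        finally show ?thesis using R' by (simp add: P_def field_simps)
      qed
      then have "\<bar>p \<bullet> (y - x)\<bar> \<le> P * norm (y - x)"
        by (meson Cauchy_Schwarz_ineq2 mult_right_mono norm_ge_zero order_trans)
      moreover have "C * (norm (y - x))\<^sup>2 \<le> \<bar>C\<bar> * (2 * R') * norm (y - x)"
      proof -
        have "norm (y - x) \<le> 2 * R'" using xy R' norm_triangle_ineq4[of y x] by simp
        then have "norm (y - x) * norm (y - x) \<le> 2 * R' * norm (y - x)" by (simp add: mult_right_mono)
        then have "\<bar>C\<bar> * (norm (y - x))\<^sup>2 \<le> \<bar>C\<bar> * (2 * R' * norm (y - x))"
          unfolding power2_eq_square by (rule mult_left_mono) simp
        moreover have "C * (norm (y - x))\<^sup>2 \<le> \<bar>C\<bar> * (norm (y - x))\<^sup>2" by (simp add: mult_right_mono)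
        ultimately show ?thesis by (simp add: mult.assoc)
      qed
      ultimately show ?thesis
        using p[of "y - x"] by (simp add: L_def algebra_simps norm_minus_commute abs_le_iff)
    qed
    show ?case using one by (fastforce simp: abs_le_iff norm_minus_commute)
  qed
  then show ?thesis by blast
qed

lemma semiconvex_continuous_convergence:
  fixes F :: "nat \<Rightarrow> 'a::euclidean_space \<Rightarrow> real"
  assumes sc: "\<And>m. semiconvex C (F m)"
    and bd: "\<And>R. \<exists>B. \<forall>\<^sub>F m in sequentially. \<forall>h. norm h \<le> R \<longrightarrow> \<bar>F m h\<bar> \<le> B"
    and lim: "\<And>h. (\<lambda>m. F m h) \<longlonglongrightarrow> f h" and y: "y \<longlonglongrightarrow> y0"
  shows "(\<lambda>m. F m (y m)) \<longlonglongrightarrow> f y0"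
proof -
  define R where "R = norm y0 + 1"
  obtain L where L: "\<forall>\<^sub>F m in sequentially. \<forall>x\<in>cball 0 R. \<forall>y\<in>cball 0 R. \<bar>F m x - F m y\<bar> \<le> L * norm (x - y)"
    using semiconvex_bounded_imp_equi_Lipschitz[OF sc bd] by blast
  have "\<forall>\<^sub>F m in sequentially. dist (y m) y0 < 1" by (rule tendstoD[OF y]) simp
  then have "\<forall>\<^sub>F m in sequentially. norm (F m (y m) - F m y0) \<le> L * norm (y m - y0)"
    using L
  proof eventually_elim
    case (elim m)
    have "norm (y m) \<le> R" using elim(1) norm_triangle_sub[of "y m" y0] by (simp add: R_def dist_norm)
    with elim(2) show ?case by (simp add: R_def)
  qed
  moreover have "(\<lambda>m. L * norm (y m - y0)) \<longlonglongrightarrow> 0"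
    using y by (auto intro!: tendsto_eq_intros simp: LIM_zero_iff)
  ultimately have "(\<lambda>m. F m (y m) - F m y0) \<longlonglongrightarrow> 0"
    by (rule Lim_null_comparison)
  from tendsto_add[OF this lim[of y0]] show ?thesis by simp
qed

text \<open>
  The values on a countable dense set converge along a subsequence; the common local Lipschitz constants extend
  the convergence to all points.
\<close>
lemma semiconvex_convergent_subsequence:
  fixes F :: "nat \<Rightarrow> 'a::euclidean_space \<Rightarrow> real"
  assumes sc: "\<And>m. semiconvex C (F m)"
    and bd: "\<And>R. \<exists>B. \<forall>\<^sub>F m in sequentially. \<forall>h. norm h \<le> R \<longrightarrow> \<bar>F m h\<bar> \<le> B"
  obtains r f where "strict_mono (r :: nat \<Rightarrow> nat)" "\<And>h. (\<lambda>m. F (r m) h) \<longlonglongrightarrow> f h"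
proof -
  obtain D :: "'a set" where D: "countable D" "\<And>X. open X \<Longrightarrow> X \<noteq> {} \<Longrightarrow> \<exists>d\<in>D. d \<in> X"
    using countable_dense_exists by blast
  have "\<exists>b>0. \<forall>m. \<bar>F m x\<bar> \<le> b" for x
  proof -
    obtain B N where "\<And>m. m \<ge> N \<Longrightarrow> \<bar>F m x\<bar> \<le> B"
      using bd[of "norm x"] by (fastforce simp: eventually_sequentially)
    then have "Bseq (\<lambda>m. F (m + N) x)" by (intro BseqI'[of _ B]) auto
    then have "Bseq (\<lambda>m. F m x)" by (rule Bseq_offset)
    then show ?thesis by (auto simp: Bseq_def)
  qed
  then obtain b where b: "\<And>x. 0 < b x" "\<And>x m. \<bar>F m x\<bar> \<le> b x" by metis
  \<comment> \<open>dividing by the pointwise bounds provides the uniform bound that the selection principle asks for\<close>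
  have "norm (F m x / b x) \<le> 1" for m x using b by (simp add: abs_divide abs_of_pos)
  then obtain r where r: "strict_mono (r :: nat \<Rightarrow> nat)" "\<And>x. x \<in> D \<Longrightarrow> \<exists>l. (\<lambda>n. F (r n) x / b x) \<longlonglongrightarrow> l"
    using function_convergent_subsequence[of D "\<lambda>m x. F m x / b x" 1] D(1) by metis
  have conv_D: "convergent (\<lambda>n. F (r n) x)" if x: "x \<in> D" for x
  proof -
    obtain l where "(\<lambda>n. F (r n) x / b x) \<longlonglongrightarrow> l" using r(2) x by blast
    from tendsto_mult_right[OF this, of "b x"] b(1)[of x]
    have "(\<lambda>n. F (r n) x) \<longlonglongrightarrow> l * b x" by (simp add: less_imp_neq[symmetric])
    then show ?thesis by (auto simp: convergent_def)
  qed
  have "Cauchy (\<lambda>n. F (r n) x)" for x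
  proof (rule metric_CauchyI)
    fix e :: real assume e: "0 < e"
    obtain L where L: "\<forall>\<^sub>F m in sequentially. \<forall>u\<in>cball 0 (norm x + 1). \<forall>v\<in>cball 0 (norm x + 1). \<bar>F m u - F m v\<bar> \<le> L * norm (u - v)"
      using semiconvex_bounded_imp_equi_Lipschitz[OF sc bd] by blast
    define \<delta> where "\<delta> = min 1 (e / (4 * (\<bar>L\<bar> + 1)))"
    have \<delta>: "0 < \<delta>" "\<delta> \<le> 1" "\<bar>L\<bar> * \<delta> \<le> e / 4"
    proof -
      show "0 < \<delta>" "\<delta> \<le> 1" using e by (auto simp: \<delta>_def)
      have "\<bar>L\<bar> * \<delta> \<le> (\<bar>L\<bar> + 1) * (e / (4 * (\<bar>L\<bar> + 1)))"
        using e by (intro mult_mono) (auto simp: \<delta>_def)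
      also have "(\<bar>L\<bar> + 1) * (e / (4 * (\<bar>L\<bar> + 1))) = e / 4" by (simp add: field_simps)
      finally show "\<bar>L\<bar> * \<delta> \<le> e / 4" .
    qed
    obtain d where d: "d \<in> D" "dist x d < \<delta>" using D(2)[of "ball x \<delta>"] \<delta> by auto
    have dR: "d \<in> cball 0 (norm x + 1)"
      using d \<delta> norm_triangle_sub[of d x] by (simp add: dist_norm norm_minus_commute)
    have "\<forall>\<^sub>F m in sequentially. \<bar>F m x - F m d\<bar> \<le> e / 4"
      using L
    proof eventually_elim
      case (elim m)
      have "\<bar>F m x - F m d\<bar> \<le> L * norm (x - d)" using elim dR by auto
      also have "\<dots> \<le> \<bar>L\<bar> * \<delta>" using d by (intro mult_mono) (auto simp: dist_norm)
      finally show ?case using \<delta> by simp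
    qed
    then have "\<forall>\<^sub>F n in sequentially. \<bar>F (r n) x - F (r n) d\<bar> \<le> e / 4"
      using filterlim_subseq[OF r(1)] by (rule eventually_compose_filterlim)
    then obtain N where N: "\<And>n. n \<ge> N \<Longrightarrow> \<bar>F (r n) x - F (r n) d\<bar> \<le> e / 4"
      by (auto simp: eventually_sequentially)
    have "Cauchy (\<lambda>n. F (r n) d)" using conv_D[OF d(1)] by (simp add: convergent_Cauchy)
    then obtain N' where N': "\<And>m n. m \<ge> N' \<Longrightarrow> n \<ge> N' \<Longrightarrow> dist (F (r m) d) (F (r n) d) < e / 4"
      using metric_CauchyD[of _ "e/4"] e by fastforce
    show "\<exists>M. \<forall>m\<ge>M. \<forall>n\<ge>M. dist (F (r m) x) (F (r n) x) < e"
    proof (intro exI[of _ "max N N'"] allI impI)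
      fix m n assume "max N N' \<le> m" "max N N' \<le> n"
      then have "\<bar>F (r m) x - F (r m) d\<bar> \<le> e / 4" "\<bar>F (r n) x - F (r n) d\<bar> \<le> e / 4"
        "\<bar>F (r m) d - F (r n) d\<bar> < e / 4"
        using N[of m] N[of n] N'[of m n] by (auto simp: dist_real_def)
      then show "dist (F (r m) x) (F (r n) x) < e" using e unfolding dist_real_def by linarith
    qed
  qed
  then have "\<exists>l. (\<lambda>n. F (r n) x) \<longlonglongrightarrow> l" for x
    using Cauchy_convergent convergent_def by blast
  then show thesis using that r(1) by metis
qed

lemma semiconvex_continuous_convergence_subseq:
  fixes F :: "nat \<Rightarrow> 'a::euclidean_space \<Rightarrow> real"
  assumes sc: "\<And>m. semiconvex C (F m)"
    and bd: "\<And>R. \<exists>B. \<forall>\<^sub>F m in sequentially. \<forall>h. norm h \<le> R \<longrightarrow> \<bar>F m h\<bar> \<le> B"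
    and lim: "\<And>h. (\<lambda>m. F m h) \<longlonglongrightarrow> f h" and r: "strict_mono (r :: nat \<Rightarrow> nat)" and y: "y \<longlonglongrightarrow> y0"
  shows "(\<lambda>m. F (r m) (y m)) \<longlonglongrightarrow> f y0"
proof (rule semiconvex_continuous_convergence[OF sc _ _ y])
  show "\<exists>B. \<forall>\<^sub>F m in sequentially. \<forall>h. norm h \<le> R \<longrightarrow> \<bar>F (r m) h\<bar> \<le> B" for R
    using bd[of R] eventually_subseq[OF r] by blast
  show "(\<lambda>m. F (r m) h) \<longlonglongrightarrow> f h" for h
    using LIMSEQ_subseq_LIMSEQ[OF lim r] by (simp add: o_def)
qed

lemma quadratically_bounded_imp_locally_bounded:
  fixes F :: "nat \<Rightarrow> 'a::real_normed_vector \<Rightarrow> real"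
  assumes "0 \<le> C" "\<And>m h. \<bar>F m h\<bar> \<le> C * (norm h)\<^sup>2"
  shows "\<exists>B. \<forall>\<^sub>F m in sequentially. \<forall>h. norm h \<le> R \<longrightarrow> \<bar>F m h\<bar> \<le> B"
proof (intro exI[of _ "C * R\<^sup>2"] always_eventually allI impI)
  fix m h assume "norm (h::'a) \<le> R"
  then have "C * (norm h)\<^sup>2 \<le> C * R\<^sup>2" using assms(1) by (intro mult_left_mono power_mono) auto
  then show "\<bar>F m h\<bar> \<le> C * R\<^sup>2" using assms(2)[of m h] by simp
qed

section \<open>Blow-up at contact points\<close>

definition selfadjoint :: "('a::real_inner \<Rightarrow> 'a) \<Rightarrow> bool" where
  "selfadjoint M \<longleftrightarrow> linear M \<and> (\<forall>x y. x \<bullet> M y = M x \<bullet> y)"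

text \<open>
  Quadratic forms are represented by self-adjoint maps instead of matrices, since the doubled variable \<open>(x, y)\<close> is
  treated as a single vector of a product space.
\<close>
definition quad :: "('a::real_inner \<Rightarrow> 'a) \<Rightarrow> 'a \<Rightarrow> real" where
  "quad M z = (z \<bullet> M z) / 2"

lemma quad_scaleR: "selfadjoint M \<Longrightarrow> quad M (s *\<^sub>R z) = s\<^sup>2 * quad M z"
  by (simp add: selfadjoint_def quad_def linear_cmul power2_eq_square)

lemma quad_add: "selfadjoint M \<Longrightarrow> quad M (x + h) = quad M x + M x \<bullet> h + quad M h"
  by (simp add: selfadjoint_def quad_def linear_add inner_add_left inner_add_right inner_commute[of _ "M x"] field_simps)
     (metis inner_commute)

lemma selfadjoint_bound:
  fixes M :: "'a::euclidean_space \<Rightarrow> 'a"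
  assumes "selfadjoint M"
  obtains B where "0 < B" "\<And>x. norm (M x) \<le> B * norm x" "\<And>x. \<bar>quad M x\<bar> \<le> B * (norm x)\<^sup>2"
proof -
  obtain B where B: "0 < B" "\<And>x. norm (M x) \<le> B * norm x"
    using linear_bounded_pos[of M] assms unfolding selfadjoint_def by blast
  have "\<bar>quad M x\<bar> \<le> B * (norm x)\<^sup>2" for x
  proof -
    have "\<bar>x \<bullet> M x\<bar> \<le> norm x * norm (M x)" by (rule Cauchy_Schwarz_ineq2)
    also have "\<dots> \<le> norm x * (B * norm x)" by (intro mult_left_mono B) auto
    finally have "\<bar>x \<bullet> M x\<bar> \<le> B * (norm x)\<^sup>2" by (simp add: power2_eq_square algebra_simps)
    moreover have "0 \<le> B * (norm x)\<^sup>2" using B by simp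
    ultimately show ?thesis by (simp add: quad_def)
  qed
  then show thesis using B that by blast
qed

lemma quad_bound:
  fixes M :: "'a::euclidean_space \<Rightarrow> 'a"
  assumes "selfadjoint M" shows "\<exists>B>0. \<forall>x. \<bar>quad M x\<bar> \<le> B * (norm x)\<^sup>2"
  by (rule selfadjoint_bound[OF assms]) (intro exI conjI allI; assumption)

lemma continuous_on_quad:
  fixes M :: "'a::euclidean_space \<Rightarrow> 'a"
  assumes "selfadjoint M" shows "continuous_on A (quad M)"
proof -
  have "continuous_on A M"
    using assms by (simp add: selfadjoint_def linear_continuous_on linear_conv_bounded_linear)
  then have "continuous_on A (\<lambda>z. (z \<bullet> M z) / 2)" by (intro continuous_intros) auto
  then show ?thesis by (simp add: quad_def[abs_def])
qed

text \<open>
  Second-order blow-up: the affine part with slope \<open>p\<close> at \<open>z\<close> is removed and the rest is measured in units of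
  \<open>s\<^sup>2\<close>, so that quadratic forms are fixed points.
\<close>
definition rescale :: "('a::real_inner \<Rightarrow> real) \<Rightarrow> 'a \<Rightarrow> 'a \<Rightarrow> real \<Rightarrow> 'a \<Rightarrow> real" where
  "rescale f z p s h = (f (z + s *\<^sub>R h) - f z - s * (p \<bullet> h)) / s\<^sup>2"

lemma rescale_scaled:
  "0 < s \<Longrightarrow> s\<^sup>2 * rescale f z p s h = f (z + s *\<^sub>R h) - f z - s * (p \<bullet> h)"
  by (simp add: rescale_def)

lemma inner_slope_scaled: "0 < s \<Longrightarrow> s\<^sup>2 * (((q - p) /\<^sub>R s) \<bullet> h) = s * (q \<bullet> h) - s * (p \<bullet> h)"
  by (simp add: inner_diff_left power2_eq_square field_simps)

lemma rescale_lower: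
  assumes s: "0 < s" and le: "f (z + s *\<^sub>R k) + q \<bullet> (s *\<^sub>R h) - C * (norm (s *\<^sub>R h))\<^sup>2 \<le> f (z + s *\<^sub>R k + s *\<^sub>R h)"
  shows "rescale f z p s k + ((q - p) /\<^sub>R s) \<bullet> h - C * (norm h)\<^sup>2 \<le> rescale f z p s (k + h)"
proof -
  have "s\<^sup>2 * (rescale f z p s k + ((q - p) /\<^sub>R s) \<bullet> h - C * (norm h)\<^sup>2)
      = s\<^sup>2 * rescale f z p s k + s\<^sup>2 * (((q - p) /\<^sub>R s) \<bullet> h) - C * (s * norm h)\<^sup>2"
    by (simp add: algebra_simps power_mult_distrib)
  also have "\<dots> \<le> s\<^sup>2 * rescale f z p s (k + h)"
    unfolding rescale_scaled[OF s] inner_slope_scaled[OF s]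
    using le s by (simp add: algebra_simps inner_add_right)
  finally show ?thesis using s by simp
qed

lemma rescale_upper:
  assumes s: "0 < s" and M: "selfadjoint M" and le: "f (z + s *\<^sub>R k + s *\<^sub>R h) \<le> f (z + s *\<^sub>R k) + q \<bullet> (s *\<^sub>R h) + quad M (s *\<^sub>R h)"
  shows "rescale f z p s (k + h) \<le> rescale f z p s k + ((q - p) /\<^sub>R s) \<bullet> h + quad M h"
proof -
  have "s\<^sup>2 * rescale f z p s (k + h) \<le> s\<^sup>2 * rescale f z p s k + s\<^sup>2 * (((q - p) /\<^sub>R s) \<bullet> h) + s\<^sup>2 * quad M h"
    unfolding rescale_scaled[OF s] inner_slope_scaled[OF s]
    using le s unfolding quad_scaleR[OF M] by (simp add: algebra_simps inner_add_right)
  also have "\<dots> = s\<^sup>2 * (rescale f z p s k + ((q - p) /\<^sub>R s) \<bullet> h + quad M h)"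
    by (simp add: algebra_simps)
  finally show ?thesis using s by simp
qed

lemma semiconvex_rescale:
  assumes "semiconvex C f" "0 < s" shows "semiconvex C (rescale f z p s)"
  unfolding semiconvex_def
proof
  fix k
  obtain q where "\<And>h. f (z + s *\<^sub>R k) + q \<bullet> h - C * (norm h)\<^sup>2 \<le> f (z + s *\<^sub>R k + h)"
    using assms(1) unfolding semiconvex_def by metis
  then show "\<exists>g. \<forall>h. rescale f z p s k + g \<bullet> h - C * (norm h)\<^sup>2 \<le> rescale f z p s (k + h)"
    using rescale_lower[OF assms(2)] by metis
qed

text \<open>
  The slopes \<open>g m\<close> stay bounded because the supporting paraboloids obey the local bounds of \<open>F m\<close>. A cluster
  point of them serves as the slope for the limit function.
\<close>
lemma two_sided_touching_limit:
  fixes F :: "nat \<Rightarrow> 'a::euclidean_space \<Rightarrow> real"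
  assumes sc: "\<And>m. semiconvex C (F m)"
    and bd: "\<And>R. \<exists>B. \<forall>\<^sub>F m in sequentially. \<forall>h. norm h \<le> R \<longrightarrow> \<bar>F m h\<bar> \<le> B"
    and lim: "\<And>h. (\<lambda>m. F m h) \<longlonglongrightarrow> f h" and k: "k \<longlonglongrightarrow> x"
    and lower: "\<forall>\<^sub>F m in sequentially. \<forall>h. F m (k m) + g m \<bullet> h - C * (norm h)\<^sup>2 \<le> F m (k m + h)"
    and upper: "\<And>h. \<forall>\<^sub>F m in sequentially. F m (k m + h) \<le> F m (k m) + g m \<bullet> h + N h"
  shows "\<exists>p. \<forall>h. f x + p \<bullet> h - C * (norm h)\<^sup>2 \<le> f (x + h) \<and> f (x + h) \<le> f x + p \<bullet> h + N h"
proof -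
  obtain B where B: "\<forall>\<^sub>F m in sequentially. \<forall>h. norm h \<le> norm x + 2 \<longrightarrow> \<bar>F m h\<bar> \<le> B"
    using bd by blast
  have "\<forall>\<^sub>F m in sequentially. dist (k m) x < 1" by (rule tendstoD[OF k]) simp
  with B lower have "\<forall>\<^sub>F m in sequentially. norm (g m) \<le> 2 * B + \<bar>C\<bar>"
  proof eventually_elim
    case (elim m)
    have km: "norm (k m) \<le> norm x + 1" using elim(3) norm_triangle_sub[of "k m" x] by (simp add: dist_norm)
    show ?case
    proof (cases "g m = 0")
      case True
      have "0 \<le> B" using elim(1)[rule_format, of 0] by auto
      then show ?thesis using True by simp
    next
      case False
      define h where "h = g m /\<^sub>R norm (g m)"
      have h: "norm h = 1" "g m \<bullet> h = norm (g m)"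
        using False by (auto simp: h_def divide_simps simp flip: power2_norm_eq_inner) (simp add: power2_eq_square)
      have "norm (k m + h) \<le> norm x + 2" using km h norm_triangle_ineq[of "k m" h] by simp
      then have "\<bar>F m (k m + h)\<bar> \<le> B" "\<bar>F m (k m)\<bar> \<le> B" using elim(1) km by auto
      then show ?thesis using elim(2)[rule_format, of h] h by (simp add: abs_if split: if_splits)
    qed
  qed
  then obtain n0 where "\<And>m. m \<ge> n0 \<Longrightarrow> norm (g m) \<le> 2 * B + \<bar>C\<bar>"
    by (auto simp: eventually_sequentially)
  then have "bounded (range (\<lambda>m. g (m + n0)))"
    unfolding bounded_iff by (intro exI[of _ "2 * B + \<bar>C\<bar>"]) auto
  then obtain p r0 where r0: "strict_mono (r0::nat \<Rightarrow> nat)" "((\<lambda>m. g (m + n0)) \<circ> r0) \<longlonglongrightarrow> p"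
    using bounded_imp_convergent_subsequence by blast
  define r where "r = (\<lambda>m. r0 m + n0)"
  have r: "strict_mono r" using r0(1) by (auto simp: r_def strict_mono_def)
  have gr: "(\<lambda>m. g (r m)) \<longlonglongrightarrow> p" using r0(2) by (simp add: r_def o_def)
  have bd': "\<exists>B. \<forall>\<^sub>F m in sequentially. \<forall>h. norm h \<le> R \<longrightarrow> \<bar>F (r m) h\<bar> \<le> B" for R
    using bd[of R] eventually_subseq[OF r] by blast
  have cc: "(\<lambda>m. F (r m) (y m)) \<longlonglongrightarrow> f y0" if "y \<longlonglongrightarrow> y0" for y y0
    by (rule semiconvex_continuous_convergence[OF sc bd' _ that])
       (use lim r LIMSEQ_subseq_LIMSEQ[of _ _ r] in \<open>auto simp: o_def\<close>)
  have kr: "(\<lambda>m. k (r m)) \<longlonglongrightarrow> x" using k r LIMSEQ_subseq_LIMSEQ[of _ _ r] by (auto simp: o_def)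
  show ?thesis
  proof (intro exI[of _ p] allI conjI)
    fix h
    have l0: "(\<lambda>m. F (r m) (k (r m))) \<longlonglongrightarrow> f x" by (rule cc[OF kr])
    have l1: "(\<lambda>m. F (r m) (k (r m) + h)) \<longlonglongrightarrow> f (x + h)" by (intro cc tendsto_intros kr)
    show "f x + p \<bullet> h - C * (norm h)\<^sup>2 \<le> f (x + h)"
    proof (rule tendsto_le[OF _ l1])
      show "(\<lambda>m. F (r m) (k (r m)) + g (r m) \<bullet> h - C * (norm h)\<^sup>2) \<longlonglongrightarrow> f x + p \<bullet> h - C * (norm h)\<^sup>2"
        by (intro tendsto_intros l0 gr)
      show "\<forall>\<^sub>F m in sequentially. F (r m) (k (r m)) + g (r m) \<bullet> h - C * (norm h)\<^sup>2 \<le> F (r m) (k (r m) + h)"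
        using eventually_subseq[OF r lower] by eventually_elim blast
    qed simp
    show "f (x + h) \<le> f x + p \<bullet> h + N h"
    proof (rule tendsto_le[OF _ _ l1])
      show "(\<lambda>m. F (r m) (k (r m)) + g (r m) \<bullet> h + N h) \<longlonglongrightarrow> f x + p \<bullet> h + N h"
        by (intro tendsto_intros l0 gr)
      show "\<forall>\<^sub>F m in sequentially. F (r m) (k (r m) + h) \<le> F (r m) (k (r m)) + g (r m) \<bullet> h + N h"
        by (rule eventually_subseq[OF r upper])
    qed simp
  qed
qed

text \<open>
  At a contact point of \<open>f - quad M\<close> the affine function above and the paraboloid below have the same slope, so one
  slope \<open>Q\<close> bounds \<open>f\<close> from both sides.
\<close>
lemma contact_two_sided:
  fixes f :: "'a::euclidean_space \<Rightarrow> real"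
  assumes sc: "semiconvex C f" and M: "selfadjoint M" and B: "\<And>x. norm (M x) \<le> B * norm x" and "0 \<le> B"
    and y: "y \<in> contact_set \<rho> s (\<lambda>z. f z - quad M z)" and yb: "y \<in> ball 0 \<rho>"
  obtains Q where "norm Q \<le> s + B * \<rho>" "\<And>h. f y + Q \<bullet> h - C * (norm h)\<^sup>2 \<le> f (y + h)"
    "\<And>h. y + h \<in> cball 0 \<rho> \<Longrightarrow> f (y + h) \<le> f y + Q \<bullet> h + quad M h"
proof -
  obtain q where q: "norm q \<le> s" "\<And>z'. z' \<in> cball 0 \<rho> \<Longrightarrow> f z' - quad M z' \<le> f y - quad M y + q \<bullet> (z' - y)"
    using y unfolding contact_set_def by auto
  obtain p where p: "\<And>h. f y + p \<bullet> h - C * (norm h)\<^sup>2 \<le> f (y + h)"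
    using sc unfolding semiconvex_def by metis
  define Q where "Q = q + M y"
  have up: "f (y + h) \<le> f y + Q \<bullet> h + quad M h" if "y + h \<in> cball 0 \<rho>" for h
    using q(2)[OF that] unfolding quad_add[OF M] Q_def by (simp add: inner_add_left)
  obtain B' where B': "\<And>x. \<bar>quad M x\<bar> \<le> B' * (norm x)\<^sup>2" using quad_bound[OF M] by blast
  obtain e where e: "0 < e" "ball y e \<subseteq> ball 0 \<rho>" using yb open_ball open_contains_ball by blast
  have "p - Q = 0"
  proof (rule linear_below_quadratic_eq_0[OF e(1), of _ "C + B'"])
    fix h :: 'a assume "norm h < e"
    then have "y + h \<in> ball y e" by (simp add: dist_norm)
    then have "y + h \<in> cball 0 \<rho>" using e(2) by auto
    then show "(p - Q) \<bullet> h \<le> (C + B') * (norm h)\<^sup>2"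
      using up[of h] p[of h] B'[of h] by (simp add: inner_diff_left algebra_simps abs_le_iff)
  qed
  then have "p = Q" by simp
  moreover have "norm Q \<le> s + B * \<rho>"
  proof -
    have "norm Q \<le> norm q + norm (M y)" unfolding Q_def by (rule norm_triangle_ineq)
    moreover have "norm (M y) \<le> B * \<rho>" using B[of y] yb \<open>0 \<le> B\<close> by (smt (verit) mem_ball_0 mult_left_mono)
    ultimately show ?thesis using q by simp
  qed
  ultimately show thesis using that[of Q] p up by blast
qed

text \<open>
  Contact points are chosen so dense in balls of radius \<open>t m\<close> that they still become dense after zooming in
  to the smaller scale \<open>\<sigma> m = t m / (m + 1)\<close>, where the ball of radius \<open>t m\<close> fills the whole space in the limit. The
  two-sided bound, available at contact points only, therefore holds at every point for the limit function.
\<close>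
lemma blow_up_at_contact_points:
  fixes f :: "'a::euclidean_space \<Rightarrow> real"
  assumes cf: "continuous_on UNIV f" and sc: "semiconvex C f" and M: "selfadjoint M"
    and B: "\<And>x. norm (M x) \<le> B * norm x" "0 \<le> B" and \<rho>: "0 < \<rho>" and s: "0 < s"
    and gap: "\<And>z. norm z = \<rho> \<Longrightarrow> f z - quad M z + s * \<rho> < f 0"
  obtains z P \<sigma> f0 where "\<And>m::nat. norm (z m) < \<rho>" "\<And>m. norm (P m) \<le> s + B * \<rho>" "\<And>m. 0 < \<sigma> m" "\<sigma> \<longlonglongrightarrow> 0"
    "\<And>R. \<exists>B. \<forall>\<^sub>F m in sequentially. \<forall>h. norm h \<le> R \<longrightarrow> \<bar>rescale f (z m) (P m) (\<sigma> m) h\<bar> \<le> B"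
    "\<And>h. (\<lambda>m. rescale f (z m) (P m) (\<sigma> m) h) \<longlonglongrightarrow> f0 h"
    "\<And>x. \<exists>p. \<forall>h. f0 x + p \<bullet> h - C * (norm h)\<^sup>2 \<le> f0 (x + h) \<and> f0 (x + h) \<le> f0 x + p \<bullet> h + quad M h"
proof -
  let ?w = "\<lambda>z. f z - quad M z"
  let ?K = "contact_set \<rho> s ?w"
  obtain B' where B': "\<And>x. \<bar>quad M x\<bar> \<le> B' * (norm x)\<^sup>2" using quad_bound[OF M] by blast
  have cw: "continuous_on UNIV ?w" by (intro continuous_intros cf continuous_on_quad[OF M])
  have scw: "semiconvex (C + B') ?w"
    unfolding semiconvex_def
  proof
    fix z
    obtain p where p: "\<And>h. f z + p \<bullet> h - C * (norm h)\<^sup>2 \<le> f (z + h)"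
      using sc unfolding semiconvex_def by metis
    have "?w z + (p - M z) \<bullet> h - (C + B') * (norm h)\<^sup>2 \<le> ?w (z + h)" for h
      using p[of h] B'[of h] unfolding quad_add[OF M] by (simp add: inner_diff_left algebra_simps abs_le_iff)
    then show "\<exists>p. \<forall>h. ?w z + p \<bullet> h - (C + B') * (norm h)\<^sup>2 \<le> ?w (z + h)" by blast
  qed
  have gap': "?w z + s * \<rho> < ?w 0" if "norm z = \<rho>" for z
    using gap[OF that] by (simp add: quad_def)
  have Kc: "compact ?K" by (rule compact_contact_set[OF cw])
  have Kb: "?K \<subseteq> ball 0 \<rho>" using contact_set_subset_ball[of \<rho> ?w s] \<rho> gap' by blast
  have Kn: "\<not> negligible ?K" using contact_set_not_negligible[OF cw scw \<rho> s gap'] by blast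
  obtain d0 where d0: "0 < d0" "(\<Union>x\<in>?K. ball x d0) \<subseteq> ball 0 \<rho>"
    using compact_subset_open_imp_ball_epsilon_subset[OF Kc open_ball Kb] by blast
  define s0 where "s0 = min (d0/2) 1"
  have s0: "0 < s0" "s0 \<le> 1" "s0 < d0" using d0 by (auto simp: s0_def)
  \<comment> \<open>relative density \<open>1 / (m + 1)\<^sup>2\<close> at scale \<open>t\<close> is relative density \<open>1 / (m + 1)\<close> at scale \<open>t / (m + 1)\<close>\<close>
  define good where "good = (\<lambda>(m::nat) x t. x \<in> ?K \<and> 0 < t \<and> t \<le> s0 \<and>
      (\<forall>y\<in>cball x t. \<exists>z\<in>?K. dist y z \<le> (1 / (real m + 1)\<^sup>2) * t))"
  have "\<exists>x t. good m x t" for m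
  proof -
    have "0 < 1 / (real m + 1)\<^sup>2" "1 / (real m + 1)\<^sup>2 \<le> 1" by (auto simp: field_simps)
    then show ?thesis
      by (rule nonnegligible_dense_at_small_scale[OF lmeasurable_compact[OF Kc] Kn _ _ s0(1)]) (unfold good_def, blast)+
  qed
  then have "\<exists>q. good m (fst q) (snd q)" for m by (metis fst_conv snd_conv)
  then obtain q where q: "\<And>m. good m (fst (q m)) (snd (q m))" by metis
  define x where "x = (\<lambda>m. fst (q m))"
  define t where "t = (\<lambda>m. snd (q m))"
  have x: "x m \<in> ?K" and t: "0 < t m" "t m \<le> s0"
    and dense: "\<And>y. y \<in> cball (x m) (t m) \<Longrightarrow> \<exists>z\<in>?K. dist y z \<le> (1 / (real m + 1)\<^sup>2) * t m" for m
    using q[of m] by (auto simp: good_def x_def t_def)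
  have ball: "cball (x m) (t m) \<subseteq> cball 0 \<rho>" for m
  proof -
    have "cball (x m) (t m) \<subseteq> ball (x m) d0" using t[of m] s0 by auto
    then show ?thesis using d0(2) x[of m] by force
  qed
  define slope where "slope = (\<lambda>y Q. norm Q \<le> s + B * \<rho> \<and> (\<forall>h. f y + Q \<bullet> h - C * (norm h)\<^sup>2 \<le> f (y + h)) \<and>
      (\<forall>h. y + h \<in> cball 0 \<rho> \<longrightarrow> f (y + h) \<le> f y + Q \<bullet> h + quad M h))"
  have "\<exists>Q. slope y Q" if y: "y \<in> ?K" for y
  proof -
    have "y \<in> ball 0 \<rho>" using Kb y by blast
    show ?thesis
      by (rule contact_two_sided[OF sc M B y \<open>y \<in> ball 0 \<rho>\<close>]) (auto simp: slope_def)
  qed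
  then obtain Q where slope: "\<And>y. y \<in> ?K \<Longrightarrow> slope y (Q y)" by metis
  have Q: "norm (Q y) \<le> s + B * \<rho>"
    "f y + Q y \<bullet> h - C * (norm h)\<^sup>2 \<le> f (y + h)"
    "y + h \<in> cball 0 \<rho> \<Longrightarrow> f (y + h) \<le> f y + Q y \<bullet> h + quad M h" if "y \<in> ?K" for y h
    using slope[OF that] unfolding slope_def by blast+
  define \<sigma> where "\<sigma> = (\<lambda>m. t m / (real m + 1))"
  have \<sigma>: "0 < \<sigma> m" for m using t[of m] by (simp add: \<sigma>_def)
  have \<sigma>0: "\<sigma> \<longlonglongrightarrow> 0"
  proof (rule Lim_null_comparison)
    have "norm (\<sigma> m) \<le> 1 / (real m + 1)" for m
      using t[of m] s0 by (auto simp: \<sigma>_def divide_simps)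
    then show "\<forall>\<^sub>F m in sequentially. norm (\<sigma> m) \<le> 1 / (real m + 1)" by simp
    show "(\<lambda>m. 1 / (real m + 1)) \<longlonglongrightarrow> 0"
      using LIMSEQ_inverse_real_of_nat by (simp add: inverse_eq_divide add.commute)
  qed
  define F where "F = (\<lambda>m. rescale f (x m) (Q (x m)) (\<sigma> m))"
  have inb: "x m + \<sigma> m *\<^sub>R h \<in> cball (x m) (t m)" if "norm h \<le> real m + 1" for m h
  proof -
    have "\<sigma> m * norm h \<le> \<sigma> m * (real m + 1)" using that \<sigma>[of m] by (intro mult_left_mono) auto
    then show ?thesis using t(1)[of m] by (simp add: dist_norm \<sigma>_def abs_of_pos)
  qed
  have scF: "semiconvex C (F m)" for m unfolding F_def by (rule semiconvex_rescale[OF sc \<sigma>])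
  have F0: "F m 0 = 0" for m by (simp add: F_def rescale_def)
  have bdF: "\<exists>B. \<forall>\<^sub>F m in sequentially. \<forall>h. norm h \<le> R \<longrightarrow> \<bar>F m h\<bar> \<le> B" for R
  proof -
    obtain n where n: "R \<le> real n" using real_arch_simple by blast
    have "\<bar>F m h\<bar> \<le> (\<bar>C\<bar> + \<bar>B'\<bar>) * R\<^sup>2" if m: "m \<ge> n" and h: "norm h \<le> R" for m h
    proof -
      have hm: "norm h \<le> real m + 1" using h m n by simp
      have "F m (0 + h) \<le> F m 0 + ((Q (x m) - Q (x m)) /\<^sub>R \<sigma> m) \<bullet> h + quad M h"
      proof -
        have "x m + \<sigma> m *\<^sub>R h \<in> cball 0 \<rho>" using inb[OF hm] ball[of m] by blast
        from Q(3)[OF x this] show ?thesis unfolding F_def by (intro rescale_upper[OF \<sigma> M]) simp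
      qed
      moreover have "F m 0 + ((Q (x m) - Q (x m)) /\<^sub>R \<sigma> m) \<bullet> h - C * (norm h)\<^sup>2 \<le> F m (0 + h)"
        unfolding F_def by (rule rescale_lower[OF \<sigma>]) (use Q(2)[OF x[of m], of "\<sigma> m *\<^sub>R h"] in simp)
      moreover have "(norm h)\<^sup>2 \<le> R\<^sup>2" using h by (simp add: power_mono)
      then have "\<bar>C\<bar> * (norm h)\<^sup>2 \<le> \<bar>C\<bar> * R\<^sup>2" "\<bar>B'\<bar> * (norm h)\<^sup>2 \<le> \<bar>B'\<bar> * R\<^sup>2" by (auto intro: mult_left_mono)
      moreover have "C * (norm h)\<^sup>2 \<le> \<bar>C\<bar> * (norm h)\<^sup>2" "B' * (norm h)\<^sup>2 \<le> \<bar>B'\<bar> * (norm h)\<^sup>2"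
        by (auto intro: mult_right_mono)
      moreover have "0 \<le> \<bar>C\<bar> * R\<^sup>2" "0 \<le> \<bar>B'\<bar> * R\<^sup>2" by auto
      moreover have "\<bar>quad M h\<bar> \<le> B' * (norm h)\<^sup>2" by (rule B')
      ultimately have "F m h \<le> \<bar>C\<bar> * R\<^sup>2 + \<bar>B'\<bar> * R\<^sup>2" "- F m h \<le> \<bar>C\<bar> * R\<^sup>2 + \<bar>B'\<bar> * R\<^sup>2"
        unfolding F0 add_0_left diff_self scaleR_zero_right inner_zero_left by linarith+
      then show ?thesis by (simp add: distrib_right abs_le_iff)
    qed
    then show ?thesis unfolding eventually_sequentially by blast
  qed
  obtain r f0 where r: "strict_mono (r :: nat \<Rightarrow> nat)" and f0: "\<And>h. (\<lambda>m. F (r m) h) \<longlonglongrightarrow> f0 h"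
    using semiconvex_convergent_subsequence[of C F, OF scF bdF] by blast
  have bdr: "\<exists>B. \<forall>\<^sub>F m in sequentially. \<forall>h. norm h \<le> R \<longrightarrow> \<bar>F (r m) h\<bar> \<le> B" for R
    using bdF[of R] eventually_subseq[OF r] by blast
  have two: "\<exists>p. \<forall>h. f0 y + p \<bullet> h - C * (norm h)\<^sup>2 \<le> f0 (y + h) \<and> f0 (y + h) \<le> f0 y + p \<bullet> h + quad M h" for y
  proof -
    define near where "near = (\<lambda>(m::nat) k. norm y \<le> real m + 1 \<longrightarrow> x m + \<sigma> m *\<^sub>R k \<in> ?K \<and> norm (k - y) \<le> 1 / (real m + 1))"
    have "\<exists>k. near m k" for m
    proof (cases "norm y \<le> real m + 1")
      case True
      obtain u where u: "u \<in> ?K" "dist (x m + \<sigma> m *\<^sub>R y) u \<le> (1 / (real m + 1)\<^sup>2) * t m"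
        using dense[OF inb[OF True]] by blast
      define k where "k = (u - x m) /\<^sub>R \<sigma> m"
      have "x m + \<sigma> m *\<^sub>R k = u" using \<sigma>[of m] by (simp add: k_def)
      moreover have "norm (k - y) \<le> 1 / (real m + 1)"
      proof -
        have "\<sigma> m *\<^sub>R (k - y) = u - (x m + \<sigma> m *\<^sub>R y)"
          unfolding \<open>x m + \<sigma> m *\<^sub>R k = u\<close>[symmetric] by (simp add: scaleR_diff_right)
        then have "norm (\<sigma> m *\<^sub>R (k - y)) \<le> (1 / (real m + 1)\<^sup>2) * t m"
          using u(2) by (simp add: dist_norm norm_minus_commute)
        also have "\<dots> = \<sigma> m * (1 / (real m + 1))" by (simp add: \<sigma>_def power2_eq_square)
        finally have "\<sigma> m * norm (k - y) \<le> \<sigma> m * (1 / (real m + 1))" using \<sigma>[of m] by simp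
        then show ?thesis using \<sigma>[of m] by (simp only: mult_le_cancel_left_pos)
      qed
      ultimately show ?thesis using u unfolding near_def by blast
    qed (auto simp: near_def)
    then obtain k where "\<And>m. near m (k m)" by metis
    then have k: "\<And>m. norm y \<le> real m + 1 \<Longrightarrow> x m + \<sigma> m *\<^sub>R k m \<in> ?K \<and> norm (k m - y) \<le> 1 / (real m + 1)"
      unfolding near_def by blast
    define g where "g = (\<lambda>m. (Q (x m + \<sigma> m *\<^sub>R k m) - Q (x m)) /\<^sub>R \<sigma> m)"
    obtain n where n: "norm y \<le> real n" using real_arch_simple by blast
    have klim: "k \<longlonglongrightarrow> y"
    proof -
      have "(\<lambda>m. k m - y) \<longlonglongrightarrow> 0"
      proof (rule Lim_null_comparison)
        show "\<forall>\<^sub>F m in sequentially. norm (k m - y) \<le> 1 / (real m + 1)"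
          unfolding eventually_sequentially using k n by (intro exI[of _ n]) auto
        show "(\<lambda>m. 1 / (real m + 1)) \<longlonglongrightarrow> 0"
          using LIMSEQ_inverse_real_of_nat by (simp add: inverse_eq_divide add.commute)
      qed
      then show ?thesis by (simp add: LIM_zero_iff)
    qed
    have low: "\<forall>\<^sub>F m in sequentially. \<forall>h. F m (k m) + g m \<bullet> h - C * (norm h)\<^sup>2 \<le> F m (k m + h)"
      unfolding eventually_sequentially
    proof (intro exI[of _ n] allI impI)
      fix m h assume "n \<le> m"
      then have "x m + \<sigma> m *\<^sub>R k m \<in> ?K" using k n by simp
      then show "F m (k m) + g m \<bullet> h - C * (norm h)\<^sup>2 \<le> F m (k m + h)"
        unfolding F_def g_def by (intro rescale_lower[OF \<sigma>] Q(2))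
    qed
    have up: "\<forall>\<^sub>F m in sequentially. F m (k m + h) \<le> F m (k m) + g m \<bullet> h + quad M h" for h
    proof -
      obtain n' where n': "norm y + norm h \<le> real n'" using real_arch_simple by blast
      show ?thesis unfolding eventually_sequentially
      proof (intro exI[of _ "n + n'"] allI impI)
        fix m assume m: "n + n' \<le> m"
        then have K: "x m + \<sigma> m *\<^sub>R k m \<in> ?K" and kn: "norm (k m - y) \<le> 1 / (real m + 1)" using k[of m] n by auto
        have "1 / (real m + 1) \<le> 1" by simp
        then have "norm (k m + h) \<le> real m + 1"
          using kn n' m norm_triangle_ineq[of "k m" h] norm_triangle_sub[of "k m" y] by linarith
        then have "x m + \<sigma> m *\<^sub>R (k m + h) \<in> cball 0 \<rho>" using inb ball by blast
        then show "F m (k m + h) \<le> F m (k m) + g m \<bullet> h + quad M h"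
          unfolding F_def g_def by (intro rescale_upper[OF \<sigma> M] Q(3)[OF K]) (simp add: scaleR_add_right add.assoc)
      qed
    qed
    show ?thesis
    proof (rule two_sided_touching_limit[where F = "\<lambda>m. F (r m)" and k = "\<lambda>m. k (r m)" and g = "\<lambda>m. g (r m)"])
      show "(\<lambda>m. k (r m)) \<longlonglongrightarrow> y" using klim r LIMSEQ_subseq_LIMSEQ[of _ _ r] by (auto simp: o_def)
      show "\<forall>\<^sub>F m in sequentially. \<forall>h. F (r m) (k (r m)) + g (r m) \<bullet> h - C * (norm h)\<^sup>2 \<le> F (r m) (k (r m) + h)"
        by (rule eventually_subseq[OF r low])
      show "\<forall>\<^sub>F m in sequentially. F (r m) (k (r m) + h) \<le> F (r m) (k (r m)) + g (r m) \<bullet> h + quad M h" for h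
        by (rule eventually_subseq[OF r up])
    qed (use scF bdr f0 in auto)
  qed
  show thesis
  proof (rule that[of "\<lambda>m. x (r m)" "\<lambda>m. Q (x (r m))" "\<lambda>m. \<sigma> (r m)" f0])
    show "norm (x (r m)) < \<rho>" for m using subsetD[OF Kb x[of "r m"]] by simp
    show "norm (Q (x (r m))) \<le> s + B * \<rho>" for m using Q(1) x by blast
    show "0 < \<sigma> (r m)" for m by (rule \<sigma>)
    show "(\<lambda>m. \<sigma> (r m)) \<longlonglongrightarrow> 0" using \<sigma>0 r LIMSEQ_subseq_LIMSEQ[of _ _ r] by (auto simp: o_def)
    show "\<exists>B. \<forall>\<^sub>F m in sequentially. \<forall>h. norm h \<le> R \<longrightarrow> \<bar>rescale f (x (r m)) (Q (x (r m))) (\<sigma> (r m)) h\<bar> \<le> B" for R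
      using bdr[of R] by (simp add: F_def)
    show "(\<lambda>m. rescale f (x (r m)) (Q (x (r m))) (\<sigma> (r m)) h) \<longlonglongrightarrow> f0 h" for h
      using f0[of h] by (simp add: F_def)
  qed (rule two)
qed

section \<open>Quadratic forms as extremal blow-ups\<close>

definition second_diff :: "('a::real_vector \<Rightarrow> real) \<Rightarrow> 'a \<Rightarrow> 'a \<Rightarrow> real" where
  "second_diff f x v = f (x + v) + f (x - v) - 2 * f x"

text \<open>
  A quantitative form of being of class \<open>C\<^sup>1\<^sup>,\<^sup>1\<close> on the whole space.
\<close>
definition taylor_bounded :: "real \<Rightarrow> ('a::real_inner \<Rightarrow> real) \<Rightarrow> bool" where
  "taylor_bounded C f \<longleftrightarrow> (\<forall>z. \<exists>p. \<forall>h. \<bar>f (z + h) - f z - p \<bullet> h\<bar> \<le> C * (norm h)\<^sup>2)"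

text \<open>
  Closure under limits concerns sequences that vanish to second order at the origin: this normalisation is what
  \<^const>\<open>rescale\<close> produces when \<open>p\<close> is the gradient at \<open>z\<close>, and it supplies the local bounds needed for compactness.
\<close>
definition blowup_closed :: "real \<Rightarrow> ('a::real_inner \<Rightarrow> real) set \<Rightarrow> bool" where
  "blowup_closed C G \<longleftrightarrow>
     (\<forall>f\<in>G. taylor_bounded C f) \<and>
     (\<forall>f\<in>G. \<forall>z p s. 0 < s \<longrightarrow> rescale f z p s \<in> G) \<and>
     (\<forall>F f. (\<forall>m::nat. F m \<in> G) \<longrightarrow> (\<forall>m h. \<bar>F m h\<bar> \<le> C * (norm h)\<^sup>2) \<longrightarrow> (\<forall>h. (\<lambda>m. F m h) \<longlonglongrightarrow> f h) \<longrightarrow> f \<in> G)"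

lemma second_diff_minus: "second_diff f x (- v) = second_diff f x v"
  by (simp add: second_diff_def)

lemma second_diff_rescale:
  assumes "0 < s" shows "second_diff (rescale f z p s) x v = second_diff f (z + s *\<^sub>R x) (s *\<^sub>R v) / s\<^sup>2"
  unfolding second_diff_def rescale_def by (simp add: algebra_simps inner_add_right inner_diff_right add_divide_distrib diff_divide_distrib)

lemma second_diff_bound:
  assumes "taylor_bounded C f"
  shows "\<bar>second_diff f x v\<bar> \<le> 2 * C * (norm v)\<^sup>2"
proof -
  obtain p where p: "\<And>h. \<bar>f (x + h) - f x - p \<bullet> h\<bar> \<le> C * (norm h)\<^sup>2"
    using assms unfolding taylor_bounded_def by metis
  show ?thesis using p[of v] p[of "- v"] by (simp add: second_diff_def)
qed

lemma taylor_bounded_imp_semiconvex: "taylor_bounded C f \<Longrightarrow> semiconvex C f"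
proof -
  assume tb: "taylor_bounded C f"
  show "semiconvex C f"
    unfolding semiconvex_def
  proof
    fix z
    obtain p where p: "\<And>h. \<bar>f (z + h) - f z - p \<bullet> h\<bar> \<le> C * (norm h)\<^sup>2"
      using tb unfolding taylor_bounded_def by metis
    have "f z + p \<bullet> h - C * (norm h)\<^sup>2 \<le> f (z + h)" for h using p[of h] by (simp add: abs_le_iff)
    then show "\<exists>p. \<forall>h. f z + p \<bullet> h - C * (norm h)\<^sup>2 \<le> f (z + h)" by blast
  qed
qed

lemma taylor_bounded_continuous:
  fixes f :: "'a::euclidean_space \<Rightarrow> real"
  assumes "taylor_bounded C f" shows "continuous_on UNIV f"
proof -
  have "isCont f x" for x
  proof -
    obtain p where p: "\<And>h. \<bar>f (x + h) - f x - p \<bullet> h\<bar> \<le> C * (norm h)\<^sup>2"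
      using assms unfolding taylor_bounded_def by metis
    have "((\<lambda>h. (f (x + h) - f x - p \<bullet> h)) \<longlongrightarrow> 0) (at 0)"
    proof (rule Lim_null_comparison)
      show "\<forall>\<^sub>F h in at 0. norm (f (x + h) - f x - p \<bullet> h) \<le> C * (norm h)\<^sup>2" using p by simp
      show "((\<lambda>h. C * (norm h)\<^sup>2) \<longlongrightarrow> 0) (at (0::'a))" by (auto intro!: tendsto_eq_intros)
    qed
    moreover have "((\<lambda>h. f x + p \<bullet> h) \<longlongrightarrow> f x + p \<bullet> 0) (at 0)" by (intro tendsto_intros)
    ultimately have "((\<lambda>h. f (x + h)) \<longlongrightarrow> f x) (at 0)"
      using tendsto_add by fastforce
    then show ?thesis by (simp add: isCont_def LIM_offset_zero_iff)
  qed
  then show ?thesis by (simp add: continuous_at_imp_continuous_on)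
qed

lemma convex_sequence_chord:
  fixes E :: "nat \<Rightarrow> real"
  assumes "E 0 = 0" and conv: "\<And>i. E i + E (i + 2) \<ge> 2 * E (i + 1)" and "n \<le> J" "0 < J"
  shows "real J * E n \<le> real n * E J"
proof -
  have step: "real (Suc n) * E n \<le> real n * E (Suc n)" for n
  proof (induction n)
    case 0
    then show ?case using assms(1) by simp
  next
    case (Suc n)
    have "real (Suc n) * (2 * E (Suc n) - E n) \<le> real (Suc n) * E (Suc (Suc n))"
      using conv[of n] by (intro mult_left_mono) auto
    then show ?case using Suc by (simp add: algebra_simps)
  qed
  have "n = 0 \<or> real J * E n \<le> real n * E J"
    using \<open>n \<le> J\<close>
  proof (induction J rule: dec_induct)
    case (step k)
    show ?case
    proof (cases "n = 0")
      case False
      then have k: "0 < k" using step by simp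
      have IH: "real k * E n \<le> real n * E k" using step False by simp
      have "real k * (real (Suc k) * E n) \<le> real (Suc k) * (real n * E k)"
        using mult_left_mono[OF IH, of "real (Suc k)"] by (simp add: algebra_simps)
      also have "\<dots> = real n * (real (Suc k) * E k)" by simp
      also have "\<dots> \<le> real n * (real k * E (Suc k))" using \<open>\<And>n. real (Suc n) * E n \<le> real n * E (Suc n)\<close>[of k] by (intro mult_left_mono) auto
      finally have "real k * (real (Suc k) * E n) \<le> real k * (real n * E (Suc k))" by (simp add: algebra_simps)
      then show ?thesis using k by simp
    qed simp
  qed simp
  then show ?thesis using assms(1) by auto
qed

lemma convex_sequence_growth:
  fixes H :: "nat \<Rightarrow> real"
  assumes conv: "\<And>i. H i + H (i + 2) \<ge> 2 * H (i + 1)"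
  shows "H 0 + real n * (H 1 - H 0) \<le> H n"
proof -
  have inc: "H 1 - H 0 \<le> H (Suc n) - H n" for n
  proof (induction n)
    case (Suc n)
    then show ?case using conv[of n] by simp
  qed simp
  show ?thesis
  proof (induction n)
    case (Suc n)
    then show ?case using inc[of n] by (simp add: algebra_simps)
  qed simp
qed

text \<open>
  Let \<open>S\<close> be the supremum of the second differences at step \<open>e\<close> and let \<open>f j\<close> miss it by less than
  \<open>1 / (j + 1)\<^sup>2\<close>. The deficit is convex in the length of the step and vanishes for the step \<open>0\<close>, hence it is at most
  \<open>n / (j + 1)\<^sup>3\<close> for the step \<open>n / (j + 1)\<close>. Blowing up by the factor \<open>j + 1\<close> multiplies it with \<open>(j + 1)\<^sup>2\<close> only, so
  that no deficit is left in the limit, at any integer step along the line through the origin.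
\<close>
lemma extremal_second_difference:
  fixes G :: "('a::euclidean_space \<Rightarrow> real) set"
  assumes G: "blowup_closed C G" "G \<noteq> {}" and C: "0 \<le> C"
  obtains f S where "f \<in> G" "\<And>g x t. g \<in> G \<Longrightarrow> second_diff g x (t *\<^sub>R e) \<le> S * t\<^sup>2"
    "\<And>n. second_diff f 0 (real n *\<^sub>R e) = S * (real n)\<^sup>2"
proof -
  define A where "A = (\<lambda>f. second_diff f 0 e) ` G"
  define S where "S = Sup A"
  have tb: "taylor_bounded C g" if "g \<in> G" for g using G(1) that by (simp add: blowup_closed_def)
  have rs: "rescale g z p s \<in> G" if "g \<in> G" "0 < s" for g z p s using G(1) that by (simp add: blowup_closed_def)
  have bdd: "bdd_above A"
    unfolding A_def bdd_above_def using second_diff_bound[OF tb] by (fastforce simp: abs_le_iff)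
  have Ane: "A \<noteq> {}" using G(2) by (simp add: A_def)
  have leS: "second_diff g 0 e \<le> S" if "g \<in> G" for g
    unfolding S_def using bdd that by (auto intro: cSup_upper simp: A_def)
  have le: "second_diff g x (t *\<^sub>R e) \<le> S * t\<^sup>2" if g: "g \<in> G" for g x t
  proof (cases "t = 0")
    case True
    then show ?thesis by (simp add: second_diff_def)
  next
    case False
    have "second_diff (rescale g x 0 \<bar>t\<bar>) 0 e \<le> S" using rs[OF g] False by (intro leS) simp
    then have "second_diff g x (\<bar>t\<bar> *\<^sub>R e) / t\<^sup>2 \<le> S" using False by (simp add: second_diff_rescale)
    moreover have "second_diff g x (\<bar>t\<bar> *\<^sub>R e) = second_diff g x (t *\<^sub>R e)"
      using second_diff_minus[of g x "t *\<^sub>R e"] by (cases "0 \<le> t") auto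
    ultimately show ?thesis using False by (simp add: divide_le_eq)
  qed
  have "\<exists>g. g \<in> G \<and> S - 1 / (real j + 1)\<^sup>2 < second_diff g 0 e" for j :: nat
    using less_cSupD[OF Ane, of "S - 1 / (real j + 1)\<^sup>2"] by (auto simp: S_def A_def)
  then obtain f where f: "\<And>j. f j \<in> G" "\<And>j::nat. S - 1 / (real j + 1)\<^sup>2 < second_diff (f j) 0 e" by metis
  have "\<exists>p. \<forall>h. \<bar>f j (0 + h) - f j 0 - p \<bullet> h\<bar> \<le> C * (norm h)\<^sup>2" for j
    using tb[OF f(1)] unfolding taylor_bounded_def by blast
  then obtain p where p: "\<And>j h. \<bar>f j (0 + h) - f j 0 - p j \<bullet> h\<bar> \<le> C * (norm h)\<^sup>2" by metis
  define F where "F = (\<lambda>j. rescale (f j) 0 (p j) (1 / (real j + 1)))"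
  have FG: "F j \<in> G" for j unfolding F_def by (rule rs[OF f(1)]) simp
  have Fb: "\<bar>F j h\<bar> \<le> C * (norm h)\<^sup>2" for j h
  proof -
    define s where "s = 1 / (real j + 1)"
    have s: "0 < s" by (simp add: s_def)
    have "s\<^sup>2 * \<bar>F j h\<bar> = \<bar>s\<^sup>2 * F j h\<bar>" using s by (simp add: abs_mult)
    also have "\<dots> = \<bar>f j (0 + s *\<^sub>R h) - f j 0 - p j \<bullet> (s *\<^sub>R h)\<bar>"
      unfolding F_def s_def[symmetric] by (simp add: rescale_scaled[OF s])
    also have "\<dots> \<le> C * (norm (s *\<^sub>R h))\<^sup>2" by (rule p)
    also have "\<dots> = s\<^sup>2 * (C * (norm h)\<^sup>2)" using s by (simp add: power_mult_distrib)
    finally show ?thesis using s by simp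
  qed
  have Fsc: "semiconvex C (F j)" for j by (rule taylor_bounded_imp_semiconvex[OF tb[OF FG]])
  have Fbd: "\<exists>B. \<forall>\<^sub>F m in sequentially. \<forall>h. norm h \<le> R \<longrightarrow> \<bar>F m h\<bar> \<le> B" for R
    by (rule quadratically_bounded_imp_locally_bounded[OF C Fb])
  obtain r f0 where r: "strict_mono (r :: nat \<Rightarrow> nat)" and f0: "\<And>h. (\<lambda>m. F (r m) h) \<longlonglongrightarrow> f0 h"
    using semiconvex_convergent_subsequence[of C F, OF Fsc Fbd] by blast
  have f0G: "f0 \<in> G"
    using G(1) FG Fb f0 unfolding blowup_closed_def by (elim conjE allE[of _ "\<lambda>m. F (r m)"] allE[of _ f0]) blast
  have "second_diff f0 0 (real n *\<^sub>R e) = S * (real n)\<^sup>2" for n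
  proof -
    have close: "norm (second_diff (F j) 0 (real n *\<^sub>R e) - S * (real n)\<^sup>2) \<le> real n * (1 / (real j + 1))" if j: "n \<le> j" for j
    proof -
      define J where "J = Suc j"
      have J: "0 < J" "real J = real j + 1" "n \<le> J" using j by (auto simp: J_def)
      define E where "E = (\<lambda>i::nat. S * (real i / real J)\<^sup>2 - second_diff (f j) 0 ((real i / real J) *\<^sub>R e))"
      define v where "v = (1 / real J) *\<^sub>R e"
      have iv: "(real i / real J) *\<^sub>R e = real i *\<^sub>R v" for i by (simp add: v_def)
      have sd: "second_diff (f j) 0 (real (i + 2) *\<^sub>R v) + second_diff (f j) 0 (real i *\<^sub>R v) - 2 * second_diff (f j) 0 (real (i + 1) *\<^sub>R v)
          = second_diff (f j) (real (i + 1) *\<^sub>R v) v + second_diff (f j) (- (real (i + 1) *\<^sub>R v)) v" for i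
        by (simp add: second_diff_def algebra_simps scaleR_2)
      have le_v: "second_diff (f j) y v \<le> S * (1 / real J)\<^sup>2" for y
        unfolding v_def by (rule le[OF f(1)])
      have sq: "S * (real (i + 2) / real J)\<^sup>2 + S * (real i / real J)\<^sup>2 - 2 * (S * (real (i + 1) / real J)\<^sup>2) = 2 * (S * (1 / real J)\<^sup>2)" for i
        using J(1) by (simp add: field_simps power2_eq_square)
      have convE: "E i + E (i + 2) \<ge> 2 * E (i + 1)" for i
      proof -
        have "2 * (A1 - D1) \<le> (A0 - D0) + (A2 - D2)"
          if "A2 + A0 - 2 * A1 = 2 * c" "D2 + D0 - 2 * D1 = x + y" "x \<le> c" "y \<le> c"
          for A0 A1 A2 D0 D1 D2 c x y :: real
          using that by simp
        note arith = this
        show ?thesis unfolding E_def iv by (rule arith[OF sq sd le_v le_v])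
      qed
      have "E 0 = 0" by (simp add: E_def second_diff_def)
      from convex_sequence_chord[OF this convE J(3,1)] have chord: "real J * E n \<le> real n * E J" .
      have "E J < 1 / (real J)\<^sup>2"
        using f(2)[of j] J by (simp add: E_def)
      then have "real n * E J \<le> real n * (1 / (real J)\<^sup>2)" by (intro mult_left_mono) auto
      with chord have "real J * E n \<le> real n * (1 / (real J)\<^sup>2)" by linarith
      then have "real J * (real J * E n) \<le> real J * (real n * (1 / (real J)\<^sup>2))" using J by (intro mult_left_mono) auto
      then have up: "(real J)\<^sup>2 * E n \<le> real n * (1 / real J)" using J by (simp add: power2_eq_square)
      have "second_diff (F j) 0 (real n *\<^sub>R e) = (real J)\<^sup>2 * second_diff (f j) 0 ((real n / real J) *\<^sub>R e)"
        unfolding F_def J(2)[symmetric] by (subst second_diff_rescale) (use J in \<open>simp_all add: power_divide\<close>)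
      then have "S * (real n)\<^sup>2 - second_diff (F j) 0 (real n *\<^sub>R e) = (real J)\<^sup>2 * E n"
        using J(1) by (simp add: E_def algebra_simps power_divide)
      moreover have "0 \<le> (real J)\<^sup>2 * E n"
        using le[OF f(1), of j 0 "real n / real J"] by (simp add: E_def)
      ultimately show ?thesis using up J(2) by (simp add: abs_if)
    qed
    have "(\<lambda>j. second_diff (F j) 0 (real n *\<^sub>R e) - S * (real n)\<^sup>2) \<longlonglongrightarrow> 0"
    proof (rule Lim_null_comparison)
      show "\<forall>\<^sub>F j in sequentially. norm (second_diff (F j) 0 (real n *\<^sub>R e) - S * (real n)\<^sup>2) \<le> real n * (1 / (real j + 1))"
        unfolding eventually_sequentially using close by blast
      show "(\<lambda>j. real n * (1 / (real j + 1))) \<longlonglongrightarrow> 0"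
        using tendsto_mult_right_zero[OF LIMSEQ_inverse_real_of_nat] by (simp add: inverse_eq_divide add.commute)
    qed
    then have "(\<lambda>j. second_diff (F (r j)) 0 (real n *\<^sub>R e) - S * (real n)\<^sup>2) \<longlonglongrightarrow> 0"
      using r LIMSEQ_subseq_LIMSEQ by (fastforce simp: o_def)
    moreover have "(\<lambda>j. second_diff (F (r j)) 0 (real n *\<^sub>R e) - S * (real n)\<^sup>2) \<longlonglongrightarrow> second_diff f0 0 (real n *\<^sub>R e) - S * (real n)\<^sup>2"
      unfolding second_diff_def by (intro tendsto_intros f0)
    ultimately show ?thesis using LIMSEQ_unique by fastforce
  qed
  then show thesis using that[OF f0G] le by blast
qed

text \<open>
  Extremality spreads from the line through the origin to all parallel lines. Average \<open>f\<close> over the four points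
  \<open>\<plusminus> y \<plusminus> \<sigma> e\<close>. Subtracted from its extremal parabola, this is a convex even function of \<open>\<sigma>\<close>; at integers it is bounded,
  because there it differs from known values on the line by second differences in the direction \<open>y\<close>. A convex sequence
  that is bounded along a subsequence cannot increase, so the deficit at \<open>y\<close> vanishes. The step \<open>t\<close> is first taken rational, so
  that some of its multiples are integers.
\<close>
lemma extremal_line_imp_constant:
  fixes f :: "'a::euclidean_space \<Rightarrow> real"
  assumes tb: "taylor_bounded C f"
    and le: "\<And>x t. second_diff f x (t *\<^sub>R e) \<le> S * t\<^sup>2"
    and eq: "\<And>n. second_diff f 0 (real n *\<^sub>R e) = S * (real n)\<^sup>2"
  shows "second_diff f y (t *\<^sub>R e) = S * t\<^sup>2"
proof -
  have rat: "second_diff f y (t *\<^sub>R e) = S * t\<^sup>2" if t: "t = real a / real b" "0 < b" for a b :: nat and t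
  proof -
    define g where "g = (\<lambda>\<sigma>. f (y + \<sigma> *\<^sub>R e) + f (- y + \<sigma> *\<^sub>R e) + f (y - \<sigma> *\<^sub>R e) + f (- y - \<sigma> *\<^sub>R e))"
    define H where "H = (\<lambda>i::nat. 2 * S * (real i * t)\<^sup>2 - g (real i * t))"
    have convH: "H i + H (i + 2) \<ge> 2 * H (i + 1)" for i
    proof -
      define \<sigma> where "\<sigma> = real (i + 1) * t"
      have s: "real i * t = \<sigma> - t" "real (i + 2) * t = \<sigma> + t" by (auto simp: \<sigma>_def algebra_simps)
      have "g (\<sigma> + t) + g (\<sigma> - t) - 2 * g \<sigma> =
          second_diff f (y + \<sigma> *\<^sub>R e) (t *\<^sub>R e) + second_diff f (- y + \<sigma> *\<^sub>R e) (t *\<^sub>R e)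
          + second_diff f (y - \<sigma> *\<^sub>R e) (t *\<^sub>R e) + second_diff f (- y - \<sigma> *\<^sub>R e) (t *\<^sub>R e)"
        by (simp add: g_def second_diff_def algebra_simps)
      also have "\<dots> \<le> 4 * (S * t\<^sup>2)"
        using le[of "y + \<sigma> *\<^sub>R e" t] le[of "- y + \<sigma> *\<^sub>R e" t] le[of "y - \<sigma> *\<^sub>R e" t] le[of "- y - \<sigma> *\<^sub>R e" t] by linarith
      finally show ?thesis
        unfolding H_def s \<sigma>_def[symmetric] by (simp add: algebra_simps power2_eq_square)
    qed
    define \<mu> where "\<mu> = H 1 - H 0"
    have \<mu>: "\<mu> = (S * t\<^sup>2 - second_diff f y (t *\<^sub>R e)) + (S * t\<^sup>2 - second_diff f (- y) (t *\<^sub>R e))"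
      by (simp add: \<mu>_def H_def g_def second_diff_def)
    define B where "B = 4 * C * (norm y)\<^sup>2 - 4 * f 0 - H 0"
    have bound: "real k * \<mu> \<le> B" for k
    proof -
      define n where "n = a * k"
      have n: "real (b * k) * t = real n" using t by (simp add: n_def)
      have "g (real n) = second_diff f (real n *\<^sub>R e) y + second_diff f (- (real n *\<^sub>R e)) y
         + 2 * (second_diff f 0 (real n *\<^sub>R e) + 2 * f 0)"
        unfolding g_def second_diff_def minus_diff_commute[of y "real n *\<^sub>R e"] by (simp add: g_def second_diff_def algebra_simps)
      moreover have "\<bar>second_diff f (real n *\<^sub>R e) y\<bar> \<le> 2 * C * (norm y)\<^sup>2"
        "\<bar>second_diff f (- (real n *\<^sub>R e)) y\<bar> \<le> 2 * C * (norm y)\<^sup>2"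
        by (rule second_diff_bound[OF tb])+
      ultimately have "H (b * k) \<le> 4 * C * (norm y)\<^sup>2 - 4 * f 0"
        unfolding H_def n eq by (simp add: abs_le_iff algebra_simps)
      moreover have "H 0 + real (b * k) * \<mu> \<le> H (b * k)"
        unfolding \<mu>_def by (rule convex_sequence_growth[OF convH])
      moreover have "real k * \<mu> \<le> real (b * k) * \<mu>"
      proof (rule mult_right_mono)
        show "real k \<le> real (b * k)" using t by (cases b) auto
        show "0 \<le> \<mu>" using \<mu> le[of y t] le[of "- y" t] by linarith
      qed
      ultimately show ?thesis by (simp add: B_def)
    qed
    have "\<mu> \<le> 0"
    proof (rule ccontr)
      assume "\<not> \<mu> \<le> 0"
      then obtain k :: nat where "B < real k * \<mu>" using reals_Archimedean3[of \<mu>] by auto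
      then show False using bound[of k] by simp
    qed
    then show ?thesis using \<mu> le[of y t] le[of "- y" t] by linarith
  qed
  define \<phi> where "\<phi> = (\<lambda>t. second_diff f y (t *\<^sub>R e) - S * t\<^sup>2)"
  have cf: "continuous_on UNIV f" by (rule taylor_bounded_continuous[OF tb])
  have "continuous_on UNIV \<phi>"
    unfolding \<phi>_def second_diff_def
    by (intro continuous_intros continuous_on_compose2[OF cf]) auto
  then have "closed {t. \<phi> t = 0}"
    using continuous_closed_preimage_constant[of UNIV \<phi> 0] by simp
  moreover have "\<rat> \<subseteq> {t. \<phi> t = 0}"
  proof
    fix t :: real assume "t \<in> \<rat>"
    then obtain m n :: nat where mn: "n \<noteq> 0" "\<bar>t\<bar> = real m / real n" by (rule Rats_abs_nat_div_natE)
    then have "second_diff f y (\<bar>t\<bar> *\<^sub>R e) = S * \<bar>t\<bar>\<^sup>2" using rat[of "\<bar>t\<bar>" m n] by simp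
    moreover have "second_diff f y (\<bar>t\<bar> *\<^sub>R e) = second_diff f y (t *\<^sub>R e)"
      using second_diff_minus[of f y "t *\<^sub>R e"] by (cases "0 \<le> t") auto
    ultimately show "t \<in> {t. \<phi> t = 0}" by (simp add: \<phi>_def)
  qed
  ultimately have "closure \<rat> \<subseteq> {t. \<phi> t = 0}" by (rule closure_minimal[rotated])
  then show ?thesis by (auto simp: Rats_closure_real \<phi>_def)
qed

lemma blowup_closed_restrict_direction:
  assumes "blowup_closed C G"
  shows "blowup_closed C {f \<in> G. \<forall>x t. second_diff f x (t *\<^sub>R e) = S * t\<^sup>2}" (is "blowup_closed C ?G'")
  unfolding blowup_closed_def
proof (intro conjI ballI allI impI)
  fix f assume "f \<in> ?G'"
  then show "taylor_bounded C f" using assms by (simp add: blowup_closed_def)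
next
  fix f z p and s :: real assume f: "f \<in> ?G'" and s: "0 < s"
  have "rescale f z p s \<in> G" using f s assms by (simp add: blowup_closed_def)
  moreover have "second_diff (rescale f z p s) x (t *\<^sub>R e) = S * t\<^sup>2" for x t
  proof -
    have "second_diff f (z + s *\<^sub>R x) ((s * t) *\<^sub>R e) = S * (s * t)\<^sup>2" using f by blast
    then show ?thesis using s by (simp add: second_diff_rescale power_mult_distrib)
  qed
  ultimately show "rescale f z p s \<in> ?G'" by simp
next
  fix F f assume F: "\<forall>m::nat. F m \<in> ?G'" and b: "\<forall>m h. \<bar>F m h\<bar> \<le> C * (norm h)\<^sup>2" and lim: "\<forall>h. (\<lambda>m. F m h) \<longlonglongrightarrow> f h"
  have "f \<in> G" using F b lim assms unfolding blowup_closed_def by blast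
  moreover have "second_diff f x (t *\<^sub>R e) = S * t\<^sup>2" for x t
  proof (rule LIMSEQ_unique)
    show "(\<lambda>m. second_diff (F m) x (t *\<^sub>R e)) \<longlonglongrightarrow> second_diff f x (t *\<^sub>R e)"
      unfolding second_diff_def by (intro tendsto_intros lim[rule_format])
    show "(\<lambda>m. second_diff (F m) x (t *\<^sub>R e)) \<longlonglongrightarrow> S * t\<^sup>2" using F by simp
  qed
  ultimately show "f \<in> ?G'" by simp
qed

lemma exists_constant_second_differences:
  fixes G :: "('a::euclidean_space \<Rightarrow> real) set"
  assumes "finite E" "0 \<le> C" "blowup_closed C G" "G \<noteq> {}"
  shows "\<exists>f\<in>G. \<forall>e\<in>E. \<exists>S. \<forall>x t. second_diff f x (t *\<^sub>R e) = S * t\<^sup>2"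
  using assms(1,3,4)
proof (induction E arbitrary: G rule: finite_induct)
  case empty
  then show ?case by blast
next
  case (insert e E)
  obtain f S where f: "f \<in> G" "\<And>g x t. g \<in> G \<Longrightarrow> second_diff g x (t *\<^sub>R e) \<le> S * t\<^sup>2"
    "\<And>n. second_diff f 0 (real n *\<^sub>R e) = S * (real n)\<^sup>2"
    by (rule extremal_second_difference[OF insert.prems \<open>0 \<le> C\<close>, of e]) (rule that; assumption)
  have tb: "taylor_bounded C f" using f(1) insert.prems by (simp add: blowup_closed_def)
  let ?G' = "{f \<in> G. \<forall>x t. second_diff f x (t *\<^sub>R e) = S * t\<^sup>2}"
  have "f \<in> ?G'" using extremal_line_imp_constant[OF tb f(2)[OF f(1)] f(3)] f(1) by blast
  then obtain g where "g \<in> ?G'" "\<forall>e\<in>E. \<exists>S. \<forall>x t. second_diff g x (t *\<^sub>R e) = S * t\<^sup>2"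
    using insert.IH[of ?G'] blowup_closed_restrict_direction[OF insert.prems(1)] by blast
  then show ?case by blast
qed

lemma Basis_translation_invariant_imp_constant:
  fixes \<phi> :: "'a::euclidean_space \<Rightarrow> 'b"
  assumes inv: "\<And>x t b. b \<in> Basis \<Longrightarrow> \<phi> (x + t *\<^sub>R b) = \<phi> x"
  shows "\<phi> x = \<phi> 0"
proof -
  have "\<phi> (\<Sum>b\<in>A. (x \<bullet> b) *\<^sub>R b) = \<phi> 0" if "finite A" "A \<subseteq> Basis" for A
    using that
  proof (induction A rule: finite_induct)
    case (insert b A)
    have "\<phi> ((\<Sum>b\<in>A. (x \<bullet> b) *\<^sub>R b) + (x \<bullet> b) *\<^sub>R b) = \<phi> (\<Sum>b\<in>A. (x \<bullet> b) *\<^sub>R b)"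
      using insert.prems by (intro inv) simp
    then show ?case using insert by (simp add: add.commute)
  qed simp
  from this[of Basis] show ?thesis by (simp add: euclidean_representation)
qed

text \<open>
  The increments over \<open>n\<close> equal steps coincide, and the Taylor error of one step, of order \<open>1 / n\<^sup>2\<close>, remains
  negligible when multiplied by \<open>n\<close>.
\<close>
lemma vanishing_second_differences_imp_affine:
  fixes g :: "'a::euclidean_space \<Rightarrow> real"
  assumes p: "\<And>x h. \<bar>g (x + h) - g x - p x \<bullet> h\<bar> \<le> C * (norm h)\<^sup>2"
    and z: "\<And>x t. second_diff g x (t *\<^sub>R e) = 0"
  shows "g (x + t *\<^sub>R e) = g x + t * (p x \<bullet> e)"
proof -
  define u where "u = t *\<^sub>R e"
  have le: "\<bar>g (x + u) - g x - p x \<bullet> u\<bar> \<le> (C * (norm u)\<^sup>2) * (1 / (real n + 1))" for n :: nat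
  proof -
    define N where "N = Suc n"
    define v where "v = (1 / real N) *\<^sub>R u"
    have N: "real N = real n + 1" "real N \<noteq> 0" by (auto simp: N_def)
    have Nv: "real N *\<^sub>R v = u" using N by (simp add: v_def)
    have "second_diff g y v = 0" for y
      using z[of y "(1 / real N) * t"] by (simp add: v_def u_def)
    then have step: "g (y + v + v) - g (y + v) = g (y + v) - g y" for y
      using \<open>second_diff g (y + v) v = 0\<close> by (simp add: second_diff_def)
    have inc: "g (x + real (Suc i) *\<^sub>R v) - g (x + real i *\<^sub>R v) = g (x + v) - g x" for i
    proof (induction i)
      case (Suc i)
      then show ?case using step[of "x + real i *\<^sub>R v"] by (simp add: algebra_simps scaleR_2)
    qed simp
    have "g (x + real i *\<^sub>R v) = g x + real i * (g (x + v) - g x)" for i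
    proof (induction i)
      case (Suc i)
      then show ?case using inc[of i] by (simp add: algebra_simps)
    qed simp
    from this[of N] have "g (x + u) - g x - p x \<bullet> u = real N * (g (x + v) - g x - p x \<bullet> v)"
      using N Nv by (simp add: right_diff_distrib flip: inner_scaleR_right)
    then have "\<bar>g (x + u) - g x - p x \<bullet> u\<bar> = real N * \<bar>g (x + v) - g x - p x \<bullet> v\<bar>"
      by (simp add: abs_mult)
    also have "\<dots> \<le> real N * (C * (norm v)\<^sup>2)" by (intro mult_left_mono p) simp
    also have "\<dots> = (C * (norm u)\<^sup>2) * (1 / (real n + 1))"
      using N by (simp add: v_def power_divide power2_eq_square)
    finally show ?thesis .
  qed
  have "(\<lambda>n. (C * (norm u)\<^sup>2) * (1 / (real n + 1))) \<longlonglongrightarrow> 0"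
    using tendsto_mult_right_zero[OF LIMSEQ_inverse_real_of_nat] by (simp add: inverse_eq_divide add.commute)
  then have "\<bar>g (x + u) - g x - p x \<bullet> u\<bar> \<le> 0"
    using le by (intro LIMSEQ_le_const) auto
  then show ?thesis by (simp add: u_def)
qed

text \<open>
  The directions \<open>b\<close> and \<open>b + b'\<close> determine the coefficients of a quadratic form by polarisation. After it is
  subtracted, the rest is affine in each of these directions. Going from \<open>x\<close> to \<open>x + t (b + b')\<close> directly or in two steps
  shows that the gradient of the rest is constant.
\<close>
lemma constant_second_differences_imp_quadratic:
  fixes f :: "'a::euclidean_space \<Rightarrow> real"
  assumes tb: "taylor_bounded C f" and f0: "\<And>h. \<bar>f h\<bar> \<le> C * (norm h)\<^sup>2"
    and S: "\<And>b b' x t. b \<in> Basis \<Longrightarrow> b' \<in> Basis \<union> {0} \<Longrightarrow> second_diff f x (t *\<^sub>R (b + b')) = S (b + b') * t\<^sup>2"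
  obtains M where "selfadjoint M" "f = quad M"
proof -
  define m where "m = (\<lambda>b b'. (S (b + b') - S b - S b') / 2)"
  define M where "M = (\<lambda>z::'a. \<Sum>b\<in>Basis. (\<Sum>b'\<in>Basis. m b b' * (z \<bullet> b')) *\<^sub>R b)"
  have msym: "m b b' = m b' b" for b b' by (simp add: m_def add.commute)
  have linM: "linear M"
    unfolding M_def
    by (intro linearI) (simp_all add: inner_add_left algebra_simps sum.distrib scaleR_sum_right sum_distrib_left)
  have xM: "x \<bullet> M y = (\<Sum>b\<in>Basis. \<Sum>b'\<in>Basis. m b b' * ((x \<bullet> b) * (y \<bullet> b')))" for x y
    by (simp add: M_def inner_sum_right sum_distrib_right sum_distrib_left algebra_simps)
  have sa: "selfadjoint M"
    unfolding selfadjoint_def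
  proof (intro conjI linM allI)
    fix x y :: 'a
    have "x \<bullet> M y = (\<Sum>b'\<in>Basis. \<Sum>b\<in>Basis. m b b' * ((x \<bullet> b) * (y \<bullet> b')))"
      unfolding xM by (rule sum.swap)
    also have "\<dots> = y \<bullet> M x"
      unfolding xM by (intro sum.cong refl) (simp add: msym mult.commute)
    finally show "x \<bullet> M y = M x \<bullet> y" by (simp add: inner_commute)
  qed
  have bMb: "b \<bullet> M b' = m b b'" if "b \<in> Basis" "b' \<in> Basis" for b b'
  proof -
    have row: "(\<Sum>b2\<in>Basis. m b1 b2 * (b' \<bullet> b2)) = m b1 b'" for b1
      using that by (subst sum.remove[of _ b']) (auto simp: inner_Basis intro!: sum.neutral split: if_splits)
    have "M b' \<bullet> b = m b b'"
      unfolding M_def row using that by (simp only: inner_sum_left_Basis)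
    then show ?thesis by (simp add: inner_commute)
  qed
  have S2: "S (b + b) = 4 * S b" if b: "b \<in> Basis" for b
  proof -
    have "S (b + b) = second_diff f 0 (b + b)" using S[of b b 0 1] b by simp
    also have "b + b = 2 *\<^sub>R (b + 0)" by (simp add: scaleR_2)
    also have "second_diff f 0 \<dots> = S b * 2\<^sup>2" using S[of b 0 0 2] b by simp
    finally show ?thesis by (simp add: scaleR_2)
  qed
  have Mdir: "(b + b') \<bullet> M (b + b') = S (b + b')" if b: "b \<in> Basis" "b' \<in> Basis \<union> {0}" for b b'
  proof (cases "b' = 0")
    case True
    then show ?thesis using bMb[OF b(1) b(1)] S2[OF b(1)] by (simp add: m_def)
  next
    case False
    then have b': "b' \<in> Basis" using b by simp
    have "(b + b') \<bullet> M (b + b') = m b b + m b b' + m b' b + m b' b'"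
      using bMb b(1) b' by (simp add: linear_add[OF linM] inner_add_left inner_add_right)
    also have "m b b = S b" using S2[OF b(1)] by (simp add: m_def)
    also have "m b' b' = S b'" using S2[OF b'] by (simp add: m_def)
    also have "m b' b = m b b'" by (rule msym)
    also have "S b + m b b' + m b b' + S b' = S (b + b')" by (simp add: m_def)
    finally show ?thesis .
  qed
  obtain B where B: "0 < B" "\<And>x. \<bar>quad M x\<bar> \<le> B * (norm x)\<^sup>2" using quad_bound[OF sa] by blast
  define g where "g = (\<lambda>z. f z - quad M z)"
  have sdq: "second_diff (quad M) x v = v \<bullet> M v" for x v
  proof -
    have "quad M (- v) = quad M v" using quad_scaleR[OF sa, of "-1" v] by simp
    then have "second_diff (quad M) x v = 2 * quad M v"
      using quad_add[OF sa, of x v] quad_add[OF sa, of x "- v"] by (simp add: second_diff_def)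
    then show ?thesis by (simp add: quad_def)
  qed
  have gz: "second_diff g x (t *\<^sub>R (b + b')) = 0" if b: "b \<in> Basis" "b' \<in> Basis \<union> {0}" for x t b b'
  proof -
    have "second_diff g x (t *\<^sub>R (b + b')) = second_diff f x (t *\<^sub>R (b + b')) - second_diff (quad M) x (t *\<^sub>R (b + b'))"
      by (simp add: second_diff_def g_def)
    also have "second_diff (quad M) x (t *\<^sub>R (b + b')) = t\<^sup>2 * ((b + b') \<bullet> M (b + b'))"
      unfolding sdq by (simp add: linear_cmul[OF linM] power2_eq_square)
    finally show ?thesis unfolding S[OF b] Mdir[OF b] by simp
  qed
  have "\<exists>p. \<forall>h. \<bar>g (x + h) - g x - p \<bullet> h\<bar> \<le> (C + B) * (norm h)\<^sup>2" for x
  proof -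
    obtain q where q: "\<And>h. \<bar>f (x + h) - f x - q \<bullet> h\<bar> \<le> C * (norm h)\<^sup>2"
      using tb unfolding taylor_bounded_def by metis
    have "\<bar>g (x + h) - g x - (q - M x) \<bullet> h\<bar> \<le> (C + B) * (norm h)\<^sup>2" for h
      using q[of h] B(2)[of h] quad_add[OF sa, of x h] by (simp add: g_def inner_diff_left algebra_simps abs_le_iff)
    then show ?thesis by blast
  qed
  then obtain p where p: "\<And>x h. \<bar>g (x + h) - g x - p x \<bullet> h\<bar> \<le> (C + B) * (norm h)\<^sup>2" by metis
  have aff: "g (x + t *\<^sub>R (b + b')) = g x + t * (p x \<bullet> (b + b'))" if "b \<in> Basis" "b' \<in> Basis \<union> {0}" for x t b b'
    by (rule vanishing_second_differences_imp_affine[OF p gz[OF that]])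
  have pb: "p (x + t *\<^sub>R b) \<bullet> b' = p x \<bullet> b'" if b: "b \<in> Basis" "b' \<in> Basis" for x t b b'
  proof (cases "t = 0")
    case False
    have "g (x + t *\<^sub>R (b + b')) = g x + t * (p x \<bullet> (b + b'))" using b by (intro aff) auto
    moreover have "g (x + t *\<^sub>R (b + b')) = g ((x + t *\<^sub>R (b + 0)) + t *\<^sub>R (b' + 0))" by (simp add: algebra_simps)
    moreover have "g ((x + t *\<^sub>R (b + 0)) + t *\<^sub>R (b' + 0)) = g (x + t *\<^sub>R (b + 0)) + t * (p (x + t *\<^sub>R (b + 0)) \<bullet> (b' + 0))"
      using b by (intro aff) auto
    moreover have "g (x + t *\<^sub>R (b + 0)) = g x + t * (p x \<bullet> (b + 0))" using b by (intro aff) auto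
    ultimately show ?thesis using False by (simp add: inner_add_right algebra_simps)
  qed simp
  have pconst: "p x = p 0" for x
    by (rule Basis_translation_invariant_imp_constant) (auto intro: euclidean_eqI pb)
  have "p 0 = 0"
  proof (rule linear_below_quadratic_eq_0[of 1 _ "(C + B) + (C + B)"])
    fix h :: 'a
    have "\<bar>g h\<bar> \<le> (C + B) * (norm h)\<^sup>2" using f0[of h] B(2)[of h] by (simp add: g_def algebra_simps abs_le_iff)
    moreover have "\<bar>g (0 + h) - g 0 - p 0 \<bullet> h\<bar> \<le> (C + B) * (norm h)\<^sup>2" by (rule p)
    moreover have "g 0 = 0" using f0[of 0] by (simp add: g_def quad_def)
    ultimately show "p 0 \<bullet> h \<le> ((C + B) + (C + B)) * (norm h)\<^sup>2" by (simp add: algebra_simps abs_le_iff)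
  qed simp
  have "g x = g 0" for x
  proof (rule Basis_translation_invariant_imp_constant)
    fix x t and b :: 'a assume "b \<in> Basis"
    then show "g (x + t *\<^sub>R b) = g x" using aff[of b 0 x t] pconst[of x] \<open>p 0 = 0\<close> by simp
  qed
  moreover have "g 0 = 0" using f0[of 0] by (simp add: g_def quad_def)
  ultimately have "f = quad M" by (auto simp: g_def fun_eq_iff)
  with sa show thesis using that by blast
qed

text \<open>
  The substitute for Aleksandrov's theorem: some blow-up is a quadratic form.
\<close>
theorem blowup_closed_contains_quadratic:
  fixes G :: "('a::euclidean_space \<Rightarrow> real) set"
  assumes C: "0 \<le> C" and G: "blowup_closed C G" "G \<noteq> {}"
  obtains M where "selfadjoint M" "quad M \<in> G"
proof -
  define E where "E = (\<lambda>(b, b'). b + b') ` ((Basis :: 'a set) \<times> (Basis \<union> {0}))"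
  have "finite E" by (simp add: E_def)
  then obtain f where f: "f \<in> G" "\<forall>e\<in>E. \<exists>S. \<forall>x t. second_diff f x (t *\<^sub>R e) = S * t\<^sup>2"
    using exists_constant_second_differences[OF _ C G] by blast
  obtain p where p: "\<And>h. \<bar>f (0 + h) - f 0 - p \<bullet> h\<bar> \<le> C * (norm h)\<^sup>2"
    using f(1) G(1) unfolding blowup_closed_def taylor_bounded_def by metis
  define f1 where "f1 = rescale f 0 p 1"
  have f1: "f1 \<in> G" using f(1) G(1) by (simp add: f1_def blowup_closed_def)
  have tb: "taylor_bounded C f1" using f1 G(1) by (simp add: blowup_closed_def)
  have b: "\<bar>f1 h\<bar> \<le> C * (norm h)\<^sup>2" for h using p[of h] by (simp add: f1_def rescale_def)
  obtain S where "\<And>e x t. e \<in> E \<Longrightarrow> second_diff f x (t *\<^sub>R e) = S e * t\<^sup>2" using f(2) by metis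
  then have S: "second_diff f1 x (t *\<^sub>R e) = S e * t\<^sup>2" if "e \<in> E" for e x t
    using that by (simp add: f1_def second_diff_rescale)
  obtain M where "selfadjoint M" "f1 = quad M"
  proof (rule constant_second_differences_imp_quadratic[OF tb b])
    fix b b' x :: 'a and t assume "b \<in> Basis" "b' \<in> Basis \<union> {0}"
    then have "(b, b') \<in> Basis \<times> (Basis \<union> {0})" by blast
    then have "b + b' \<in> E" unfolding E_def by (rule rev_image_eqI) simp
    then show "second_diff f1 x (t *\<^sub>R (b + b')) = S (b + b') * t\<^sup>2" by (rule S)
  qed
  then show thesis using that f1 by blast
qed

section \<open>Superjets and sup-convolutions\<close>

lemma symmetric_matrix_inner: "symmetric_matrix X \<Longrightarrow> x \<bullet> (X *v y) = (X *v x) \<bullet> y" for X :: "real^'n^'n"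
  unfolding symmetric_matrix_def by (metis dot_lmul_matrix transpose_matrix_vector)

lemma selfadjoint_matrix: "symmetric_matrix X \<Longrightarrow> selfadjoint ((*v) X)" for X :: "real^'n^'n"
  unfolding selfadjoint_def by (simp add: symmetric_matrix_inner)

text \<open>
  \<open>D\<close> may be closed: at its boundary points only the points of \<open>D\<close> are tested. In this way superjets at the bottom of the
  strip see the Neumann condition.
\<close>
definition superjet :: "(real^'n) set \<Rightarrow> (real^'n \<Rightarrow> real) \<Rightarrow> real^'n \<Rightarrow> real^'n \<Rightarrow> real^'n^'n \<Rightarrow> bool" where
  "superjet D u x p X \<longleftrightarrow> x \<in> D \<and> symmetric_matrix X \<and>
     (\<exists>r>0. \<forall>y\<in>D \<inter> ball x r. u y \<le> u x + p \<bullet> (y - x) + quad ((*v) X) (y - x))"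

lemma usc_onD:
  assumes "usc_on D u" "x \<in> D" "0 < e"
  obtains d where "0 < d" "\<And>y. y \<in> D \<Longrightarrow> dist y x < d \<Longrightarrow> u y < u x + e"
proof -
  have "openin (top_of_set D) {y\<in>D. u y < u x + e}" using assms(1) by (simp add: usc_on_def)
  moreover have "x \<in> {y\<in>D. u y < u x + e}" using assms by simp
  ultimately obtain d where "0 < d" "\<And>y. y \<in> D \<Longrightarrow> dist y x < d \<Longrightarrow> y \<in> {y\<in>D. u y < u x + e}"
    unfolding openin_euclidean_subtopology_iff by (metis (lifting) dist_commute)
  then show thesis using that by blast
qed

lemma usc_attains_max:
  fixes f :: "'a::metric_space \<Rightarrow> real"
  assumes K: "compact K" "K \<noteq> {}"
    and usc: "\<And>x e. x \<in> K \<Longrightarrow> 0 < e \<Longrightarrow> \<exists>d>0. \<forall>y\<in>K. dist y x < d \<longrightarrow> f y < f x + e"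
  obtains x where "x \<in> K" "\<And>y. y \<in> K \<Longrightarrow> f y \<le> f x"
proof -
  have "\<exists>x\<in>K. \<forall>y\<in>K. f y \<le> f x"
  proof (rule ccontr)
    assume "\<not> ?thesis"
    then have "\<forall>x\<in>K. \<exists>y. y \<in> K \<and> f x < f y" by (meson not_le)
    then obtain n where n: "\<And>x. x \<in> K \<Longrightarrow> n x \<in> K" "\<And>x. x \<in> K \<Longrightarrow> f x < f (n x)" by metis
    have "\<exists>d>0. \<forall>y\<in>K. dist y x < d \<longrightarrow> f y < f (n x)" if "x \<in> K" for x
      using usc[OF that, of "f (n x) - f x"] n(2)[OF that] by simp
    then obtain d where d: "\<And>x. x \<in> K \<Longrightarrow> 0 < d x" "\<And>x y. x \<in> K \<Longrightarrow> y \<in> K \<Longrightarrow> dist y x < d x \<Longrightarrow> f y < f (n x)"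
      by metis
    have "K \<subseteq> (\<Union>x\<in>K. ball x (d x))" using d(1) by force
    then obtain C where C: "C \<subseteq> K" "finite C" "K \<subseteq> (\<Union>x\<in>C. ball x (d x))"
      using compactE_image[OF K(1), of K "\<lambda>x. ball x (d x)"] by blast
    have "C \<noteq> {}" using C(3) K(2) by auto
    define m where "m = Max ((\<lambda>x. f (n x)) ` C)"
    have "m \<in> (\<lambda>x. f (n x)) ` C" unfolding m_def using C(2) \<open>C \<noteq> {}\<close> by (intro Max_in) auto
    then obtain c where c: "c \<in> C" "m = f (n c)" by blast
    have "n c \<in> K" using n(1) c C by blast
    then obtain x where x: "x \<in> C" "n c \<in> ball x (d x)" using C(3) by blast
    then have "f (n c) < f (n x)" using d(2)[of x "n c"] \<open>n c \<in> K\<close> C(1) by (auto simp: dist_commute)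
    also have "f (n x) \<le> m" unfolding m_def using C(2) x(1) by (intro Max_ge) auto
    finally show False using c by simp
  qed
  then show thesis using that by blast
qed

lemma sup_convolution_attained:
  fixes E :: "(real^'n) set"
  assumes E: "compact E" "E \<noteq> {}" and usc: "usc_on D u" "E \<subseteq> D"
  shows "\<exists>\<zeta>\<in>E. \<forall>z\<in>E. u z - k * (norm (x - z))\<^sup>2 \<le> u \<zeta> - k * (norm (x - \<zeta>))\<^sup>2"
proof -
  have "\<exists>d>0. \<forall>y\<in>E. dist y z < d \<longrightarrow> u y - k * (norm (x - y))\<^sup>2 < u z - k * (norm (x - z))\<^sup>2 + e"
    if z: "z \<in> E" and e: "0 < e" for z e
  proof -
    obtain d1 where d1: "0 < d1" "\<And>y. y \<in> D \<Longrightarrow> dist y z < d1 \<Longrightarrow> u y < u z + e/2"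
      using usc_onD[OF usc(1), of z "e/2"] z e usc(2) by auto
    have "isCont (\<lambda>y. k * (norm (x - y))\<^sup>2) z" by (intro continuous_intros)
    then obtain d2 where d2: "0 < d2" "\<And>y. dist y z < d2 \<Longrightarrow> dist (k * (norm (x - y))\<^sup>2) (k * (norm (x - z))\<^sup>2) < e/2"
      using e unfolding continuous_at_eps_delta by (metis half_gt_zero)
    have "u y - k * (norm (x - y))\<^sup>2 < u z - k * (norm (x - z))\<^sup>2 + e" if "y \<in> E" "dist y z < min d1 d2" for y
    proof -
      have "u y < u z + e/2" using d1(2)[of y] that usc(2) by auto
      moreover have "\<bar>k * (norm (x - y))\<^sup>2 - k * (norm (x - z))\<^sup>2\<bar> < e/2"
        using d2(2)[of y] that by (simp add: dist_real_def)
      ultimately show ?thesis by linarith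
    qed
    then show ?thesis using d1 d2 by (intro exI[of _ "min d1 d2"]) auto
  qed
  then show ?thesis by (rule usc_attains_max[OF E]) blast+
qed

text \<open>
  \<open>U\<close> is the sup-convolution of the restriction of \<open>u\<close> to a ball, and \<open>\<zeta> x\<close> is a point at which the supremum
  defining \<open>U x\<close> is attained.
\<close>
locale sup_convolution =
  fixes D E :: "(real^'n) set" and u U :: "real^'n \<Rightarrow> real" and \<zeta> :: "real^'n \<Rightarrow> real^'n" and k :: real and r :: real
  assumes r: "0 < r" and E: "E = D \<inter> cball 0 r" and k: "0 < k"
    and \<zeta>: "\<And>x. \<zeta> x \<in> E" and U: "\<And>x. U x = u (\<zeta> x) - k * (norm (x - \<zeta> x))\<^sup>2"
    and U_ge: "\<And>x z. z \<in> E \<Longrightarrow> u z - k * (norm (x - z))\<^sup>2 \<le> U x"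
begin

lemma semiconvex_slope: "U x + (2 * k) *\<^sub>R (\<zeta> x - x) \<bullet> h - k * (norm h)\<^sup>2 \<le> U (x + h)"
proof -
  have eq: "(norm (x + h - \<zeta> x))\<^sup>2 = (norm (x - \<zeta> x))\<^sup>2 + 2 * ((x - \<zeta> x) \<bullet> h) + (norm h)\<^sup>2"
    unfolding power2_norm_eq_inner by (simp add: inner_diff_left inner_diff_right inner_add_left inner_add_right inner_commute)
  have "k * (norm (x + h - \<zeta> x))\<^sup>2 = k * (norm (x - \<zeta> x))\<^sup>2 + 2 * k * ((x - \<zeta> x) \<bullet> h) + k * (norm h)\<^sup>2"
    unfolding eq by (simp add: algebra_simps)
  then show ?thesis
    using U_ge[OF \<zeta>[of x], of "x + h"] U[of x] by (simp add: inner_diff_left algebra_simps)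
qed

lemma semiconvex: "semiconvex k U"
  unfolding semiconvex_def using semiconvex_slope by blast

lemma norm_\<zeta>: "norm (\<zeta> x) \<le> r"
  using \<zeta>[of x] E by auto

lemma continuous: "continuous_on UNIV U"
proof -
  have "isCont U x" for x
  proof -
    define L where "L = 2 * k * (r + norm x + 1) + k"
    have L: "0 \<le> L" using k r by (simp add: L_def)
    have one: "U a - U b \<le> L * norm (b - a)" if ab: "norm a \<le> norm x + 1" "norm (b - a) \<le> 1" for a b
    proof -
      have "U a + (2 * k) *\<^sub>R (\<zeta> a - a) \<bullet> (b - a) - k * (norm (b - a))\<^sup>2 \<le> U b"
        using semiconvex_slope[of a "b - a"] by simp
      moreover have "\<bar>(2 * k) *\<^sub>R (\<zeta> a - a) \<bullet> (b - a)\<bar> \<le> 2 * k * (r + norm x + 1) * norm (b - a)"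
      proof -
        have "norm (\<zeta> a - a) \<le> r + norm x + 1" using norm_triangle_ineq4[of "\<zeta> a" a] norm_\<zeta>[of a] ab by simp
        then have "norm ((2 * k) *\<^sub>R (\<zeta> a - a)) \<le> 2 * k * (r + norm x + 1)" using k by simp
        then show ?thesis
          by (meson Cauchy_Schwarz_ineq2 mult_right_mono norm_ge_zero order_trans)
      qed
      moreover have "k * (norm (b - a))\<^sup>2 \<le> k * norm (b - a)"
        using ab k by (intro mult_left_mono) (auto simp: power2_eq_square mult_left_le)
      ultimately show ?thesis by (simp add: L_def algebra_simps abs_le_iff)
    qed
    have "((\<lambda>y. U y - U x) \<longlongrightarrow> 0) (at x)"
    proof (rule Lim_null_comparison)
      have "\<forall>\<^sub>F y in at x. dist y x < 1" by (rule eventually_at_ball'[of 1 x UNIV, THEN eventually_mono]) (auto simp: dist_commute)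
      then show "\<forall>\<^sub>F y in at x. norm (U y - U x) \<le> L * norm (y - x)"
      proof eventually_elim
        case (elim y)
        have "norm y \<le> norm x + 1" using elim norm_triangle_sub[of y x] by (simp add: dist_norm)
        then show ?case using one[of y x] one[of x y] elim by (simp add: dist_norm norm_minus_commute abs_le_iff)
      qed
      show "((\<lambda>y. L * norm (y - x)) \<longlongrightarrow> 0) (at x)" by (auto intro!: tendsto_eq_intros)
    qed
    then show ?thesis by (simp add: isCont_def LIM_zero_iff)
  qed
  then show ?thesis by (simp add: continuous_at_imp_continuous_on)
qed

text \<open>
  The translation by \<open>\<zeta> w - w\<close> carries a paraboloid touching \<open>U\<close> at \<open>w\<close> to one touching \<open>u\<close> at \<open>\<zeta> w\<close>: the slope and
  the Hessian are preserved.
\<close>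
lemma superjet_of_touching:
  assumes X: "symmetric_matrix X" and e: "0 < e"
    and le: "\<And>v. norm v < e \<Longrightarrow> U (w + v) \<le> U w + p \<bullet> v + quad ((*v) X) v"
    and int: "norm (\<zeta> w) < r"
  shows "superjet D u (\<zeta> w) p X"
  unfolding superjet_def
proof (intro conjI X)
  show "\<zeta> w \<in> D" using \<zeta> E by blast
  have "u y \<le> u (\<zeta> w) + p \<bullet> (y - \<zeta> w) + quad ((*v) X) (y - \<zeta> w)"
    if y: "y \<in> D \<inter> ball (\<zeta> w) (min e (r - norm (\<zeta> w)))" for y
  proof -
    have "norm (y - \<zeta> w) < e" "norm (y - \<zeta> w) < r - norm (\<zeta> w)"
      using y by (auto simp: dist_norm norm_minus_commute)
    then have "y \<in> E" using y E norm_triangle_sub[of y "\<zeta> w"] by auto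
    then have "u y - k * (norm (w + (y - \<zeta> w) - y))\<^sup>2 \<le> U (w + (y - \<zeta> w))" by (rule U_ge)
    also have "\<dots> \<le> U w + p \<bullet> (y - \<zeta> w) + quad ((*v) X) (y - \<zeta> w)"
      by (rule le) fact
    finally show ?thesis using U[of w] by simp
  qed
  then show "\<exists>r>0. \<forall>y\<in>D \<inter> ball (\<zeta> w) r. u y \<le> u (\<zeta> w) + p \<bullet> (y - \<zeta> w) + quad ((*v) X) (y - \<zeta> w)"
    using e int by (intro exI[of _ "min e (r - norm (\<zeta> w))"]) auto
qed

end

section \<open>Touching by quadratics under blow-up\<close>

text \<open>
  The Hessians of all quadratics that touch \<open>a\<close> strictly from above satisfy \<open>T\<close>. Strictness is expressed by a gap between
  a centre and a sphere, which is stable under locally uniform convergence. The position and the slope of the contact are left out because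
  blow-ups change them.
\<close>
definition touched_only_by :: "(real^'n^'n \<Rightarrow> bool) \<Rightarrow> (real^'n \<Rightarrow> real) \<Rightarrow> bool" where
  "touched_only_by T a \<longleftrightarrow> (\<forall>c \<rho> p X. 0 < \<rho> \<longrightarrow> symmetric_matrix X \<longrightarrow>
     (\<forall>z\<in>sphere c \<rho>. a z - (p \<bullet> z + quad ((*v) X) z) < a c - (p \<bullet> c + quad ((*v) X) c)) \<longrightarrow> T X)"

lemma touched_only_by_rescale:
  fixes a :: "real^'n \<Rightarrow> real"
  assumes a: "touched_only_by T a" and s: "0 < s"
  shows "touched_only_by T (\<lambda>x. (a (z + s *\<^sub>R x) - b - s * (p \<bullet> x)) / s\<^sup>2)" (is "touched_only_by T ?a'")
  unfolding touched_only_by_def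
proof (intro allI impI)
  fix c \<rho> q and X :: "real^'n^'n"
  assume \<rho>: "0 < \<rho>" and X: "symmetric_matrix X"
    and st: "\<forall>x\<in>sphere c \<rho>. ?a' x - (q \<bullet> x + quad ((*v) X) x) < ?a' c - (q \<bullet> c + quad ((*v) X) c)"
  have sa: "selfadjoint ((*v) X)" by (rule selfadjoint_matrix[OF X])
  define q' where "q' = s *\<^sub>R q + p - X *v z"
  have key: "a (z + s *\<^sub>R x) - (q' \<bullet> (z + s *\<^sub>R x) + quad ((*v) X) (z + s *\<^sub>R x))
      = s\<^sup>2 * (?a' x - (q \<bullet> x + quad ((*v) X) x)) + (b - q' \<bullet> z - quad ((*v) X) z)" for x
  proof -
    have N: "s\<^sup>2 * (N / s\<^sup>2) = N" for N :: real using s by simp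
    have "s\<^sup>2 * (?a' x - (q \<bullet> x + quad ((*v) X) x)) = a (z + s *\<^sub>R x) - b - s * (p \<bullet> x) - s\<^sup>2 * (q \<bullet> x) - quad ((*v) X) (s *\<^sub>R x)"
      unfolding right_diff_distrib[of "s\<^sup>2"] N by (simp add: distrib_left quad_scaleR[OF sa])
    moreover have "quad ((*v) X) (z + s *\<^sub>R x) = quad ((*v) X) z + s * ((X *v z) \<bullet> x) + quad ((*v) X) (s *\<^sub>R x)"
      by (simp add: quad_add[OF sa])
    moreover have "q' \<bullet> (z + s *\<^sub>R x) = q' \<bullet> z + s\<^sup>2 * (q \<bullet> x) + s * (p \<bullet> x) - s * ((X *v z) \<bullet> x)"
      by (simp add: q'_def inner_add_left inner_add_right inner_diff_left algebra_simps power2_eq_square)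
    ultimately show ?thesis by simp
  qed
  show "T X"
  proof (rule a[unfolded touched_only_by_def, rule_format, of "s * \<rho>" X "z + s *\<^sub>R c" q'])
    show "0 < s * \<rho>" using s \<rho> by simp
    fix w assume w: "w \<in> sphere (z + s *\<^sub>R c) (s * \<rho>)"
    define x where "x = (w - z) /\<^sub>R s"
    have wx: "w = z + s *\<^sub>R x" using s by (simp add: x_def)
    have "dist (s *\<^sub>R c) (s *\<^sub>R x) = s * \<rho>" using w by (simp add: wx dist_norm)
    then have "s * dist c x = s * \<rho>" using s by (simp add: dist_norm flip: scaleR_diff_right)
    then have "x \<in> sphere c \<rho>" using s by simp
    then show "a w - (q' \<bullet> w + quad ((*v) X) w) < a (z + s *\<^sub>R c) - (q' \<bullet> (z + s *\<^sub>R c) + quad ((*v) X) (z + s *\<^sub>R c))"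
      unfolding wx key using st s by simp
  qed (rule X)
qed

lemma strict_touching_stable:
  fixes a :: "nat \<Rightarrow> real^'n \<Rightarrow> real"
  assumes cc: "\<And>r y y0. strict_mono (r::nat\<Rightarrow>nat) \<Longrightarrow> y \<longlonglongrightarrow> y0 \<Longrightarrow> (\<lambda>m. a (r m) (y m)) \<longlonglongrightarrow> A y0"
    and \<rho>: "0 < \<rho>" and X: "symmetric_matrix X"
    and st: "\<And>z. z \<in> sphere c \<rho> \<Longrightarrow> A z - (p \<bullet> z + quad ((*v) X) z) < A c - (p \<bullet> c + quad ((*v) X) c)"
  shows "\<forall>\<^sub>F m in sequentially. \<forall>z\<in>sphere c \<rho>. a m z - (p \<bullet> z + quad ((*v) X) z) < a m c - (p \<bullet> c + quad ((*v) X) c)"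
proof (rule ccontr)
  assume "\<not> ?thesis"
  then obtain r :: "nat \<Rightarrow> nat" where r: "strict_mono r"
    and "\<And>n. \<exists>z\<in>sphere c \<rho>. \<not> a (r n) z - (p \<bullet> z + quad ((*v) X) z) < a (r n) c - (p \<bullet> c + quad ((*v) X) c)"
    using not_eventually_sequentiallyD by blast
  then obtain z where z: "\<And>n. z n \<in> sphere c \<rho>"
    and bad: "\<And>n. a (r n) c - (p \<bullet> c + quad ((*v) X) c) \<le> a (r n) (z n) - (p \<bullet> z n + quad ((*v) X) (z n))"
    by (metis not_less)
  obtain z0 r' where z0: "z0 \<in> sphere c \<rho>" and r': "strict_mono (r'::nat\<Rightarrow>nat)" "(z \<circ> r') \<longlonglongrightarrow> z0"
    using compact_sphere[of c \<rho>] z unfolding compact_def by metis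
  have rr: "strict_mono (\<lambda>m. r (r' m))" using strict_mono_o[OF r r'(1)] by (simp add: o_def)
  have zl: "(\<lambda>m. z (r' m)) \<longlonglongrightarrow> z0" using r'(2) by (simp add: o_def)
  have ql: "(\<lambda>m. quad ((*v) X) (z (r' m))) \<longlonglongrightarrow> quad ((*v) X) z0"
    by (rule continuous_on_tendsto_compose[OF continuous_on_quad[OF selfadjoint_matrix[OF X], of UNIV] zl]) auto
  have "A c - (p \<bullet> c + quad ((*v) X) c) \<le> A z0 - (p \<bullet> z0 + quad ((*v) X) z0)"
  proof (rule LIMSEQ_le)
    show "(\<lambda>m. a (r (r' m)) c - (p \<bullet> c + quad ((*v) X) c)) \<longlonglongrightarrow> A c - (p \<bullet> c + quad ((*v) X) c)"
      by (intro tendsto_intros cc[OF rr])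
    show "(\<lambda>m. a (r (r' m)) (z (r' m)) - (p \<bullet> z (r' m) + quad ((*v) X) (z (r' m)))) \<longlonglongrightarrow> A z0 - (p \<bullet> z0 + quad ((*v) X) z0)"
      by (intro tendsto_intros cc[OF rr zl] zl ql)
    show "\<exists>N. \<forall>n\<ge>N. a (r (r' n)) c - (p \<bullet> c + quad ((*v) X) c) \<le> a (r (r' n)) (z (r' n)) - (p \<bullet> z (r' n) + quad ((*v) X) (z (r' n)))"
      using bad by blast
  qed
  with st[OF z0] show False by simp
qed

lemma touched_only_by_limit:
  fixes a :: "nat \<Rightarrow> real^'n \<Rightarrow> real"
  assumes "\<And>m. touched_only_by T (a m)"
    and cc: "\<And>r y y0. strict_mono (r::nat\<Rightarrow>nat) \<Longrightarrow> y \<longlonglongrightarrow> y0 \<Longrightarrow> (\<lambda>m. a (r m) (y m)) \<longlonglongrightarrow> A y0"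
  shows "touched_only_by T A"
  unfolding touched_only_by_def
proof (intro allI impI)
  fix c \<rho> p and X :: "real^'n^'n"
  assume *: "0 < \<rho>" "symmetric_matrix X"
    and st: "\<forall>z\<in>sphere c \<rho>. A z - (p \<bullet> z + quad ((*v) X) z) < A c - (p \<bullet> c + quad ((*v) X) c)"
  have "\<forall>\<^sub>F m in sequentially. \<forall>z\<in>sphere c \<rho>. a m z - (p \<bullet> z + quad ((*v) X) z) < a m c - (p \<bullet> c + quad ((*v) X) c)"
    by (rule strict_touching_stable[OF _ * st[rule_format]]) (rule cc; assumption)
  then obtain m where "\<forall>z\<in>sphere c \<rho>. a m z - (p \<bullet> z + quad ((*v) X) z) < a m c - (p \<bullet> c + quad ((*v) X) c)"
    using eventually_happens'[OF sequentially_bot] by blast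
  then show "T X" using assms(1)[of m] * unfolding touched_only_by_def by blast
qed

text \<open>
  In the first blow-up the contact takes place within \<open>O(\<sigma> m)\<close> of the point \<open>x m\<close>, with a slope within
  \<open>O(\<sigma> m)\<close> of \<open>P m\<close>. So \<open>T\<close> may record that both are small; later blow-ups only keep \<open>T\<close>.
\<close>
lemma touched_only_by_blow_up:
  fixes U :: "real^'n \<Rightarrow> real" and x P :: "nat \<Rightarrow> real^'n"
  assumes cU: "continuous_on UNIV U"
    and \<sigma>: "\<And>m. 0 < \<sigma> m" "\<sigma> \<longlonglongrightarrow> 0" and x: "\<And>m. norm (x m) \<le> \<rho>1" "\<rho>1 < \<rho>2" and P: "\<And>m. norm (P m) \<le> \<pi>1" "\<pi>1 < \<pi>2"
    and cc: "\<And>r y y0. strict_mono (r::nat\<Rightarrow>nat) \<Longrightarrow> y \<longlonglongrightarrow> y0 \<Longrightarrow>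
        (\<lambda>m. (U (x (r m) + \<sigma> (r m) *\<^sub>R y m) - b (r m) - \<sigma> (r m) * (P (r m) \<bullet> y m)) / (\<sigma> (r m))\<^sup>2) \<longlonglongrightarrow> A y0"
    and touch: "\<And>w p X e. norm w < \<rho>2 \<Longrightarrow> norm p < \<pi>2 \<Longrightarrow> symmetric_matrix X \<Longrightarrow> 0 < e \<Longrightarrow>
        (\<And>v. norm v < e \<Longrightarrow> U (w + v) \<le> U w + p \<bullet> v + quad ((*v) X) v) \<Longrightarrow> T X"
  shows "touched_only_by T A"
  unfolding touched_only_by_def
proof (intro allI impI)
  fix c \<rho> q and X :: "real^'n^'n"
  assume \<rho>: "0 < \<rho>" and X: "symmetric_matrix X"
    and st: "\<forall>z\<in>sphere c \<rho>. A z - (q \<bullet> z + quad ((*v) X) z) < A c - (q \<bullet> c + quad ((*v) X) c)"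
  have sa: "selfadjoint ((*v) X)" by (rule selfadjoint_matrix[OF X])
  define a where "a = (\<lambda>m y. (U (x m + \<sigma> m *\<^sub>R y) - b m - \<sigma> m * (P m \<bullet> y)) / (\<sigma> m)\<^sup>2)"
  have ev1: "\<forall>\<^sub>F m in sequentially. \<forall>z\<in>sphere c \<rho>. a m z - (q \<bullet> z + quad ((*v) X) z) < a m c - (q \<bullet> c + quad ((*v) X) c)"
    by (rule strict_touching_stable[OF _ \<rho> X st[rule_format]]) (use cc in \<open>auto simp: a_def\<close>)
  define R where "R = norm c + \<rho>"
  obtain B where B: "0 < B" "\<And>x. norm (X *v x) \<le> B * norm x" using selfadjoint_bound[OF sa] by metis
  have "(\<lambda>m. \<sigma> m * R) \<longlonglongrightarrow> 0" "(\<lambda>m. \<sigma> m * (norm q + B * R)) \<longlonglongrightarrow> 0"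
    using tendsto_mult_left_zero[OF \<sigma>(2)] by blast+
  then have ev2: "\<forall>\<^sub>F m in sequentially. \<sigma> m * R < \<rho>2 - \<rho>1" "\<forall>\<^sub>F m in sequentially. \<sigma> m * (norm q + B * R) < \<pi>2 - \<pi>1"
    using x(2) P(2) by (auto intro: order_tendstoD)
  have "\<forall>\<^sub>F m in sequentially. (\<forall>z\<in>sphere c \<rho>. a m z - (q \<bullet> z + quad ((*v) X) z) < a m c - (q \<bullet> c + quad ((*v) X) c))
      \<and> \<sigma> m * R < \<rho>2 - \<rho>1 \<and> \<sigma> m * (norm q + B * R) < \<pi>2 - \<pi>1"
    using ev1 ev2 by eventually_elim blast
  then obtain m where st': "\<And>z. z \<in> sphere c \<rho> \<Longrightarrow> a m z - (q \<bullet> z + quad ((*v) X) z) < a m c - (q \<bullet> c + quad ((*v) X) c)"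
    and sm: "\<sigma> m * R < \<rho>2 - \<rho>1" "\<sigma> m * (norm q + B * R) < \<pi>2 - \<pi>1"
    using eventually_happens'[OF sequentially_bot] by blast
  define s where "s = \<sigma> m"
  have s: "0 < s" by (simp add: s_def \<sigma>)
  define \<psi> where "\<psi> = (\<lambda>z. a m z - (q \<bullet> z + quad ((*v) X) z))"
  have "continuous_on (cball c \<rho>) \<psi>"
    unfolding \<psi>_def a_def using \<sigma>(1)[of m]
    by (intro continuous_intros continuous_on_compose2[OF cU] continuous_on_quad[OF sa]) auto
  then obtain h where h: "h \<in> cball c \<rho>" "\<And>z. z \<in> cball c \<rho> \<Longrightarrow> \<psi> z \<le> \<psi> h"
    using continuous_attains_sup[of "cball c \<rho>" \<psi>] \<rho> by auto
  have "h \<notin> sphere c \<rho>" using st'[of h] h(2)[of c] \<rho> by (auto simp: \<psi>_def)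
  then have hb: "dist c h < \<rho>" using h(1) by auto
  have hR: "norm h \<le> R" using h(1) norm_triangle_sub[of h c] by (simp add: R_def dist_norm norm_minus_commute)
  define w where "w = x m + s *\<^sub>R h"
  define p where "p = P m + s *\<^sub>R (q + X *v h)"
  have "norm (s *\<^sub>R h) \<le> s * R" using hR s by simp
  then have w: "norm w < \<rho>2"
    unfolding w_def using norm_triangle_ineq[of "x m" "s *\<^sub>R h"] x(1)[of m] sm(1)[folded s_def] by linarith
  have "norm (q + X *v h) \<le> norm q + B * R"
    using norm_triangle_ineq[of q "X *v h"] B(2)[of h] mult_left_mono[OF hR, of B] B(1) by linarith
  then have "norm (s *\<^sub>R (q + X *v h)) \<le> s * (norm q + B * R)" using s by simp
  then have p: "norm p < \<pi>2"
    unfolding p_def using norm_triangle_ineq[of "P m" "s *\<^sub>R (q + X *v h)"] P(1)[of m] sm(2)[folded s_def] by linarith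
  have e: "0 < s * (\<rho> - dist c h)" using s hb by simp
  show "T X"
  proof (rule touch[OF w p X e])
    fix v :: "real^'n" assume v: "norm v < s * (\<rho> - dist c h)"
    define y where "y = v /\<^sub>R s"
    have vy: "v = s *\<^sub>R y" using s by (simp add: y_def)
    have "norm y < \<rho> - dist c h" using v s by (simp add: vy)
    then have "h + y \<in> cball c \<rho>" using dist_triangle[of c "h + y" h] by (simp add: dist_norm)
    then have "\<psi> (h + y) \<le> \<psi> h" by (rule h(2))
    then have le: "s\<^sup>2 * a m (h + y) \<le> s\<^sup>2 * a m h + s\<^sup>2 * (q \<bullet> y + (X *v h) \<bullet> y + quad ((*v) X) y)"
      unfolding \<psi>_def quad_add[OF sa] using s by (simp add: inner_add_right flip: distrib_left)
    have eq: "s\<^sup>2 * a m z = U (x m + s *\<^sub>R z) - b m - s * (P m \<bullet> z)" for z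
      using s by (simp add: a_def s_def[symmetric])
    have "U (x m + s *\<^sub>R (h + y)) \<le> U w + s * (P m \<bullet> y) + s\<^sup>2 * (q \<bullet> y + (X *v h) \<bullet> y + quad ((*v) X) y)"
      using le unfolding eq by (simp add: w_def inner_add_right algebra_simps)
    moreover have "x m + s *\<^sub>R (h + y) = w + v" by (simp add: w_def vy algebra_simps)
    moreover have "s * (P m \<bullet> y) + s\<^sup>2 * (q \<bullet> y + (X *v h) \<bullet> y + quad ((*v) X) y) = p \<bullet> v + quad ((*v) X) v"
      unfolding vy quad_scaleR[OF sa] by (simp add: p_def inner_add_left algebra_simps power2_eq_square)
    ultimately show "U (w + v) \<le> U w + p \<bullet> v + quad ((*v) X) v" by simp
  qed
qed

section \<open>The theorem on sums\<close>

text \<open>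
  Sums of a function of \<open>x\<close> and a function of \<open>y\<close>, expressed without reference to the two summands.
\<close>
definition separated :: "('a \<times> 'b \<Rightarrow> real) \<Rightarrow> bool" where
  "separated f \<longleftrightarrow> (\<forall>x x' y y'. f (x, y) + f (x', y') = f (x, y') + f (x', y))"

text \<open>
  A single slope \<open>p\<close> serves both bounds. The function is thus differentiable everywhere, and its second differences lie between
  those of the two quadratic forms.
\<close>
definition pinched :: "real \<Rightarrow> ('a::real_inner \<Rightarrow> 'a) \<Rightarrow> ('a \<Rightarrow> real) \<Rightarrow> bool" where
  "pinched C M f \<longleftrightarrow> (\<forall>z. \<exists>p. \<forall>h. f z + p \<bullet> h - C * (norm h)\<^sup>2 \<le> f (z + h) \<and> f (z + h) \<le> f z + p \<bullet> h + quad M h)"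

text \<open>
  The class to which the blow-ups of \<open>U1 x + U2 y\<close> belong, \<open>U1\<close> and \<open>U2\<close> being sup-convolutions.
\<close>
definition doubled_class ::
  "real \<Rightarrow> ((real^'n) \<times> (real^'n) \<Rightarrow> (real^'n) \<times> (real^'n)) \<Rightarrow> (real^'n^'n \<Rightarrow> bool) \<Rightarrow> (real^'n^'n \<Rightarrow> bool)
    \<Rightarrow> ((real^'n) \<times> (real^'n) \<Rightarrow> real) set" where
  "doubled_class C M T1 T2 = {f. pinched C M f \<and> separated f \<and>
     (\<forall>y. touched_only_by T1 (\<lambda>x. f (x, y))) \<and> (\<forall>x. touched_only_by T2 (\<lambda>y. f (x, y)))}"

lemma separated_rescale:
  fixes f :: "'a::real_inner \<times> 'b::real_inner \<Rightarrow> real"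
  assumes "separated f" shows "separated (rescale f z p s)"
  unfolding separated_def
proof (intro allI)
  fix x x' y y'
  have "f (fst z + s *\<^sub>R x, snd z + s *\<^sub>R y) + f (fst z + s *\<^sub>R x', snd z + s *\<^sub>R y')
      = f (fst z + s *\<^sub>R x, snd z + s *\<^sub>R y') + f (fst z + s *\<^sub>R x', snd z + s *\<^sub>R y)"
    using assms by (simp add: separated_def)
  then show "rescale f z p s (x, y) + rescale f z p s (x', y') = rescale f z p s (x, y') + rescale f z p s (x', y)"
    unfolding rescale_def by (cases z; cases p) (simp add: add_divide_distrib[symmetric] algebra_simps)
qed

lemma pinched_rescale:
  assumes f: "pinched C M f" and M: "selfadjoint M" and s: "0 < s"
  shows "pinched C M (rescale f z p s)"
  unfolding pinched_def
proof
  fix k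
  obtain q where q: "\<And>h. f (z + s *\<^sub>R k) + q \<bullet> h - C * (norm h)\<^sup>2 \<le> f (z + s *\<^sub>R k + h)"
     "\<And>h. f (z + s *\<^sub>R k + h) \<le> f (z + s *\<^sub>R k) + q \<bullet> h + quad M h"
    using f unfolding pinched_def by metis
  show "\<exists>g. \<forall>h. rescale f z p s k + g \<bullet> h - C * (norm h)\<^sup>2 \<le> rescale f z p s (k + h) \<and>
           rescale f z p s (k + h) \<le> rescale f z p s k + g \<bullet> h + quad M h"
    using rescale_lower[OF s q(1)] rescale_upper[OF s M q(2)] by blast
qed

lemma pinched_imp_semiconvex: "pinched C M f \<Longrightarrow> semiconvex C f"
  unfolding pinched_def semiconvex_def by blast

lemma pinched_imp_taylor_bounded:
  assumes f: "pinched C M f" and B: "\<And>h. \<bar>quad M h\<bar> \<le> B * (norm h)\<^sup>2" and "0 \<le> B" "0 \<le> C"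
  shows "taylor_bounded (C + B) f"
  unfolding taylor_bounded_def
proof
  fix z
  obtain p where p: "\<And>h. f z + p \<bullet> h - C * (norm h)\<^sup>2 \<le> f (z + h)" "\<And>h. f (z + h) \<le> f z + p \<bullet> h + quad M h"
    using f unfolding pinched_def by metis
  have "\<bar>f (z + h) - f z - p \<bullet> h\<bar> \<le> (C + B) * (norm h)\<^sup>2" for h
  proof -
    have "0 \<le> C * (norm h)\<^sup>2" "0 \<le> B * (norm h)\<^sup>2" using assms by auto
    then show ?thesis using p[of h] B[of h] by (simp add: abs_le_iff distrib_right)
  qed
  then show "\<exists>p. \<forall>h. \<bar>f (z + h) - f z - p \<bullet> h\<bar> \<le> (C + B) * (norm h)\<^sup>2" by blast
qed

lemma blowup_closed_doubled_class:
  fixes M :: "(real^'n) \<times> (real^'n) \<Rightarrow> (real^'n) \<times> (real^'n)"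
  assumes M: "selfadjoint M" and B: "\<And>h. \<bar>quad M h\<bar> \<le> B * (norm h)\<^sup>2" "0 \<le> B" and C: "0 \<le> C"
  shows "blowup_closed (C + B) (doubled_class C M T1 T2)" (is "blowup_closed _ ?G")
  unfolding blowup_closed_def
proof (intro conjI ballI allI impI)
  fix f assume "f \<in> ?G"
  then show "taylor_bounded (C + B) f"
    using pinched_imp_taylor_bounded[OF _ B C] by (simp add: doubled_class_def)
next
  fix f z p and s :: real assume f: "f \<in> ?G" and s: "0 < s"
  have "touched_only_by T1 (\<lambda>x. rescale f z p s (x, y))" for y
  proof -
    have "touched_only_by T1 (\<lambda>x. f (x, snd z + s *\<^sub>R y))" using f by (simp add: doubled_class_def)
    from touched_only_by_rescale[OF this s, of "fst z" "f z + s * (snd p \<bullet> y)" "fst p"]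
    show ?thesis by (simp add: rescale_def inner_prod_def plus_prod_def scaleR_prod_def algebra_simps)
  qed
  moreover have "touched_only_by T2 (\<lambda>y. rescale f z p s (x, y))" for x
  proof -
    have "touched_only_by T2 (\<lambda>y. f (fst z + s *\<^sub>R x, y))" using f by (simp add: doubled_class_def)
    from touched_only_by_rescale[OF this s, of "snd z" "f z + s * (fst p \<bullet> x)" "snd p"]
    show ?thesis by (simp add: rescale_def inner_prod_def plus_prod_def scaleR_prod_def algebra_simps)
  qed
  ultimately show "rescale f z p s \<in> ?G"
    using f separated_rescale[of f z p s] pinched_rescale[OF _ M s, of C f z p] by (simp add: doubled_class_def)
next
  fix F f
  assume F: "\<forall>m::nat. F m \<in> ?G" and b: "\<forall>m h. \<bar>F m h\<bar> \<le> (C + B) * (norm h)\<^sup>2" and lim: "\<forall>h. (\<lambda>m. F m h) \<longlonglongrightarrow> f h"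
  have sc: "semiconvex C (F m)" for m
    by (rule pinched_imp_semiconvex[where M = M]) (use F in \<open>simp add: doubled_class_def\<close>)
  have bd: "\<exists>B. \<forall>\<^sub>F m in sequentially. \<forall>h. norm h \<le> R \<longrightarrow> \<bar>F m h\<bar> \<le> B" for R
    using quadratically_bounded_imp_locally_bounded[of "C + B" F] b C B by simp
  have cc: "(\<lambda>m. F (r m) (y m)) \<longlonglongrightarrow> f y0" if "strict_mono (r :: nat \<Rightarrow> nat)" "y \<longlonglongrightarrow> y0" for r y y0
    by (rule semiconvex_continuous_convergence_subseq[OF sc bd _ that]) (use lim in blast)
  have "pinched C M f"
    unfolding pinched_def
  proof
    fix z
    have "\<exists>p. \<forall>h. F m z + p \<bullet> h - C * (norm h)\<^sup>2 \<le> F m (z + h) \<and> F m (z + h) \<le> F m z + p \<bullet> h + quad M h" for m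
    proof -
      have "pinched C M (F m)" using F by (simp add: doubled_class_def)
      then show ?thesis unfolding pinched_def by blast
    qed
    then obtain g where g: "\<And>m. \<forall>h. F m z + g m \<bullet> h - C * (norm h)\<^sup>2 \<le> F m (z + h) \<and> F m (z + h) \<le> F m z + g m \<bullet> h + quad M h"
      by metis
    show "\<exists>p. \<forall>h. f z + p \<bullet> h - C * (norm h)\<^sup>2 \<le> f (z + h) \<and> f (z + h) \<le> f z + p \<bullet> h + quad M h"
      by (rule two_sided_touching_limit[OF sc bd _ tendsto_const, of f z g]) (use lim g in auto)
  qed
  moreover have "separated f"
    unfolding separated_def
  proof (intro allI)
    fix x x' y y'
    show "f (x, y) + f (x', y') = f (x, y') + f (x', y)"
    proof (rule LIMSEQ_unique)
      show "(\<lambda>m. F m (x, y) + F m (x', y')) \<longlonglongrightarrow> f (x, y) + f (x', y')"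
        by (intro tendsto_intros lim[rule_format])
      have "(\<lambda>m. F m (x, y') + F m (x', y)) \<longlonglongrightarrow> f (x, y') + f (x', y)"
        by (intro tendsto_intros lim[rule_format])
      moreover have "F m (x, y') + F m (x', y) = F m (x, y) + F m (x', y')" for m
        using F by (auto simp: doubled_class_def separated_def)
      ultimately show "(\<lambda>m. F m (x, y) + F m (x', y')) \<longlonglongrightarrow> f (x, y') + f (x', y)" by simp
    qed
  qed
  moreover have "touched_only_by T1 (\<lambda>x. f (x, y))" for y
  proof (rule touched_only_by_limit)
    show "touched_only_by T1 (\<lambda>x. F m (x, y))" for m using F by (simp add: doubled_class_def)
    show "(\<lambda>m. F (r m) (w m, y)) \<longlonglongrightarrow> f (w0, y)" if "strict_mono (r :: nat \<Rightarrow> nat)" "w \<longlonglongrightarrow> w0" for r w w0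
      by (intro cc that tendsto_intros)
  qed
  moreover have "touched_only_by T2 (\<lambda>y. f (x, y))" for x
  proof (rule touched_only_by_limit)
    show "touched_only_by T2 (\<lambda>y. F m (x, y))" for m using F by (simp add: doubled_class_def)
    show "(\<lambda>m. F (r m) (x, w m)) \<longlonglongrightarrow> f (x, w0)" if "strict_mono (r :: nat \<Rightarrow> nat)" "w \<longlonglongrightarrow> w0" for r w w0
      by (intro cc that tendsto_intros)
  qed
  ultimately show "f \<in> ?G" by (simp add: doubled_class_def)
qed

lemma selfadjoint_imp_matrix:
  fixes L :: "real^'n \<Rightarrow> real^'n"
  assumes "selfadjoint L"
  shows "symmetric_matrix (matrix L)" "(*v) (matrix L) = L"
proof -
  have lin: "linear L" using assms by (simp add: selfadjoint_def)
  show *: "(*v) (matrix L) = L" using lin by (auto simp: fun_eq_iff)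
  have "transpose (matrix L) *v y = matrix L *v y" for y
  proof (rule vector_eq_ldot[THEN iffD1], intro allI)
    fix x
    have "x \<bullet> (transpose (matrix L) *v y) = (matrix L *v x) \<bullet> y"
      by (metis dot_lmul_matrix inner_commute transpose_matrix_vector)
    also have "\<dots> = x \<bullet> (matrix L *v y)" using assms unfolding * selfadjoint_def by metis
    finally show "x \<bullet> (transpose (matrix L) *v y) = x \<bullet> (matrix L *v y)" .
  qed
  then show "symmetric_matrix (matrix L)" unfolding symmetric_matrix_def by (simp add: matrix_eq)
qed

text \<open>
  Separation removes the off-diagonal blocks of the quadratic form in the class, and adding \<open>e\<close> times the identity to
  the diagonal blocks makes the touching strict.
\<close>
lemma doubled_class_block_quadratic:
  fixes M :: "(real^'n) \<times> (real^'n) \<Rightarrow> (real^'n) \<times> (real^'n)"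
  assumes M: "selfadjoint M" and C: "0 \<le> C" and ne: "doubled_class C M T1 T2 \<noteq> {}" and e: "0 < e"
  obtains X Y where "T1 X" "T2 Y" "symmetric_matrix X" "symmetric_matrix Y"
    "\<And>h k. h \<bullet> (X *v h) + k \<bullet> (Y *v k) \<le> 2 * quad M (h, k) + e * ((norm h)\<^sup>2 + (norm k)\<^sup>2)"
proof -
  obtain B where B: "0 < B" "\<And>x. norm (M x) \<le> B * norm x" "\<And>x. \<bar>quad M x\<bar> \<le> B * (norm x)\<^sup>2"
    using selfadjoint_bound[OF M] by metis
  have "blowup_closed (C + B) (doubled_class C M T1 T2)"
    by (rule blowup_closed_doubled_class[OF M B(3)]) (use B C in auto)
  then obtain N where N: "selfadjoint N" and NG: "quad N \<in> doubled_class C M T1 T2"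
    using blowup_closed_contains_quadratic[of "C + B"] B C ne by (metis add_nonneg_nonneg less_eq_real_def)
  have q0: "quad N 0 = 0" by (simp add: quad_def)
  have le: "quad N h \<le> quad M h" for h
  proof -
    obtain p where p: "\<And>h. quad N 0 + p \<bullet> h - C * (norm h)\<^sup>2 \<le> quad N (0 + h)" "\<And>h. quad N (0 + h) \<le> quad N 0 + p \<bullet> h + quad M h"
      using NG unfolding doubled_class_def pinched_def by blast
    obtain B' where B': "\<And>x. \<bar>quad N x\<bar> \<le> B' * (norm x)\<^sup>2" using quad_bound[OF N] by blast
    have "p = 0"
    proof (rule linear_below_quadratic_eq_0[of 1 _ "C + B'"])
      show "p \<bullet> h \<le> (C + B') * (norm h)\<^sup>2" for h
        using p(1)[of h] B'[of h] q0 by (simp add: distrib_right abs_le_iff)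
    qed simp
    then show ?thesis using p(2)[of h] q0 by simp
  qed
  have sep: "quad N (x, y) = quad N (x, 0) + quad N (0, y)" for x y
  proof -
    have "quad N (x, y) + quad N (0, 0) = quad N (x, 0) + quad N (0, y)"
      using NG unfolding doubled_class_def separated_def by blast
    then show ?thesis using q0 by (simp add: zero_prod_def)
  qed
  define L1 where "L1 = (\<lambda>x. fst (N (x, 0)) + e *\<^sub>R x)"
  define L2 where "L2 = (\<lambda>y. snd (N (0, y)) + e *\<^sub>R y)"
  have linN: "linear N" and symN: "\<And>x y. x \<bullet> N y = N x \<bullet> y" using N by (auto simp: selfadjoint_def)
  have Nadd: "N (x + x', 0) = N (x, 0) + N (x', 0)" "N (0, y + y') = N (0, y) + N (0, y')" for x x' y y'
    using linear_add[OF linN, of "(x, 0)" "(x', 0)"] linear_add[OF linN, of "(0, y)" "(0, y')"] by simp_all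
  have Nsc: "N (c *\<^sub>R x, 0) = c *\<^sub>R N (x, 0)" "N (0, c *\<^sub>R y) = c *\<^sub>R N (0, y)" for c x y
    using linear_cmul[OF linN, of c "(x, 0)"] linear_cmul[OF linN, of c "(0, y)"] by simp_all
  have "selfadjoint L1"
    unfolding selfadjoint_def
  proof (intro conjI allI)
    show "linear L1" unfolding L1_def by (intro linearI) (simp_all add: Nadd Nsc algebra_simps)
    show "x \<bullet> L1 y = L1 x \<bullet> y" for x y
      using symN[of "(x, 0)" "(y, 0)"] by (simp add: L1_def inner_prod_def inner_add_left inner_add_right)
  qed
  have "selfadjoint L2"
    unfolding selfadjoint_def
  proof (intro conjI allI)
    show "linear L2" unfolding L2_def by (intro linearI) (simp_all add: Nadd Nsc algebra_simps)
    show "x \<bullet> L2 y = L2 x \<bullet> y" for x y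
      using symN[of "(0, x)" "(0, y)"] by (simp add: L2_def inner_prod_def inner_add_left inner_add_right)
  qed
  note X = selfadjoint_imp_matrix[OF \<open>selfadjoint L1\<close>]
  note Y = selfadjoint_imp_matrix[OF \<open>selfadjoint L2\<close>]
  have q1: "quad L1 x = quad N (x, 0) + e / 2 * (norm x)\<^sup>2" for x
    by (simp add: quad_def L1_def inner_prod_def inner_add_right power2_norm_eq_inner field_simps)
  have q2: "quad L2 y = quad N (0, y) + e / 2 * (norm y)\<^sup>2" for y
    by (simp add: quad_def L2_def inner_prod_def inner_add_right power2_norm_eq_inner field_simps)
  have "T1 (matrix L1)"
  proof -
    have "touched_only_by T1 (\<lambda>x. quad N (x, 0))" using NG by (simp add: doubled_class_def)
    moreover have "quad N (z, 0) - (0 \<bullet> z + quad ((*v) (matrix L1)) z) < quad N (0, 0) - (0 \<bullet> 0 + quad ((*v) (matrix L1)) 0)"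
      if "z \<in> sphere 0 1" for z
      using that e q0 by (simp add: X(2) q1 zero_prod_def)
    ultimately show ?thesis using X(1) unfolding touched_only_by_def by (metis zero_less_one)
  qed
  moreover have "T2 (matrix L2)"
  proof -
    have "touched_only_by T2 (\<lambda>y. quad N (0, y))" using NG by (simp add: doubled_class_def)
    moreover have "quad N (0, z) - (0 \<bullet> z + quad ((*v) (matrix L2)) z) < quad N (0, 0) - (0 \<bullet> 0 + quad ((*v) (matrix L2)) 0)"
      if "z \<in> sphere 0 1" for z
      using that e q0 by (simp add: Y(2) q2 zero_prod_def)
    ultimately show ?thesis using Y(1) unfolding touched_only_by_def by (metis zero_less_one)
  qed
  moreover have "h \<bullet> (matrix L1 *v h) + k \<bullet> (matrix L2 *v k) \<le> 2 * quad M (h, k) + e * ((norm h)\<^sup>2 + (norm k)\<^sup>2)" for h k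
  proof -
    have "h \<bullet> (matrix L1 *v h) = 2 * quad L1 h" "k \<bullet> (matrix L2 *v k) = 2 * quad L2 k"
      by (simp_all add: X(2) Y(2) quad_def)
    then show ?thesis using le[of "(h, k)"] sep[of h k] by (simp add: q1 q2 algebra_simps)
  qed
  ultimately show thesis using that X(1) Y(1) by blast
qed

lemma sup_convolution_exists:
  fixes D :: "(real^'n) set"
  assumes D: "closed D" "0 \<in> D" and usc: "usc_on D u" and r: "0 < r" and k: "0 < k"
  obtains U \<zeta> where "sup_convolution D (D \<inter> cball 0 r) u U \<zeta> k r"
proof -
  have E: "compact (D \<inter> cball 0 r)" "D \<inter> cball 0 r \<noteq> {}"
    using D r by (auto intro: closed_Int_compact)
  have "\<exists>\<zeta>. \<zeta> \<in> D \<inter> cball 0 r \<and> (\<forall>z\<in>D \<inter> cball 0 r. u z - k * (norm (x - z))\<^sup>2 \<le> u \<zeta> - k * (norm (x - \<zeta>))\<^sup>2)" for x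
    using sup_convolution_attained[OF E usc, of k x] by blast
  then obtain \<zeta> where \<zeta>: "\<And>x. \<zeta> x \<in> D \<inter> cball 0 r \<and> (\<forall>z\<in>D \<inter> cball 0 r. u z - k * (norm (x - z))\<^sup>2 \<le> u (\<zeta> x) - k * (norm (x - \<zeta> x))\<^sup>2)"
    by metis
  have "sup_convolution D (D \<inter> cball 0 r) u (\<lambda>x. u (\<zeta> x) - k * (norm (x - \<zeta> x))\<^sup>2) \<zeta> k r"
    by standard (use \<zeta> r k in blast)+
  then show thesis by (rule that)
qed

text \<open>
  The competitor \<open>0\<close> in the supremum and the quadratic upper bound on \<open>u\<close> keep \<open>\<zeta> x\<close> close to \<open>x\<close> for large \<open>k\<close>. The
  point \<open>x\<close> may lie outside \<open>D\<close>, so the distance is bounded by a multiple of \<open>norm x\<close> and does not tend to \<open>0\<close> with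
  \<open>1 / k\<close>.
\<close>
lemma (in sup_convolution) contact_near_origin:
  assumes u0: "0 \<in> D" "u 0 = 0" and le: "\<And>z. z \<in> E \<Longrightarrow> u z \<le> B * (norm z)\<^sup>2" and B: "0 \<le> B" "4 * B \<le> k"
  shows "norm (\<zeta> x) \<le> 3 * norm x"
proof -
  define a where "a = norm (x - \<zeta> x)"
  have "0 \<in> E" using u0 E r by simp
  from U_ge[OF this, of x] have "- k * (norm x)\<^sup>2 \<le> U x" using u0 by simp
  then have "k * a\<^sup>2 \<le> u (\<zeta> x) + k * (norm x)\<^sup>2" by (simp add: U a_def)
  also have "u (\<zeta> x) \<le> B * (norm (\<zeta> x))\<^sup>2" by (rule le[OF \<zeta>])
  also have "B * (norm (\<zeta> x))\<^sup>2 \<le> B * (2 * a\<^sup>2 + 2 * (norm x)\<^sup>2)"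
  proof (rule mult_left_mono[OF _ B(1)])
    have "norm (\<zeta> x) \<le> a + norm x" unfolding a_def using norm_triangle_sub[of "\<zeta> x" x] by (simp add: norm_minus_commute)
    then have "(norm (\<zeta> x))\<^sup>2 \<le> (a + norm x)\<^sup>2" by (intro power_mono) auto
    also have "\<dots> \<le> 2 * a\<^sup>2 + 2 * (norm x)\<^sup>2"
      using zero_le_power2[of "a - norm x"] by (simp add: power2_eq_square algebra_simps)
    finally show "(norm (\<zeta> x))\<^sup>2 \<le> 2 * a\<^sup>2 + 2 * (norm x)\<^sup>2" .
  qed
  also have "\<dots> \<le> k / 4 * (2 * a\<^sup>2 + 2 * (norm x)\<^sup>2)" using B by (intro mult_right_mono) auto
  finally have "k * a\<^sup>2 \<le> k * (3 * (norm x)\<^sup>2)" by (simp add: algebra_simps)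
  then have "a\<^sup>2 \<le> 3 * (norm x)\<^sup>2" using k by simp
  also have "\<dots> \<le> (2 * norm x)\<^sup>2" by (simp add: power_mult_distrib)
  finally have "a \<le> 2 * norm x" by (rule power2_le_imp_le) simp
  then show ?thesis unfolding a_def using norm_triangle_sub[of "\<zeta> x" x] by (simp add: norm_minus_commute)
qed

lemma selfadjoint_add_scaleR:
  assumes "selfadjoint M" shows "selfadjoint (\<lambda>z. M z + c *\<^sub>R z)"
  using assms unfolding selfadjoint_def
  by (auto intro!: linearI simp: linear_add linear_cmul algebra_simps inner_add_left inner_add_right)

text \<open>
  The form \<open>quad M\<close> is enlarged a little to make the maximum at the origin strict. For large \<open>k\<close> the gap persists
  for the sup-convolutions, which are then blown up at contact points. The jets found in the blow-up class belong to points within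
  \<open>6 \<rho>\<close> of the origin.
\<close>
lemma theorem_on_sums_at_origin:
  fixes u1 u2 :: "real^'n \<Rightarrow> real" and M :: "(real^'n) \<times> (real^'n) \<Rightarrow> (real^'n) \<times> (real^'n)"
  assumes D1: "closed D1" "0 \<in> D1" "usc_on D1 u1" "u1 0 = 0" and D2: "closed D2" "0 \<in> D2" "usc_on D2 u2" "u2 0 = 0"
    and r: "0 < r" and M: "selfadjoint M" and e: "0 < e"
    and le: "\<And>x y. x \<in> D1 \<Longrightarrow> y \<in> D2 \<Longrightarrow> norm x \<le> r \<Longrightarrow> norm y \<le> r \<Longrightarrow> u1 x + u2 y \<le> quad M (x, y)"
  obtains x p X y q Y where "superjet D1 u1 x p X" "superjet D2 u2 y q Y" "norm x < e" "norm y < e" "norm p < e" "norm q < e"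
    "\<And>h k. h \<bullet> (X *v h) + k \<bullet> (Y *v k) \<le> 2 * quad M (h, k) + e * ((norm h)\<^sup>2 + (norm k)\<^sup>2)"
proof -
  define e' where "e' = e / 4"
  have e': "0 < e'" using e by (simp add: e'_def)
  define M' where "M' = (\<lambda>z. M z + e' *\<^sub>R z)"
  have M': "selfadjoint M'"
    unfolding M'_def by (rule selfadjoint_add_scaleR[OF M])
  have qM': "quad M' z = quad M z + e' / 2 * (norm z)\<^sup>2" for z
    by (simp add: quad_def M'_def inner_add_right power2_norm_eq_inner field_simps)
  obtain B where B: "0 < B" "\<And>x. norm (M' x) \<le> B * norm x" "\<And>x. \<bar>quad M' x\<bar> \<le> B * (norm x)\<^sup>2"
    using selfadjoint_bound[OF M'] by metis
  \<comment> \<open>the first two summands yield the gap on the sphere, the last one keeps the contact points \<open>\<zeta>\<close> close\<close>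
  define k where "k = e' / 2 + 2 * B\<^sup>2 / e' + 4 * B"
  have k: "0 < k" "4 * B \<le> k" using e' B by (auto simp: k_def intro: add_pos_pos add_nonneg_pos)
  obtain U1 \<zeta>1 where U1: "sup_convolution D1 (D1 \<inter> cball 0 r) u1 U1 \<zeta>1 k r"
    using sup_convolution_exists[OF D1(1-3) r k(1)] by blast
  obtain U2 \<zeta>2 where U2: "sup_convolution D2 (D2 \<inter> cball 0 r) u2 U2 \<zeta>2 k r"
    using sup_convolution_exists[OF D2(1-3) r k(1)] by blast
  interpret s1: sup_convolution D1 "D1 \<inter> cball 0 r" u1 U1 \<zeta>1 k r by (rule U1)
  interpret s2: sup_convolution D2 "D2 \<inter> cball 0 r" u2 U2 \<zeta>2 k r by (rule U2)
  have nP: "(norm (a, b))\<^sup>2 = (norm a)\<^sup>2 + (norm b)\<^sup>2" for a b :: "real^'n"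
    by (simp add: norm_Pair)
  have le': "u1 x + u2 y \<le> quad M' (x, y) - e' / 2 * (norm (x, y))\<^sup>2"
    if "x \<in> D1 \<inter> cball 0 r" "y \<in> D2 \<inter> cball 0 r" for x y
    using le[of x y] that by (simp add: qM')
  have le1: "u1 x \<le> B * (norm x)\<^sup>2" if "x \<in> D1 \<inter> cball 0 r" for x
  proof -
    have "u1 x + u2 0 \<le> quad M' (x, 0) - e' / 2 * (norm (x, 0::real^'n))\<^sup>2" using that D2 r by (intro le') auto
    moreover have "\<bar>quad M' (x, 0)\<bar> \<le> B * (norm (x, 0::real^'n))\<^sup>2" by (rule B)
    moreover have "0 \<le> e' / 2 * (norm x)\<^sup>2" using e' by simp
    ultimately show ?thesis using D2(4) by (simp add: nP)
  qed
  have le2: "u2 y \<le> B * (norm y)\<^sup>2" if "y \<in> D2 \<inter> cball 0 r" for y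
  proof -
    have "u1 0 + u2 y \<le> quad M' (0, y) - e' / 2 * (norm (0::real^'n, y))\<^sup>2" using that D1 r by (intro le') auto
    moreover have "\<bar>quad M' (0, y)\<bar> \<le> B * (norm (0::real^'n, y))\<^sup>2" by (rule B)
    moreover have "0 \<le> e' / 2 * (norm y)\<^sup>2" using e' by simp
    ultimately show ?thesis using D1(4) by (simp add: nP)
  qed
  have \<zeta>1: "norm (\<zeta>1 x) \<le> 3 * norm x" for x
    using s1.contact_near_origin[OF D1(2,4) le1] k B by simp
  have \<zeta>2: "norm (\<zeta>2 x) \<le> 3 * norm x" for x
    using s2.contact_near_origin[OF D2(2,4) le2] k B by simp
  define \<rho> where "\<rho> = min (min (r / 7) (e / 7)) (e / (2 * (e' / 16 + B)))"
  have \<rho>: "0 < \<rho>" "6 * \<rho> < r" "6 * \<rho> < e" "(e' / 16 + B) * \<rho> < e"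
  proof -
    show "0 < \<rho>" using r e e' B by (auto simp: \<rho>_def intro!: divide_pos_pos add_pos_pos)
    show "6 * \<rho> < r" "6 * \<rho> < e" using r e by (auto simp: \<rho>_def min_def)
    have "(e' / 16 + B) * \<rho> \<le> (e' / 16 + B) * (e / (2 * (e' / 16 + B)))"
      using e' B by (intro mult_left_mono) (auto simp: \<rho>_def)
    also have "\<dots> = e / 2" using e' B by (simp add: field_simps)
    finally show "(e' / 16 + B) * \<rho> < e" using e by simp
  qed
  define f where "f = (\<lambda>z. U1 (fst z) + U2 (snd z))"
  have cf: "continuous_on UNIV f"
    unfolding f_def by (intro continuous_intros continuous_on_compose2[OF s1.continuous] continuous_on_compose2[OF s2.continuous]) auto
  have scf: "semiconvex k f"
    unfolding semiconvex_def
  proof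
    fix z :: "(real^'n) \<times> (real^'n)"
    let ?p = "((2 * k) *\<^sub>R (\<zeta>1 (fst z) - fst z), (2 * k) *\<^sub>R (\<zeta>2 (snd z) - snd z))"
    have "f z + ?p \<bullet> h - k * (norm h)\<^sup>2 \<le> f (z + h)" for h
      using s1.semiconvex_slope[of "fst z" "fst h"] s2.semiconvex_slope[of "snd z" "snd h"] nP[of "fst h" "snd h"]
      by (simp add: f_def inner_prod_def algebra_simps)
    then show "\<exists>p. \<forall>h. f z + p \<bullet> h - k * (norm h)\<^sup>2 \<le> f (z + h)" by blast
  qed
  have gap: "f z - quad M' z + (e' * \<rho> / 16) * \<rho> < f 0" if z: "norm z = \<rho>" for z
  proof -
    define z' where "z' = (\<zeta>1 (fst z), \<zeta>2 (snd z))"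
    define w where "w = z' - z"
    define d where "d = norm w"
    have "f z = u1 (\<zeta>1 (fst z)) + u2 (\<zeta>2 (snd z)) - k * d\<^sup>2"
      by (simp add: f_def s1.U s2.U d_def w_def z'_def norm_prod_def norm_minus_commute algebra_simps)
    also have "\<dots> \<le> quad M' z' - e' / 2 * (norm z')\<^sup>2 - k * d\<^sup>2"
      using le'[OF s1.\<zeta> s2.\<zeta>] by (simp add: z'_def)
    finally have t0: "f z \<le> quad M' z' - e' / 2 * (norm z')\<^sup>2 - k * d\<^sup>2" .
    have t1: "quad M' z' = quad M' z + M' z \<bullet> w + quad M' w"
      using quad_add[OF M', of z w] by (simp add: w_def)
    have t2: "M' z \<bullet> w \<le> B * \<rho> * d"
    proof -
      have "M' z \<bullet> w \<le> norm (M' z) * norm w" by (rule norm_cauchy_schwarz)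
      also have "\<dots> \<le> B * \<rho> * d" unfolding d_def using B(2)[of z] z by (intro mult_right_mono) auto
      finally show ?thesis .
    qed
    have t3: "quad M' w \<le> B * d\<^sup>2" using B(3)[of w] by (simp add: d_def abs_le_iff)
    have t4: "B * \<rho> * d \<le> e' / 8 * \<rho>\<^sup>2 + 2 * B\<^sup>2 / e' * d\<^sup>2"
    proof -
      have "0 \<le> (e' * \<rho> - 4 * B * d)\<^sup>2 / (8 * e')" using e' by simp
      also have "\<dots> = e' / 8 * \<rho>\<^sup>2 + 2 * B\<^sup>2 / e' * d\<^sup>2 - B * \<rho> * d"
        using e' by (simp add: field_simps power2_eq_square)
      finally show ?thesis by simp
    qed
    have t5: "- (e' / 2 * (norm z')\<^sup>2) \<le> e' / 2 * d\<^sup>2 - e' / 4 * \<rho>\<^sup>2"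
    proof -
      have "\<rho> \<le> norm z' + d" using norm_triangle_ineq4[of z' w] z by (simp add: w_def d_def)
      then have "\<rho>\<^sup>2 \<le> (norm z' + d)\<^sup>2" using \<rho> by (intro power_mono) auto
      also have "\<dots> \<le> 2 * (norm z')\<^sup>2 + 2 * d\<^sup>2"
        using zero_le_power2[of "norm z' - d"] by (simp add: power2_eq_square algebra_simps)
      finally have "e' / 4 * \<rho>\<^sup>2 \<le> e' / 4 * (2 * (norm z')\<^sup>2 + 2 * d\<^sup>2)" using e' by (intro mult_left_mono) auto
      then show ?thesis by (simp add: algebra_simps)
    qed
    have "f z - quad M' z \<le> e' / 8 * \<rho>\<^sup>2 - e' / 4 * \<rho>\<^sup>2 + (2 * B\<^sup>2 / e' * d\<^sup>2 + B * d\<^sup>2 + e' / 2 * d\<^sup>2 - k * d\<^sup>2)"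
      using t0 t1 t2 t3 t4 t5 by linarith
    also have "(2 * B\<^sup>2 / e' * d\<^sup>2 + B * d\<^sup>2 + e' / 2 * d\<^sup>2 - k * d\<^sup>2) = (2 * B\<^sup>2 / e' + B + e' / 2 - k) * d\<^sup>2"
      by (simp only: distrib_right left_diff_distrib)
    finally have "f z - quad M' z \<le> e' / 8 * \<rho>\<^sup>2 - e' / 4 * \<rho>\<^sup>2 + (2 * B\<^sup>2 / e' + B + e' / 2 - k) * d\<^sup>2" .
    moreover have "(2 * B\<^sup>2 / e' + B + e' / 2 - k) * d\<^sup>2 \<le> 0"
      using B by (intro mult_nonpos_nonneg) (auto simp: k_def)
    moreover have "0 \<le> f 0"
    proof -
      have "0 \<le> U1 0" using s1.U_ge[of 0 0] D1 r by simp
      moreover have "0 \<le> U2 0" using s2.U_ge[of 0 0] D2 r by simp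
      ultimately show ?thesis by (simp add: f_def)
    qed
    moreover have "0 < e' * \<rho>\<^sup>2" using e' \<rho> by simp
    moreover have "(e' * \<rho> / 16) * \<rho> = e' * \<rho>\<^sup>2 / 16" by (simp add: power2_eq_square)
    moreover have "e' / 8 * \<rho>\<^sup>2 - e' / 4 * \<rho>\<^sup>2 = - (e' * \<rho>\<^sup>2 / 8)" by simp
    ultimately show ?thesis by linarith
  qed
  have s: "0 < e' * \<rho> / 16" using e' \<rho> by simp
  obtain z P \<sigma> f0 where z: "\<And>m::nat. norm (z m) < \<rho>" and P: "\<And>m. norm (P m) \<le> e' * \<rho> / 16 + B * \<rho>"
    and \<sigma>: "\<And>m. 0 < \<sigma> m" "\<sigma> \<longlonglongrightarrow> 0"
    and bd: "\<And>R. \<exists>B. \<forall>\<^sub>F m in sequentially. \<forall>h. norm h \<le> R \<longrightarrow> \<bar>rescale f (z m) (P m) (\<sigma> m) h\<bar> \<le> B"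
    and lim: "\<And>h. (\<lambda>m. rescale f (z m) (P m) (\<sigma> m) h) \<longlonglongrightarrow> f0 h"
    and pin: "\<And>x. \<exists>p. \<forall>h. f0 x + p \<bullet> h - k * (norm h)\<^sup>2 \<le> f0 (x + h) \<and> f0 (x + h) \<le> f0 x + p \<bullet> h + quad M' h"
    by (rule blow_up_at_contact_points[OF cf scf M' B(2) less_imp_le[OF B(1)] \<rho>(1) s])
      ((rule gap; assumption), (rule that; assumption))
  have cc: "(\<lambda>m. rescale f (z (r m)) (P (r m)) (\<sigma> (r m)) (y m)) \<longlonglongrightarrow> f0 y0"
    if "strict_mono (r :: nat \<Rightarrow> nat)" "y \<longlonglongrightarrow> y0" for r y y0
    by (rule semiconvex_continuous_convergence_subseq[OF semiconvex_rescale[OF scf \<sigma>(1)] bd lim that])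
  have P': "norm (P m) \<le> (e' / 16 + B) * \<rho>" for m using P[of m] by (simp add: distrib_right)
  define T1 where "T1 = (\<lambda>X. \<exists>x p. superjet D1 u1 x p X \<and> norm x < e \<and> norm p < e)"
  define T2 where "T2 = (\<lambda>X. \<exists>x p. superjet D2 u2 x p X \<and> norm x < e \<and> norm p < e)"
  have "f0 \<in> doubled_class k M' T1 T2"
    unfolding doubled_class_def
  proof (intro CollectI conjI allI)
    show "pinched k M' f0" unfolding pinched_def using pin by blast
    have sf: "separated f" by (simp add: separated_def f_def)
    show "separated f0"
      unfolding separated_def
    proof (intro allI)
      fix x x' y y'
      have "(\<lambda>m. rescale f (z m) (P m) (\<sigma> m) (x, y') + rescale f (z m) (P m) (\<sigma> m) (x', y)) \<longlonglongrightarrow> f0 (x, y') + f0 (x', y)"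
        by (intro tendsto_intros lim)
      moreover have "rescale f (z m) (P m) (\<sigma> m) (x, y') + rescale f (z m) (P m) (\<sigma> m) (x', y)
          = rescale f (z m) (P m) (\<sigma> m) (x, y) + rescale f (z m) (P m) (\<sigma> m) (x', y')" for m
        using separated_rescale[OF sf, of "z m" "P m" "\<sigma> m"] unfolding separated_def by metis
      ultimately have "(\<lambda>m. rescale f (z m) (P m) (\<sigma> m) (x, y) + rescale f (z m) (P m) (\<sigma> m) (x', y')) \<longlonglongrightarrow> f0 (x, y') + f0 (x', y)"
        by simp
      moreover have "(\<lambda>m. rescale f (z m) (P m) (\<sigma> m) (x, y) + rescale f (z m) (P m) (\<sigma> m) (x', y')) \<longlonglongrightarrow> f0 (x, y) + f0 (x', y')"
        by (intro tendsto_intros lim)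
      ultimately show "f0 (x, y) + f0 (x', y') = f0 (x, y') + f0 (x', y)" using LIMSEQ_unique by blast
    qed
  next
    fix y
    show "touched_only_by T1 (\<lambda>x. f0 (x, y))"
    proof (rule touched_only_by_blow_up[OF s1.continuous \<sigma>, where x = "\<lambda>m. fst (z m)" and P = "\<lambda>m. fst (P m)"
          and b = "\<lambda>m. f (z m) - U2 (snd (z m) + \<sigma> m *\<^sub>R y) + \<sigma> m * (snd (P m) \<bullet> y)"
          and ?\<rho>1.0 = \<rho> and ?\<rho>2.0 = "2 * \<rho>" and ?\<pi>1.0 = "(e' / 16 + B) * \<rho>" and ?\<pi>2.0 = e])
      show "norm (fst (z m)) \<le> \<rho>" for m using norm_fst_le[of "fst (z m)" "snd (z m)"] z[of m] by simp
      show "norm (fst (P m)) \<le> (e' / 16 + B) * \<rho>" for m using norm_fst_le[of "fst (P m)" "snd (P m)"] P'[of m] by simp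
      show "\<rho> < 2 * \<rho>" "(e' / 16 + B) * \<rho> < e" using \<rho> by auto
      show "(\<lambda>m. (U1 (fst (z (r m)) + \<sigma> (r m) *\<^sub>R w m) - (f (z (r m)) - U2 (snd (z (r m)) + \<sigma> (r m) *\<^sub>R y) + \<sigma> (r m) * (snd (P (r m)) \<bullet> y))
           - \<sigma> (r m) * (fst (P (r m)) \<bullet> w m)) / (\<sigma> (r m))\<^sup>2) \<longlonglongrightarrow> f0 (w0, y)"
        if "strict_mono (r :: nat \<Rightarrow> nat)" "w \<longlonglongrightarrow> w0" for r w w0
        using cc[OF that(1) tendsto_Pair[OF that(2) tendsto_const, of y]]
        by (simp add: rescale_def f_def inner_prod_def algebra_simps)
      show "T1 X" if w: "norm w < 2 * \<rho>" and p: "norm p < e" and X: "symmetric_matrix X" and d: "0 < d"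
        and up: "\<And>v. norm v < d \<Longrightarrow> U1 (w + v) \<le> U1 w + p \<bullet> v + quad ((*v) X) v" for w p X d
      proof -
        have "norm (\<zeta>1 w) < r" "norm (\<zeta>1 w) < e" using \<zeta>1[of w] w \<rho> by linarith+
        moreover have "superjet D1 u1 (\<zeta>1 w) p X"
          by (rule s1.superjet_of_touching[OF X d up]) (use \<open>norm (\<zeta>1 w) < r\<close> in auto)
        ultimately show ?thesis using p unfolding T1_def by blast
      qed
    qed
  next
    fix x
    show "touched_only_by T2 (\<lambda>y. f0 (x, y))"
    proof (rule touched_only_by_blow_up[OF s2.continuous \<sigma>, where x = "\<lambda>m. snd (z m)" and P = "\<lambda>m. snd (P m)"
          and b = "\<lambda>m. f (z m) - U1 (fst (z m) + \<sigma> m *\<^sub>R x) + \<sigma> m * (fst (P m) \<bullet> x)"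
          and ?\<rho>1.0 = \<rho> and ?\<rho>2.0 = "2 * \<rho>" and ?\<pi>1.0 = "(e' / 16 + B) * \<rho>" and ?\<pi>2.0 = e])
      show "norm (snd (z m)) \<le> \<rho>" for m using norm_snd_le[of "snd (z m)" "fst (z m)"] z[of m] by simp
      show "norm (snd (P m)) \<le> (e' / 16 + B) * \<rho>" for m using norm_snd_le[of "snd (P m)" "fst (P m)"] P'[of m] by simp
      show "\<rho> < 2 * \<rho>" "(e' / 16 + B) * \<rho> < e" using \<rho> by auto
      show "(\<lambda>m. (U2 (snd (z (r m)) + \<sigma> (r m) *\<^sub>R w m) - (f (z (r m)) - U1 (fst (z (r m)) + \<sigma> (r m) *\<^sub>R x) + \<sigma> (r m) * (fst (P (r m)) \<bullet> x))
           - \<sigma> (r m) * (snd (P (r m)) \<bullet> w m)) / (\<sigma> (r m))\<^sup>2) \<longlonglongrightarrow> f0 (x, w0)"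
        if "strict_mono (r :: nat \<Rightarrow> nat)" "w \<longlonglongrightarrow> w0" for r w w0
        using cc[OF that(1) tendsto_Pair[OF tendsto_const that(2), of x]]
        by (simp add: rescale_def f_def inner_prod_def algebra_simps)
      show "T2 X" if w: "norm w < 2 * \<rho>" and p: "norm p < e" and X: "symmetric_matrix X" and d: "0 < d"
        and up: "\<And>v. norm v < d \<Longrightarrow> U2 (w + v) \<le> U2 w + p \<bullet> v + quad ((*v) X) v" for w p X d
      proof -
        have "norm (\<zeta>2 w) < r" "norm (\<zeta>2 w) < e" using \<zeta>2[of w] w \<rho> by linarith+
        moreover have "superjet D2 u2 (\<zeta>2 w) p X"
          by (rule s2.superjet_of_touching[OF X d up]) (use \<open>norm (\<zeta>2 w) < r\<close> in auto)
        ultimately show ?thesis using p unfolding T2_def by blast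
      qed
    qed
  qed
  then have ne: "doubled_class k M' T1 T2 \<noteq> {}" by blast
  obtain X Y where XY: "T1 X" "T2 Y"
    and q: "\<And>h k. h \<bullet> (X *v h) + k \<bullet> (Y *v k) \<le> 2 * quad M' (h, k) + e / 2 * ((norm h)\<^sup>2 + (norm k)\<^sup>2)"
    by (rule doubled_class_block_quadratic[OF M' less_imp_le[OF k(1)] ne half_gt_zero[OF e]]) (rule that; assumption)
  obtain x p where xp: "superjet D1 u1 x p X" "norm x < e" "norm p < e" using XY(1) unfolding T1_def by blast
  obtain y q' where yq: "superjet D2 u2 y q' Y" "norm y < e" "norm q' < e" using XY(2) unfolding T2_def by blast
  have "h \<bullet> (X *v h) + k \<bullet> (Y *v k) \<le> 2 * quad M (h, k) + e * ((norm h)\<^sup>2 + (norm k)\<^sup>2)" for h k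
  proof -
    have "0 \<le> e * (norm h)\<^sup>2" "0 \<le> e * (norm k)\<^sup>2" using e by auto
    then show ?thesis using q[of h k] by (simp add: qM' nP e'_def algebra_simps)
  qed
  with xp yq show thesis using that by blast
qed

lemma superjet_translate:
  assumes "superjet ((\<lambda>x. x - a) ` D) (\<lambda>x. u (x + a) - c - b \<bullet> x) x p X"
  shows "superjet D u (x + a) (p + b) X"
proof -
  obtain r where x: "x + a \<in> D" and X: "symmetric_matrix X" and r: "0 < r"
    and le: "\<And>y. y \<in> (\<lambda>x. x - a) ` D \<Longrightarrow> y \<in> ball x r \<Longrightarrow>
       u (y + a) - c - b \<bullet> y \<le> u (x + a) - c - b \<bullet> x + p \<bullet> (y - x) + quad ((*v) X) (y - x)"
    using assms unfolding superjet_def by (auto simp: image_iff)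
  have "u y \<le> u (x + a) + (p + b) \<bullet> (y - (x + a)) + quad ((*v) X) (y - (x + a))" if y: "y \<in> D \<inter> ball (x + a) r" for y
  proof -
    have "y - a \<in> ball x r" using y by (simp add: dist_norm algebra_simps)
    then have "u y - c - b \<bullet> (y - a) \<le> u (x + a) - c - b \<bullet> x + p \<bullet> (y - a - x) + quad ((*v) X) (y - a - x)"
      using le[of "y - a"] y by simp
    moreover have "y - a - x = y - (x + a)" by simp
    ultimately show ?thesis by (simp add: inner_add_left inner_diff_right inner_add_right)
  qed
  then show ?thesis unfolding superjet_def using x X r by blast
qed

lemma usc_on_translate:
  fixes u :: "real^'n \<Rightarrow> real"
  assumes "usc_on D u"
  shows "usc_on ((\<lambda>x. x - a) ` D) (\<lambda>x. u (x + a) - c - b \<bullet> x)"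
  unfolding usc_on_def openin_euclidean_subtopology_iff
proof (intro allI conjI ballI)
  fix t x assume x: "x \<in> {x \<in> (\<lambda>x. x - a) ` D. u (x + a) - c - b \<bullet> x < t}"
  define e where "e = (t - (u (x + a) - c - b \<bullet> x)) / 2"
  have e: "0 < e" and xD: "x + a \<in> D" using x by (auto simp: e_def)
  obtain d1 where d1: "0 < d1" "\<And>y. y \<in> D \<Longrightarrow> dist y (x + a) < d1 \<Longrightarrow> u y < u (x + a) + e"
    by (rule usc_onD[OF assms xD e]) (rule that; assumption)
  have "isCont (\<lambda>y. b \<bullet> y) x" by (intro continuous_intros)
  then obtain d2 where d2: "0 < d2" "\<And>y. dist y x < d2 \<Longrightarrow> dist (b \<bullet> y) (b \<bullet> x) < e"
    using e unfolding continuous_at_eps_delta by metis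
  show "\<exists>d>0. \<forall>y\<in>(\<lambda>x. x - a) ` D. dist y x < d \<longrightarrow> y \<in> {x \<in> (\<lambda>x. x - a) ` D. u (x + a) - c - b \<bullet> x < t}"
  proof (intro exI[of _ "min d1 d2"] conjI ballI impI CollectI)
    fix y assume y: "y \<in> (\<lambda>x. x - a) ` D" "dist y x < min d1 d2"
    then have "u (y + a) < u (x + a) + e" using d1(2)[of "y + a"] by (auto simp: dist_norm)
    moreover have "\<bar>b \<bullet> y - b \<bullet> x\<bar> < e" using d2(2)[of y] y by (simp add: dist_real_def)
    moreover have "t = (u (x + a) - c - b \<bullet> x) + e + e" by (simp add: e_def)
    ultimately show "u (y + a) - c - b \<bullet> y < t" by linarith
  qed (use d1 d2 in auto)
qed auto

text \<open>
  The lemma of Crandall and Ishii at a local maximum, with the second-order Taylor polynomial of the test function already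
  inserted. The block matrix of the two Hessians is bounded from above by the Hessian \<open>M\<close>.
\<close>
theorem theorem_on_sums:
  fixes u1 u2 :: "real^'n \<Rightarrow> real" and M :: "(real^'n) \<times> (real^'n) \<Rightarrow> (real^'n) \<times> (real^'n)"
  assumes D: "closed D" "a \<in> D" "b \<in> D" "usc_on D u1" "usc_on D u2"
    and r: "0 < r" and M: "selfadjoint M" and e: "0 < e"
    and le: "\<And>x y. x \<in> D \<Longrightarrow> y \<in> D \<Longrightarrow> norm (x - a) \<le> r \<Longrightarrow> norm (y - b) \<le> r \<Longrightarrow>
       u1 x + u2 y \<le> u1 a + u2 b + p0 \<bullet> (x - a) + q0 \<bullet> (y - b) + quad M (x - a, y - b)"
  obtains x p X y q Y where "superjet D u1 x p X" "superjet D u2 y q Y"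
    "norm (x - a) < e" "norm (y - b) < e" "norm (p - p0) < e" "norm (q - q0) < e"
    "\<And>h k. h \<bullet> (X *v h) + k \<bullet> (Y *v k) \<le> 2 * quad M (h, k) + e * ((norm h)\<^sup>2 + (norm k)\<^sup>2)"
proof -
  let ?D1 = "(\<lambda>x. x - a) ` D" and ?D2 = "(\<lambda>x. x - b) ` D"
  let ?u1 = "\<lambda>x. u1 (x + a) - u1 a - p0 \<bullet> x" and ?u2 = "\<lambda>x. u2 (x + b) - u2 b - q0 \<bullet> x"
  have cl: "closed ?D1" "closed ?D2" using D(1) by (simp_all add: closed_translation_subtract)
  have in0: "0 \<in> ?D1" "0 \<in> ?D2" using D by (auto simp: image_iff)
  have le': "?u1 x + ?u2 y \<le> quad M (x, y)" if "x \<in> ?D1" "y \<in> ?D2" "norm x \<le> r" "norm y \<le> r" for x y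
    using le[of "x + a" "y + b"] that by auto
  have usc1: "usc_on ?D1 ?u1" by (rule usc_on_translate[OF D(4)])
  have usc2: "usc_on ?D2 ?u2" by (rule usc_on_translate[OF D(5)])
  have zero: "?u1 0 = 0" "?u2 0 = 0" by simp_all
  obtain x p X y q Y where *: "superjet ?D1 ?u1 x p X" "superjet ?D2 ?u2 y q Y" "norm x < e" "norm y < e" "norm p < e" "norm q < e"
    "\<And>h k. h \<bullet> (X *v h) + k \<bullet> (Y *v k) \<le> 2 * quad M (h, k) + e * ((norm h)\<^sup>2 + (norm k)\<^sup>2)"
    by (rule theorem_on_sums_at_origin[OF cl(1) in0(1) usc1 zero(1) cl(2) in0(2) usc2 zero(2) r M e])
      ((rule le'; assumption), (rule that; assumption))
  show thesis
    by (rule that[OF superjet_translate[OF *(1)] superjet_translate[OF *(2)]]) (use * in auto)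
qed

section \<open>Pucci extremal operators and elliptic pairs\<close>

definition outer :: "real^'n \<Rightarrow> real^'n^'n" where
  "outer b = (\<chi> k l. b $ k * b $ l)"

lemma outer_mult_vec: "outer b *v x = (b \<bullet> x) *\<^sub>R b"
  by (simp add: outer_def vec_eq_iff matrix_vector_mult_def inner_vec_def sum_distrib_right sum_distrib_left ac_simps)

lemma inner_axis_matrix: "axis i 1 \<bullet> (A *v axis j 1) = A $ i $ j" for A :: "real^'n^'n"
  by (simp add: inner_axis' matrix_vector_mult_basis column_def)

text \<open>
  Symmetric elimination: subtracting the rank-one matrix built from a row with positive diagonal entry annihilates that row,
  and the Cauchy--Schwarz inequality for the form \<open>B\<close> keeps the rest positive semidefinite.
\<close>
lemma psd_imp_sum_of_outer:
  fixes B :: "real^'n^'n"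
  assumes "symmetric_matrix B" "\<And>x. 0 \<le> x \<bullet> (B *v x)"
  shows "\<exists>bs. B = sum_list (map outer bs)"
  using assms
proof (induction "card {i. B $ i \<noteq> 0}" arbitrary: B rule: less_induct)
  case less
  have sym: "B $ i $ j = B $ j $ i" for i j
    using less.prems(1) unfolding symmetric_matrix_def transpose_def by (metis vec_lambda_beta)
  show ?case
  proof (cases "B = 0")
    case True
    then show ?thesis by (intro exI[of _ "[]"]) simp
  next
    case False
    then obtain i j where ij: "B $ i $ j \<noteq> 0" by (auto simp: vec_eq_iff)
    have quadB: "x \<bullet> (B *v y) = y \<bullet> (B *v x)" for x y
      using symmetric_matrix_inner[OF less.prems(1), of x y] by (simp add: inner_commute)
    have expand: "0 \<le> x \<bullet> (B *v x) + 2 * t * (x \<bullet> (B *v y)) + t\<^sup>2 * (y \<bullet> (B *v y))" for x y t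
      using less.prems(2)[of "x + t *\<^sub>R y"] quadB[of x y]
      by (simp add: matrix_vector_right_distrib matrix_vector_mult_scaleR inner_add_left inner_add_right power2_eq_square algebra_simps)
    define a where "a = B $ i $ i"
    have a: "0 < a"
    proof (rule ccontr)
      assume "\<not> 0 < a"
      moreover have "0 \<le> a" using less.prems(2)[of "axis i 1"] by (simp add: inner_axis_matrix a_def)
      ultimately have "a = 0" by simp
      define t where "t = - (B $ j $ j + 1) / (2 * B $ i $ j)"
      have "2 * t * (B $ j $ i) = - (B $ j $ j + 1)" using ij by (simp add: t_def sym[of j i])
      moreover have "0 \<le> B $ j $ j + 2 * t * (B $ j $ i) + t\<^sup>2 * a"
        using expand[of "axis j 1" t "axis i 1"] by (simp add: inner_axis_matrix a_def)
      ultimately show False using \<open>a = 0\<close> by simp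
    qed
    define b where "b = (1 / sqrt a) *\<^sub>R (B $ i)"
    define B' where "B' = B - outer b"
    have bx: "b \<bullet> x = (axis i 1 \<bullet> (B *v x)) / sqrt a" for x
      by (simp add: b_def inner_axis' matrix_vector_mul_component)
    have sym': "symmetric_matrix B'"
      using less.prems(1) by (simp add: symmetric_matrix_def transpose_def vec_eq_iff B'_def outer_def sym mult.commute)
    have psd': "0 \<le> x \<bullet> (B' *v x)" for x
    proof -
      define s where "s = x \<bullet> (B *v axis i 1)"
      have "0 \<le> x \<bullet> (B *v x) + 2 * (- s / a) * s + (- s / a)\<^sup>2 * a"
        using expand[of x "- s / a" "axis i 1"] by (simp add: inner_axis_matrix s_def a_def)
      also have "\<dots> = x \<bullet> (B *v x) - s\<^sup>2 / a" using a by (simp add: power2_eq_square field_simps)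
      also have "s\<^sup>2 / a = (b \<bullet> x)\<^sup>2"
        using a by (simp add: bx s_def quadB[of x] power_divide)
      also have "x \<bullet> (B *v x) - (b \<bullet> x)\<^sup>2 = x \<bullet> (B' *v x)"
        by (simp add: B'_def matrix_vector_mult_diff_rdistrib inner_diff_right outer_mult_vec power2_eq_square inner_commute)
      finally show ?thesis .
    qed
    have sub: "{k. B' $ k \<noteq> 0} \<subset> {k. B $ k \<noteq> 0}"
    proof
      show "{k. B' $ k \<noteq> 0} \<subseteq> {k. B $ k \<noteq> 0}"
      proof (rule subsetI, rule CollectI, rule notI)
        fix k assume k: "k \<in> {k. B' $ k \<noteq> 0}" and "B $ k = 0"
        then have "b $ k = 0" using sym[of i k] by (simp add: b_def)
        then have "B' $ k = 0" using \<open>B $ k = 0\<close> by (simp add: B'_def outer_def vec_eq_iff)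
        then show False using k by simp
      qed
      have "B' $ i $ l = 0" for l
        using a by (simp add: B'_def outer_def b_def a_def)
      then have "B' $ i = 0" by (simp add: vec_eq_iff)
      moreover have "B $ i \<noteq> 0" using ij by auto
      ultimately show "{k. B' $ k \<noteq> 0} \<noteq> {k. B $ k \<noteq> 0}" by blast
    qed
    have "card {k. B' $ k \<noteq> 0} < card {k. B $ k \<noteq> 0}" by (rule psubset_card_mono[OF _ sub]) simp
    then obtain bs where "B' = sum_list (map outer bs)" using less.hyps[OF _ sym' psd'] by blast
    then have "B = sum_list (map outer (b # bs))" by (simp add: B'_def algebra_simps)
    then show ?thesis by blast
  qed
qed

lemma trace_mult_outer: "trace (A ** outer b) = b \<bullet> (A *v b)" for A :: "real^'n^'n"
  by (simp add: trace_def matrix_matrix_mult_def outer_def inner_vec_def matrix_vector_mult_def sum_distrib_left algebra_simps)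

lemma trace_mult_psd:
  fixes A B :: "real^'n^'n"
  assumes A: "\<And>x. lam * (x \<bullet> x) \<le> x \<bullet> (A *v x)" and lam: "0 \<le> lam"
    and B: "symmetric_matrix B" "\<And>x. 0 \<le> x \<bullet> (B *v x)" and e: "norm e = 1"
  shows "lam * (e \<bullet> (B *v e)) \<le> trace (A ** B)"
proof -
  obtain bs where bs: "B = sum_list (map outer bs)" using psd_imp_sum_of_outer[OF B] by blast
  have "lam * (e \<bullet> (sum_list (map outer bs) *v e)) \<le> trace (A ** sum_list (map outer bs))"
  proof (induction bs)
    case Nil
    then show ?case by (simp add: trace_0[simplified mat_0])
  next
    case (Cons b bs)
    have "lam * (b \<bullet> e)\<^sup>2 \<le> lam * (b \<bullet> b)"
      using Cauchy_Schwarz_ineq[of b e] e lam by (intro mult_left_mono) (auto simp: norm_eq_1)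
    also have "\<dots> \<le> b \<bullet> (A *v b)" by (rule A)
    finally have "lam * (b \<bullet> e)\<^sup>2 \<le> trace (A ** outer b)" by (simp add: trace_mult_outer)
    moreover have "e \<bullet> (outer b *v e) = (b \<bullet> e)\<^sup>2" by (simp add: outer_mult_vec power2_eq_square inner_commute)
    ultimately show ?case using Cons
      by (simp add: matrix_add_ldistrib trace_add matrix_vector_mult_add_rdistrib inner_add_right distrib_left)
  qed
  then show ?thesis by (simp add: bs)
qed

lemma mat_mult_vec: "mat c *v x = c *\<^sub>R x" for x :: "real^'n"
  by (simp add: vec_eq_iff matrix_vector_mult_def mat_def if_distrib if_distribR sum.delta' cong: if_cong)

lemma elliptic_matricesD:
  fixes A :: "real^'n^'n"
  assumes "A \<in> elliptic_matrices lam Lam"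
  shows "lam * (x \<bullet> x) \<le> x \<bullet> (A *v x)" "x \<bullet> (A *v x) \<le> Lam * (x \<bullet> x)"
  using assms by (simp_all add: elliptic_matrices_def loewner_le_def mat_mult_vec)

lemma elliptic_matrices_nonempty:
  assumes "lam \<le> Lam" shows "(elliptic_matrices lam Lam :: (real^'n^'n) set) \<noteq> {}"
proof -
  have "mat lam \<in> (elliptic_matrices lam Lam :: (real^'n^'n) set)"
    using assms by (simp add: elliptic_matrices_def loewner_le_def mat_mult_vec symmetric_matrix_def mult_right_mono)
  then show ?thesis by blast
qed

text \<open>
  Write \<open>N = c Id - B\<close> with \<open>B\<close> positive semidefinite. The direction \<open>e\<close> alone contributes at least \<open>lam m\<close> to the trace
  of \<open>A B\<close>.
\<close>
lemma pucci_plus_le: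
  fixes N :: "real^'n^'n"
  assumes lam: "0 < lam" "lam \<le> Lam" and N: "symmetric_matrix N" and c: "0 \<le> c"
    and le: "\<And>x. x \<bullet> (N *v x) \<le> c * (norm x)\<^sup>2" and e: "norm e = 1" "e \<bullet> (N *v e) \<le> c - m"
  shows "pucci_plus lam Lam N \<le> c * (real CARD('n) * Lam) - lam * m"
  unfolding pucci_plus_def
proof (rule cSUP_least[OF elliptic_matrices_nonempty[OF lam(2)]])
  fix A :: "real^'n^'n" assume A: "A \<in> elliptic_matrices lam Lam"
  note A' = elliptic_matricesD[OF A]
  define B where "B = mat c - N"
  have Bx: "x \<bullet> (B *v x) = c * (norm x)\<^sup>2 - x \<bullet> (N *v x)" for x
    by (simp add: B_def matrix_vector_mult_diff_rdistrib mat_mult_vec inner_diff_right power2_norm_eq_inner)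
  have "symmetric_matrix B"
    using N unfolding symmetric_matrix_def B_def by (simp add: transpose_def vec_eq_iff mat_def)
  moreover have "0 \<le> x \<bullet> (B *v x)" for x using le[of x] by (simp add: Bx)
  ultimately have "lam * (e \<bullet> (B *v e)) \<le> trace (A ** B)"
    using trace_mult_psd[OF A'(1)] lam e by simp
  moreover have "lam * m \<le> lam * (e \<bullet> (B *v e))"
    using e lam by (intro mult_left_mono) (auto simp: Bx)
  moreover have "trace (A ** mat c) = c * trace A"
    by (simp add: trace_def matrix_matrix_mult_def mat_def if_distrib sum.delta sum_distrib_left mult.commute cong: if_cong)
  moreover have "trace (A ** N) = trace (A ** mat c) - trace (A ** B)"
  proof -
    have "trace (A ** mat c) = trace (A ** (B + N))" by (simp add: B_def)
    then show ?thesis by (simp add: matrix_add_ldistrib trace_add)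
  qed
  moreover have "trace A \<le> real CARD('n) * Lam"
  proof -
    have "A $ i $ i \<le> Lam" for i
      using A'(2)[of "axis i 1"] by (simp add: inner_axis_matrix inner_axis_axis)
    then have "trace A \<le> (\<Sum>i\<in>(UNIV::'n set). Lam)" unfolding trace_def by (intro sum_mono) auto
    then show ?thesis by simp
  qed
  then have "c * trace A \<le> c * (real CARD('n) * Lam)" using c by (rule mult_left_mono)
  ultimately show "trace (A ** N) \<le> c * (real CARD('n) * Lam) - lam * m" by linarith
qed

lemma pucci_minus_psd:
  fixes N :: "real^'n^'n"
  assumes lam: "0 < lam" "lam \<le> Lam" and N: "symmetric_matrix N" "\<And>x. 0 \<le> x \<bullet> (N *v x)"
  shows "0 \<le> pucci_minus lam Lam N"
  unfolding pucci_minus_def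
proof (rule cINF_greatest[OF elliptic_matrices_nonempty[OF lam(2)]])
  fix A :: "real^'n^'n" assume A: "A \<in> elliptic_matrices lam Lam"
  define e :: "real^'n" where "e = axis undefined 1"
  have "norm e = 1" by (simp add: e_def)
  then have "lam * (e \<bullet> (N *v e)) \<le> trace (A ** N)"
    using trace_mult_psd[OF elliptic_matricesD(1)[OF A] _ N] lam by simp
  moreover have "0 \<le> lam * (e \<bullet> (N *v e))" using lam N by simp
  ultimately show "0 \<le> trace (A ** N)" by linarith
qed

text \<open>
  \<open>\<Gamma>1\<close> is to contain the Hessians of superjets of subsolutions, \<open>\<Gamma>2\<close> those of negatives of supersolutions. As the axioms are
  symmetric, every result applies to a solution and to its negative.
\<close>
locale elliptic_pair =
  fixes \<Gamma>1 \<Gamma>2 :: "(real^'n^'n) set" and lam Lam :: real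
  assumes lam: "0 < lam" "lam \<le> Lam"
    and pair: "\<And>X Y. symmetric_matrix X \<Longrightarrow> symmetric_matrix Y \<Longrightarrow> X \<in> \<Gamma>1 \<Longrightarrow> Y \<in> \<Gamma>2 \<Longrightarrow> 0 \<le> pucci_plus lam Lam (X + Y)"
    and psd1: "\<And>X. symmetric_matrix X \<Longrightarrow> (\<And>x. 0 \<le> x \<bullet> (X *v x)) \<Longrightarrow> X \<in> \<Gamma>1"
    and psd2: "\<And>X. symmetric_matrix X \<Longrightarrow> (\<And>x. 0 \<le> x \<bullet> (X *v x)) \<Longrightarrow> X \<in> \<Gamma>2"
    and cone1: "\<And>X s. symmetric_matrix X \<Longrightarrow> X \<in> \<Gamma>1 \<Longrightarrow> 0 < s \<Longrightarrow> s *\<^sub>R X \<in> \<Gamma>1"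
    and cone2: "\<And>X s. symmetric_matrix X \<Longrightarrow> X \<in> \<Gamma>2 \<Longrightarrow> 0 < s \<Longrightarrow> s *\<^sub>R X \<in> \<Gamma>2"

lemma symmetric_matrix_add: "symmetric_matrix X \<Longrightarrow> symmetric_matrix Y \<Longrightarrow> symmetric_matrix (X + Y)"
  unfolding symmetric_matrix_def by (simp add: transpose_def vec_eq_iff)

lemma symmetric_matrix_minus: "symmetric_matrix X \<Longrightarrow> symmetric_matrix (- X)" for X :: "real^'n^'n"
  unfolding symmetric_matrix_def by (simp add: transpose_def vec_eq_iff)

lemma symmetric_matrix_scaleR: "symmetric_matrix X \<Longrightarrow> symmetric_matrix (s *\<^sub>R X)" for X :: "real^'n^'n"
  unfolding symmetric_matrix_def by (simp add: transpose_def vec_eq_iff)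

lemma symmetric_matrix_0: "symmetric_matrix (0 :: real^'n^'n)"
  by (simp add: symmetric_matrix_def transpose_def vec_eq_iff)

context elliptic_pair begin

lemma swap: "elliptic_pair \<Gamma>2 \<Gamma>1 lam Lam"
proof
  show "0 \<le> pucci_plus lam Lam (X + Y)"
    if "symmetric_matrix X" "symmetric_matrix Y" "X \<in> \<Gamma>2" "Y \<in> \<Gamma>1" for X Y
    using pair[of Y X] that by (simp add: add.commute)
qed (use lam psd1 psd2 cone1 cone2 in auto)

text \<open>
  The form in which ellipticity is used: admissible Hessians \<open>X\<close> and \<open>Y\<close> whose sum is almost nonpositive cannot have
  a sum that is very negative in one direction.
\<close>
lemma no_common_strict:
  assumes X: "symmetric_matrix X" "X \<in> \<Gamma>1" and Y: "symmetric_matrix Y" "Y \<in> \<Gamma>2"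
    and c: "0 \<le> c" and le: "\<And>x. x \<bullet> (X *v x) + x \<bullet> (Y *v x) \<le> c * (norm x)\<^sup>2"
    and e: "norm e = 1" "e \<bullet> (X *v e) + e \<bullet> (Y *v e) \<le> c - m"
  shows "lam * m \<le> c * (real CARD('n) * Lam)"
proof -
  have "0 \<le> pucci_plus lam Lam (X + Y)" by (rule pair) fact+
  also have "\<dots> \<le> c * (real CARD('n) * Lam) - lam * m"
    by (rule pucci_plus_le[OF lam symmetric_matrix_add[OF X(1) Y(1)] c _ e(1)])
       (use le e in \<open>auto simp: matrix_vector_mult_add_rdistrib inner_add_right\<close>)
  finally show ?thesis by simp
qed

end

lemma elliptic_pair_of_operator:
  fixes F :: "real^'n^'n \<Rightarrow> real"
  assumes "uniformly_elliptic F" "positively_homogeneous F"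
  obtains lam Lam where "elliptic_pair {X. 0 \<le> F X} {Y. F (- Y) \<le> 0} lam Lam"
proof -
  obtain lam Lam where lam: "0 < lam" "lam \<le> Lam"
    and F: "\<And>M N. symmetric_matrix M \<Longrightarrow> symmetric_matrix N \<Longrightarrow>
       pucci_minus lam Lam (M - N) \<le> F M - F N \<and> F M - F N \<le> pucci_plus lam Lam (M - N)"
    using assms(1) unfolding uniformly_elliptic_def by blast
  have hom: "F (a *\<^sub>R M) = a * F M" if "symmetric_matrix M" "0 \<le> a" for a M
    using assms(2) that unfolding positively_homogeneous_def by blast
  have F0: "F 0 = 0" using hom[OF symmetric_matrix_0, of 0] by simp
  have "elliptic_pair {X. 0 \<le> F X} {Y. F (- Y) \<le> 0} lam Lam"
  proof
    fix X Y :: "real^'n^'n"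
    assume "symmetric_matrix X" "symmetric_matrix Y" "X \<in> {X. 0 \<le> F X}" "Y \<in> {Y. F (- Y) \<le> 0}"
    then show "0 \<le> pucci_plus lam Lam (X + Y)"
      using F[of X "- Y"] symmetric_matrix_minus[of Y] by auto
  next
    fix X :: "real^'n^'n"
    assume X: "symmetric_matrix X" "\<And>x. 0 \<le> x \<bullet> (X *v x)"
    show "X \<in> {X. 0 \<le> F X}"
      using F[OF X(1) symmetric_matrix_0] pucci_minus_psd[OF lam X] F0 by simp
    show "X \<in> {Y. F (- Y) \<le> 0}"
      using F[OF symmetric_matrix_0 symmetric_matrix_minus[OF X(1)]] pucci_minus_psd[OF lam X] F0 by simp
  next
    fix X :: "real^'n^'n" and s :: real
    assume X: "symmetric_matrix X" and s: "0 < s"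
    show "s *\<^sub>R X \<in> {X. 0 \<le> F X}" if "X \<in> {X. 0 \<le> F X}" using hom[OF X, of s] s that by simp
    show "s *\<^sub>R X \<in> {Y. F (- Y) \<le> 0}" if "X \<in> {Y. F (- Y) \<le> 0}"
      using hom[OF symmetric_matrix_minus[OF X], of s] s that by (simp add: mult_le_0_iff)
  qed (rule lam)+
  then show thesis by (rule that)
qed

section \<open>Subsolutions tested by quadratics\<close>

definition slab :: "real^'n \<Rightarrow> (real^'n) set" where
  "slab \<nu> = {x. 0 \<le> x \<bullet> \<nu> \<and> x \<bullet> \<nu> \<le> 1}"

lemma closed_slab: "closed (slab \<nu>)"
  unfolding slab_def by (intro closed_Collect_conj closed_Collect_le continuous_intros)

lemma closure_strip:
  assumes "norm \<nu> = 1" shows "closure (strip \<nu> 1) = slab \<nu>"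
proof
  show "closure (strip \<nu> 1) \<subseteq> slab \<nu>"
    by (rule closure_minimal[OF _ closed_slab]) (auto simp: strip_def slab_def)
  show "slab \<nu> \<subseteq> closure (strip \<nu> 1)"
  proof
    fix x assume x: "x \<in> slab \<nu>"
    show "x \<in> closure (strip \<nu> 1)"
      unfolding closure_approachable
    proof (intro allI impI)
      fix e :: real assume e: "0 < e"
      define t where "t = min (e / 2) (1 / 4)"
      have t: "0 < t" "t < e" "t < 1 / 2" using e by (auto simp: t_def min_def)
      define s where "s = (if x \<bullet> \<nu> \<le> 1 / 2 then t else - t)"
      have "\<nu> \<bullet> \<nu> = 1" using assms by (simp add: norm_eq_1)
      then have "x + s *\<^sub>R \<nu> \<in> strip \<nu> 1"
        using x t by (auto simp: strip_def slab_def s_def inner_add_left)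
      moreover have "dist (x + s *\<^sub>R \<nu>) x < e" using assms t by (simp add: dist_norm s_def)
      ultimately show "\<exists>y\<in>strip \<nu> 1. dist y x < e" by blast
    qed
  qed
qed

text \<open>
  The viscosity subsolution property in the strip of height \<open>1\<close>, with quadratics as the only test functions: this is the
  form in which \<open>theorem_on_sums\<close> produces its jets.
\<close>
definition jet_subsolution :: "(real^'n^'n) set \<Rightarrow> real^'n \<Rightarrow> (real^'n \<Rightarrow> real) \<Rightarrow> (real^'n \<Rightarrow> real) \<Rightarrow> bool" where
  "jet_subsolution \<Gamma> \<nu> h u \<longleftrightarrow> usc_on (slab \<nu>) u \<and> (\<forall>x. x \<bullet> \<nu> = 1 \<longrightarrow> u x \<le> 0) \<and>
     (\<forall>x p X. superjet (slab \<nu>) u x p X \<longrightarrow> x \<bullet> \<nu> < 1 \<longrightarrow> X \<in> \<Gamma> \<or> x \<bullet> \<nu> = 0 \<and> h x \<le> p \<bullet> \<nu>)"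

lemma C2_on_quadratic:
  fixes X :: "real^'n^'n"
  assumes "symmetric_matrix X"
  shows "C2_on U (\<lambda>y. c + p \<bullet> (y - x) + quad ((*v) X) (y - x)) (\<lambda>y. p + X *v (y - x)) (\<lambda>_. X)"
  unfolding C2_on_def
proof (intro conjI ballI)
  note sym = symmetric_matrix_inner[OF assms]
  fix z
  show "((\<lambda>y. c + p \<bullet> (y - x) + quad ((*v) X) (y - x)) has_derivative (\<lambda>h. (p + X *v (z - x)) \<bullet> h)) (at z)"
  proof -
    have bl: "bounded_linear ((*v) X)" by simp
    have d0: "((\<lambda>y. y - x) has_derivative (\<lambda>h. h)) (at z)" by (auto intro!: derivative_eq_intros)
    have d1: "((\<lambda>y. X *v (y - x)) has_derivative (\<lambda>h. X *v h)) (at z)"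
      by (rule bounded_linear.has_derivative[OF bl d0])
    have "((\<lambda>y. c + p \<bullet> (y - x) + ((y - x) \<bullet> (X *v (y - x))) / 2) has_derivative
        (\<lambda>h. 0 + p \<bullet> h + ((z - x) \<bullet> (X *v h) + h \<bullet> (X *v (z - x))) / 2)) (at z)"
      unfolding divide_inverse
      by (intro has_derivative_add has_derivative_const has_derivative_inner_right has_derivative_mult_left has_derivative_inner d0 d1)
    moreover have "0 + p \<bullet> h + ((z - x) \<bullet> (X *v h) + h \<bullet> (X *v (z - x))) / 2 = (p + X *v (z - x)) \<bullet> h" for h
      using sym[of "z - x" h] by (simp add: inner_add_left inner_commute[of h])
    ultimately show ?thesis unfolding quad_def by simp
  qed
  show "((\<lambda>y. p + X *v (y - x)) has_derivative (*v) X) (at z)"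
  proof -
    have "((\<lambda>y. p + X *v (y - x)) has_derivative (\<lambda>h. 0 + X *v (h - 0))) (at z)"
      by (intro derivative_intros bounded_linear.has_derivative[of "(*v) X"]) auto
    then show ?thesis by simp
  qed
qed simp

lemma visc_subsolution_imp_jet:
  fixes F :: "real^'n^'n \<Rightarrow> real"
  assumes \<nu>: "norm \<nu> = 1" and u: "visc_subsolution F \<nu> 1 h u"
  shows "jet_subsolution {X. 0 \<le> F X} \<nu> h u"
  unfolding jet_subsolution_def
proof (intro conjI allI impI)
  show "usc_on (slab \<nu>) u" using u by (simp add: visc_subsolution_def closure_strip[OF \<nu>])
  show "u x \<le> 0" if "x \<bullet> \<nu> = 1" for x using u that by (simp add: visc_subsolution_def hyperplane_def)
  fix x p X assume sj: "superjet (slab \<nu>) u x p X" and t: "x \<bullet> \<nu> < 1"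
  obtain r where xs: "x \<in> slab \<nu>" and X: "symmetric_matrix X" and r: "0 < r"
    and le: "\<And>y. y \<in> slab \<nu> \<inter> ball x r \<Longrightarrow> u y \<le> u x + p \<bullet> (y - x) + quad ((*v) X) (y - x)"
    using sj unfolding superjet_def by blast
  let ?\<phi> = "\<lambda>y. u x + p \<bullet> (y - x) + quad ((*v) X) (y - x)"
  have "\<forall>y\<in>ball x r \<inter> closure (strip \<nu> 1). u y - ?\<phi> y \<le> u x - ?\<phi> x"
    using le unfolding closure_strip[OF \<nu>] by (auto simp: quad_def Int_commute)
  then have "(x \<in> strip \<nu> 1 \<longrightarrow> 0 \<le> F X) \<and> (x \<in> hyperplane \<nu> 0 \<longrightarrow> 0 \<le> F X \<or> h x \<le> (p + X *v (x - x)) \<bullet> \<nu>)"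
    using u C2_on_quadratic[OF X] r unfolding visc_subsolution_def by (meson centre_in_ball open_ball)
  then show "X \<in> {X. 0 \<le> F X} \<or> x \<bullet> \<nu> = 0 \<and> h x \<le> p \<bullet> \<nu>"
    using xs t by (auto simp: slab_def strip_def hyperplane_def)
qed

lemma visc_supersolution_imp_jet:
  fixes F :: "real^'n^'n \<Rightarrow> real"
  assumes \<nu>: "norm \<nu> = 1" and u: "visc_supersolution F \<nu> 1 h u"
  shows "jet_subsolution {Y. F (- Y) \<le> 0} \<nu> (\<lambda>x. - h x) (\<lambda>x. - u x)"
  unfolding jet_subsolution_def
proof (intro conjI allI impI)
  show "usc_on (slab \<nu>) (\<lambda>x. - u x)"
    unfolding usc_on_def
  proof
    fix a
    have "openin (top_of_set (slab \<nu>)) {x \<in> slab \<nu>. - a < u x}"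
      using u by (simp add: visc_supersolution_def closure_strip[OF \<nu>] lsc_on_def)
    then show "openin (top_of_set (slab \<nu>)) {x \<in> slab \<nu>. - u x < a}" by (simp add: minus_less_iff)
  qed
  show "- u x \<le> 0" if "x \<bullet> \<nu> = 1" for x using u that by (simp add: visc_supersolution_def hyperplane_def)
  fix x p X assume sj: "superjet (slab \<nu>) (\<lambda>x. - u x) x p X" and t: "x \<bullet> \<nu> < 1"
  obtain r where xs: "x \<in> slab \<nu>" and X: "symmetric_matrix X" and r: "0 < r"
    and le: "\<And>y. y \<in> slab \<nu> \<inter> ball x r \<Longrightarrow> - u y \<le> - u x + p \<bullet> (y - x) + quad ((*v) X) (y - x)"
    using sj unfolding superjet_def by blast
  note X' = symmetric_matrix_minus[OF X]
  let ?\<phi> = "\<lambda>y. u x + (- p) \<bullet> (y - x) + quad ((*v) (- X)) (y - x)"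
  have mX: "(- X) *v z = - (X *v z)" for z by (simp add: vec_eq_iff matrix_vector_mult_def sum_negf)
  have "\<forall>y\<in>ball x r \<inter> closure (strip \<nu> 1). u y - ?\<phi> y \<ge> u x - ?\<phi> x"
    using le unfolding closure_strip[OF \<nu>] by (fastforce simp: quad_def mX)
  then have "(x \<in> strip \<nu> 1 \<longrightarrow> F (- X) \<le> 0) \<and> (x \<in> hyperplane \<nu> 0 \<longrightarrow> F (- X) \<le> 0 \<or> (- p + (- X) *v (x - x)) \<bullet> \<nu> \<le> h x)"
    using u C2_on_quadratic[OF X'] r unfolding visc_supersolution_def by (meson centre_in_ball open_ball)
  then show "X \<in> {Y. F (- Y) \<le> 0} \<or> x \<bullet> \<nu> = 0 \<and> - h x \<le> p \<bullet> \<nu>"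
    using xs t by (auto simp: slab_def strip_def hyperplane_def)
qed

section \<open>Comparison\<close>

lemma usc_sum_attains_max:
  fixes u1 u2 :: "real^'n \<Rightarrow> real" and g :: "(real^'n) \<times> (real^'n) \<Rightarrow> real"
  assumes K: "compact K" "K \<noteq> {}" "K \<subseteq> D \<times> D" and u: "usc_on D u1" "usc_on D u2" and g: "continuous_on K g"
  obtains a b where "(a, b) \<in> K" "\<And>x y. (x, y) \<in> K \<Longrightarrow> u1 x + u2 y - g (x, y) \<le> u1 a + u2 b - g (a, b)"
proof -
  let ?f = "\<lambda>q. u1 (fst q) + u2 (snd q) - g q"
  have usc: "\<exists>d>0. \<forall>y\<in>K. dist y x < d \<longrightarrow> ?f y < ?f x + e" if x: "x \<in> K" and e: "0 < e" for x e
  proof -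
    have xD: "fst x \<in> D" "snd x \<in> D" and e3: "0 < e / 3" using x K(3) e by auto
    obtain d1 where d1: "0 < d1" "\<And>y. y \<in> D \<Longrightarrow> dist y (fst x) < d1 \<Longrightarrow> u1 y < u1 (fst x) + e / 3"
      by (rule usc_onD[OF u(1) xD(1) e3]) (rule that; assumption)
    obtain d2 where d2: "0 < d2" "\<And>y. y \<in> D \<Longrightarrow> dist y (snd x) < d2 \<Longrightarrow> u2 y < u2 (snd x) + e / 3"
      by (rule usc_onD[OF u(2) xD(2) e3]) (rule that; assumption)
    obtain d3 where d3: "0 < d3" "\<And>y. y \<in> K \<Longrightarrow> dist y x < d3 \<Longrightarrow> dist (g y) (g x) < e / 3"
      using g x e3 unfolding continuous_on_iff by metis
    have "?f y < ?f x + e" if y: "y \<in> K" "dist y x < min d1 (min d2 d3)" for y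
    proof -
      have "fst y \<in> D" "snd y \<in> D" using y K(3) by auto
      moreover have "dist (fst y) (fst x) < d1" "dist (snd y) (snd x) < d2"
        using y(2) dist_fst_le[of y x] dist_snd_le[of y x] by linarith+
      ultimately have "u1 (fst y) < u1 (fst x) + e / 3" "u2 (snd y) < u2 (snd x) + e / 3" using d1(2) d2(2) by auto
      moreover have "\<bar>g y - g x\<bar> < e / 3" using d3(2)[of y] y by (simp add: dist_real_def)
      ultimately show ?thesis by linarith
    qed
    then show ?thesis using d1 d2 d3 by (intro exI[of _ "min d1 (min d2 d3)"]) auto
  qed
  obtain q where "q \<in> K" "\<And>y. y \<in> K \<Longrightarrow> ?f y \<le> ?f q"
    by (rule usc_attains_max[OF K(1,2)]) ((rule usc; assumption), (rule that; assumption))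
  then show thesis using that[of "fst q" "snd q"] by force
qed

text \<open>
  The Hessian of the quadratic form spelled out in \<open>quad_doubling_hessian\<close> below. This form covers the penalisations used for
  comparison and for equicontinuity.
\<close>
definition doubling_hessian ::
  "real \<Rightarrow> real \<Rightarrow> real^'n \<Rightarrow> real \<Rightarrow> real \<Rightarrow> real^'n \<Rightarrow> real \<Rightarrow> (real^'n) \<times> (real^'n) \<Rightarrow> (real^'n) \<times> (real^'n)" where
  "doubling_hessian A0 A1 e B1 B2 \<nu> \<alpha> = (\<lambda>(h, k).
     let w = (2 * A0) *\<^sub>R (h - k) - (2 * A1 * (e \<bullet> (h - k))) *\<^sub>R e
     in (w + (2 * B1 * (h \<bullet> \<nu>)) *\<^sub>R \<nu> + (2 * \<alpha>) *\<^sub>R h, (2 * B2 * (k \<bullet> \<nu>)) *\<^sub>R \<nu> - w))"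

lemma selfadjoint_doubling_hessian: "selfadjoint (doubling_hessian A0 A1 e B1 B2 \<nu> \<alpha>)"
  unfolding selfadjoint_def
proof (intro conjI allI)
  show "linear (doubling_hessian A0 A1 e B1 B2 \<nu> \<alpha>)"
    by (intro linearI) (auto simp: doubling_hessian_def Let_def algebra_simps inner_add_left inner_add_right inner_diff_right)
  show "x \<bullet> doubling_hessian A0 A1 e B1 B2 \<nu> \<alpha> y = doubling_hessian A0 A1 e B1 B2 \<nu> \<alpha> x \<bullet> y" for x y
    by (cases x; cases y)
       (simp add: doubling_hessian_def Let_def inner_add_left inner_add_right inner_diff_left inner_diff_right inner_commute algebra_simps)
qed

lemma quad_doubling_hessian:
  "quad (doubling_hessian A0 A1 e B1 B2 \<nu> \<alpha>) (h, k) =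
     A0 * (norm (h - k))\<^sup>2 - A1 * (e \<bullet> (h - k))\<^sup>2 + B1 * (h \<bullet> \<nu>)\<^sup>2 + B2 * (k \<bullet> \<nu>)\<^sup>2 + \<alpha> * (norm h)\<^sup>2"
  unfolding quad_def doubling_hessian_def Let_def power2_norm_eq_inner
  by (simp add: inner_add_left inner_add_right inner_diff_left inner_diff_right inner_commute power2_eq_square field_simps)

context elliptic_pair begin

text \<open>
  The slopes \<open>p0\<close> and \<open>q0\<close> violate the Neumann conditions strictly, which excludes the boundary alternative and leaves
  admissible Hessians.
\<close>
lemma doubling_jets:
  assumes \<nu>: "norm \<nu> = 1" and u1: "jet_subsolution \<Gamma>1 \<nu> h1 u1" and u2: "jet_subsolution \<Gamma>2 \<nu> h2 u2"
    and a: "a \<in> slab \<nu>" "a \<bullet> \<nu> < 1" and b: "b \<in> slab \<nu>" "b \<bullet> \<nu> < 1" and r: "0 < r" and M: "selfadjoint M"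
    and le: "\<And>x y. x \<in> slab \<nu> \<Longrightarrow> y \<in> slab \<nu> \<Longrightarrow> norm (x - a) \<le> r \<Longrightarrow> norm (y - b) \<le> r \<Longrightarrow>
       u1 x + u2 y \<le> u1 a + u2 b + p0 \<bullet> (x - a) + q0 \<bullet> (y - b) + quad M (x - a, y - b)"
    and e: "0 < e"
    and bd1: "\<And>x p. x \<bullet> \<nu> = 0 \<Longrightarrow> norm (x - a) < e \<Longrightarrow> p \<bullet> \<nu> < p0 \<bullet> \<nu> + e \<Longrightarrow> p \<bullet> \<nu> < h1 x"
    and bd2: "\<And>y q. y \<bullet> \<nu> = 0 \<Longrightarrow> norm (y - b) < e \<Longrightarrow> q \<bullet> \<nu> < q0 \<bullet> \<nu> + e \<Longrightarrow> q \<bullet> \<nu> < h2 y"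
  obtains X Y where "X \<in> \<Gamma>1" "Y \<in> \<Gamma>2" "symmetric_matrix X" "symmetric_matrix Y"
    "\<And>h k. h \<bullet> (X *v h) + k \<bullet> (Y *v k) \<le> 2 * quad M (h, k) + e * ((norm h)\<^sup>2 + (norm k)\<^sup>2)"
proof -
  define e' where "e' = min e (min (1 - a \<bullet> \<nu>) (1 - b \<bullet> \<nu>))"
  have e': "0 < e'" "e' \<le> e" "e' \<le> 1 - a \<bullet> \<nu>" "e' \<le> 1 - b \<bullet> \<nu>" using e a b by (auto simp: e'_def)
  have usc: "usc_on (slab \<nu>) u1" "usc_on (slab \<nu>) u2" using u1 u2 by (auto simp: jet_subsolution_def)
  obtain x p X y q Y where J: "superjet (slab \<nu>) u1 x p X" "superjet (slab \<nu>) u2 y q Y"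
    and n: "norm (x - a) < e'" "norm (y - b) < e'" "norm (p - p0) < e'" "norm (q - q0) < e'"
    and XY: "\<And>h k. h \<bullet> (X *v h) + k \<bullet> (Y *v k) \<le> 2 * quad M (h, k) + e' * ((norm h)\<^sup>2 + (norm k)\<^sup>2)"
    by (rule theorem_on_sums[OF closed_slab a(1) b(1) usc r M e'(1)]) ((rule le; assumption), (rule that; assumption))
  have small: "v \<bullet> \<nu> < w \<bullet> \<nu> + e'" if "norm (v - w) < e'" for v w
  proof -
    have "(v - w) \<bullet> \<nu> \<le> norm (v - w) * norm \<nu>" by (rule norm_cauchy_schwarz)
    then show ?thesis using that \<nu> by (simp add: inner_diff_left)
  qed
  have "x \<bullet> \<nu> < 1" "y \<bullet> \<nu> < 1" using small[OF n(1)] small[OF n(2)] e' by linarith+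
  then have alt: "X \<in> \<Gamma>1 \<or> x \<bullet> \<nu> = 0 \<and> h1 x \<le> p \<bullet> \<nu>" "Y \<in> \<Gamma>2 \<or> y \<bullet> \<nu> = 0 \<and> h2 y \<le> q \<bullet> \<nu>"
    using u1 u2 J unfolding jet_subsolution_def by blast+
  have "X \<in> \<Gamma>1"
  proof (rule ccontr)
    assume "X \<notin> \<Gamma>1"
    then have x0: "x \<bullet> \<nu> = 0" and "h1 x \<le> p \<bullet> \<nu>" using alt by auto
    moreover have "p \<bullet> \<nu> < h1 x" using small[OF n(3)] n(1) e'(2) by (intro bd1[OF x0]) linarith+
    ultimately show False by simp
  qed
  moreover have "Y \<in> \<Gamma>2"
  proof (rule ccontr)
    assume "Y \<notin> \<Gamma>2"
    then have y0: "y \<bullet> \<nu> = 0" and "h2 y \<le> q \<bullet> \<nu>" using alt by auto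
    moreover have "q \<bullet> \<nu> < h2 y" using small[OF n(4)] n(2) e'(2) by (intro bd2[OF y0]) linarith+
    ultimately show False by simp
  qed
  moreover have "h \<bullet> (X *v h) + k \<bullet> (Y *v k) \<le> 2 * quad M (h, k) + e * ((norm h)\<^sup>2 + (norm k)\<^sup>2)" for h k
  proof -
    have "e' * ((norm h)\<^sup>2 + (norm k)\<^sup>2) \<le> e * ((norm h)\<^sup>2 + (norm k)\<^sup>2)" using e' by (intro mult_right_mono) auto
    then show ?thesis using XY[of h k] by linarith
  qed
  moreover have "symmetric_matrix X" "symmetric_matrix Y" using J by (auto simp: superjet_def)
  ultimately show thesis using that by blast
qed

end

lemma norm_diff_sq: "(norm (x - y))\<^sup>2 = (norm (a - b))\<^sup>2 + 2 * ((a - b) \<bullet> ((x - a) - (y - b))) + (norm ((x - a) - (y - b)))\<^sup>2"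
  for x y a b :: "'a::real_inner"
  unfolding power2_norm_eq_inner by (simp add: inner_diff_left inner_diff_right inner_commute algebra_simps)

lemma slab_inner_le_1: "x \<in> slab \<nu> \<Longrightarrow> y \<in> slab \<nu> \<Longrightarrow> \<bar>(x - y) \<bullet> \<nu>\<bar> \<le> 1"
  by (auto simp: slab_def inner_diff_left)

lemma compact_doubling_region:
  fixes \<nu> :: "real^'n"
  shows "compact {(x, y). x \<in> slab \<nu> \<and> y \<in> slab \<nu> \<and> norm (x - x0) \<le> R \<and> norm (x - y) \<le> R'}" (is "compact ?K")
proof -
  have "closed ((slab \<nu> \<times> slab \<nu>) \<inter> {q. norm (fst q - x0) \<le> R} \<inter> {q. norm (fst q - snd q) \<le> R'})"
    by (intro closed_Int closed_Times closed_slab closed_Collect_le continuous_intros)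
  moreover have "(slab \<nu> \<times> slab \<nu>) \<inter> {q. norm (fst q - x0) \<le> R} \<inter> {q. norm (fst q - snd q) \<le> R'} = ?K" by auto
  moreover have "?K \<subseteq> cball x0 R \<times> cball x0 (R + R')"
  proof
    fix q assume "q \<in> ?K"
    then obtain x y where q: "q = (x, y)" "norm (x - x0) \<le> R" "norm (x - y) \<le> R'" by auto
    then show "q \<in> cball x0 R \<times> cball x0 (R + R')"
      using norm_triangle_ineq4[of "x - x0" "x - y"] by (simp add: dist_norm norm_minus_commute)
  qed
  ultimately have "closed ?K" "bounded ?K"
    using bounded_subset[OF compact_imp_bounded[OF compact_Times[OF compact_cball compact_cball]]] by auto
  then show ?thesis by (simp add: compact_eq_bounded_closed)
qed

context elliptic_pair begin

text \<open>
  Doubling of variables. The barrier \<open>\<beta>\<close> is strictly concave in the direction \<open>\<nu>\<close>, which contradicts ellipticity in the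
  interior, and its slope at the bottom leaves room \<open>\<kappa>\<close> for the Neumann data. At the bottom the penalisation
  \<open>j \<bar>x - y\<bar>\<^sup>2 / 2\<close> contributes to both normal derivatives with the favourable sign, but the data themselves have to be matched: the term
  \<open>c ((x - y) \<bullet> \<nu>)\<close> subtracts a value of \<open>h2\<close> frozen at the projection of \<open>x0\<close>. This suffices because the maximum is localised: \<open>x0\<close> is an
  almost maximiser of \<open>w\<close>, and the error \<open>\<alpha> r\<^sup>2\<close> allowed for it forces the maximum points of the doubled function into the ball of
  radius \<open>2 r\<close> about \<open>x0\<close> as \<open>j\<close> grows.
\<close>
lemma comparison:
  assumes \<nu>: "norm \<nu> = 1" and u1: "jet_subsolution \<Gamma>1 \<nu> h1 u1" and u2: "jet_subsolution \<Gamma>2 \<nu> h2 u2"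
    and bd: "\<And>x. x \<in> slab \<nu> \<Longrightarrow> u1 x \<le> B" "\<And>x. x \<in> slab \<nu> \<Longrightarrow> u2 x \<le> B"
    and uc: "\<And>e. 0 < e \<Longrightarrow> \<exists>d>0. \<forall>x y. x \<bullet> \<nu> = 0 \<longrightarrow> y \<bullet> \<nu> = 0 \<longrightarrow> norm (x - y) < d \<longrightarrow> \<bar>h2 x - h2 y\<bar> < e"
    and \<delta>: "0 \<le> \<delta>" and h: "\<And>x. x \<bullet> \<nu> = 0 \<Longrightarrow> - \<delta> \<le> h1 x + h2 x" and x: "x \<in> slab \<nu>"
  shows "u1 x + u2 x \<le> \<delta> * (1 - x \<bullet> \<nu>)"
proof -
  have \<nu>\<nu>: "\<nu> \<bullet> \<nu> = 1" using \<nu> by (simp add: norm_eq_1)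
  have usc: "usc_on (slab \<nu>) u1" "usc_on (slab \<nu>) u2" using u1 u2 by (auto simp: jet_subsolution_def)
  have main: "u1 x + u2 x \<le> (\<delta> + \<kappa>) * (1 - x \<bullet> \<nu>) + \<kappa> * (1 - (x \<bullet> \<nu>)\<^sup>2)" if \<kappa>: "0 < \<kappa>" for \<kappa>
  proof (rule ccontr)
    define \<beta> where "\<beta> = (\<lambda>x. (\<delta> + \<kappa>) * (1 - x \<bullet> \<nu>) + \<kappa> * (1 - (x \<bullet> \<nu>)\<^sup>2))"
    define w where "w = (\<lambda>x. u1 x + u2 x - \<beta> x)"
    assume "\<not> ?thesis"
    then have wx: "0 < w x" by (simp add: w_def \<beta>_def)
    have \<beta>0: "0 \<le> \<beta> x" if "x \<in> slab \<nu>" for x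
    proof -
      have "(x \<bullet> \<nu>)\<^sup>2 \<le> 1" using that by (auto simp: slab_def power_le_one)
      then show ?thesis using that \<kappa> \<delta> unfolding \<beta>_def slab_def by (intro add_nonneg_nonneg mult_nonneg_nonneg) auto
    qed
    have bddw: "bdd_above (w ` slab \<nu>)"
      unfolding bdd_above_def
    proof (intro exI[of _ "2 * B"] ballI)
      fix t assume "t \<in> w ` slab \<nu>"
      then obtain y where y: "y \<in> slab \<nu>" "t = w y" by blast
      show "t \<le> 2 * B" using bd(1)[OF y(1)] bd(2)[OF y(1)] \<beta>0[OF y(1)] by (simp add: y(2) w_def)
    qed
    define W where "W = Sup (w ` slab \<nu>)"
    have W: "w y \<le> W" if "y \<in> slab \<nu>" for y unfolding W_def using bddw that by (auto intro: cSup_upper)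
    have Wpos: "0 < W" using W[OF x] wx by simp
    obtain d where d: "0 < d" "\<And>x y. x \<bullet> \<nu> = 0 \<Longrightarrow> y \<bullet> \<nu> = 0 \<Longrightarrow> norm (x - y) < d \<Longrightarrow> \<bar>h2 x - h2 y\<bar> < \<kappa> / 4"
      using uc[of "\<kappa> / 4"] \<kappa> by auto
    define r where "r = min (d / 3) 1"
    have r: "0 < r" "r \<le> 1" "3 * r \<le> d" using d by (auto simp: r_def)
    define N where "N = real CARD('n) * Lam"
    have N: "0 < N" using lam by (simp add: N_def)
    define \<alpha> where "\<alpha> = min (\<kappa> / 64) (\<kappa> * lam / (4 * N))"
    have \<alpha>: "0 < \<alpha>" "64 * \<alpha> \<le> \<kappa>" "4 * (\<alpha> * N) \<le> \<kappa> * lam"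
    proof -
      show "0 < \<alpha>" "64 * \<alpha> \<le> \<kappa>" using \<kappa> lam N by (auto simp: \<alpha>_def)
      have "\<alpha> * (4 * N) \<le> \<kappa> * lam / (4 * N) * (4 * N)" using N by (intro mult_right_mono) (auto simp: \<alpha>_def)
      then show "4 * (\<alpha> * N) \<le> \<kappa> * lam" using N by (simp add: algebra_simps)
    qed
    have "max 0 (W - \<alpha> * r\<^sup>2) < W" using Wpos \<alpha> r by simp
    then obtain x0 where x0: "x0 \<in> slab \<nu>" "max 0 (W - \<alpha> * r\<^sup>2) < w x0"
      unfolding W_def using less_cSupD[of "w ` slab \<nu>"] x by (metis (no_types, lifting) W_def empty_iff image_iff image_is_empty)
    define x0' where "x0' = x0 - (x0 \<bullet> \<nu>) *\<^sub>R \<nu>"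
    have x0': "x0' \<bullet> \<nu> = 0" by (simp add: x0'_def inner_diff_left \<nu>\<nu>)
    have proj: "norm (y - x0') \<le> norm (y - x0)" if "y \<bullet> \<nu> = 0" for y
    proof -
      have "(norm (y - x0))\<^sup>2 = (norm (y - x0'))\<^sup>2 + (x0 \<bullet> \<nu>)\<^sup>2"
        using that \<nu>\<nu> unfolding power2_norm_eq_inner x0'_def
        by (simp add: inner_diff_left inner_diff_right inner_commute power2_eq_square algebra_simps)
      then have "(norm (y - x0'))\<^sup>2 \<le> (norm (y - x0))\<^sup>2" by simp
      then show ?thesis by (rule power2_le_imp_le) simp
    qed
    \<comment> \<open>half of the room \<open>\<kappa>\<close> is given to each of the two Neumann conditions\<close>
    define c where "c = \<kappa> / 2 - h2 x0'"
    define B' where "B' = 2 * \<bar>B\<bar> + \<bar>c\<bar> + 1"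
    have B': "0 < B'" by (simp add: B'_def add_nonneg_pos)
    define g where "g = (\<lambda>j (x, y). real j / 2 * (norm (x - y))\<^sup>2 + c * ((x - y) \<bullet> \<nu>) + \<beta> x + \<alpha> * (norm (x - x0))\<^sup>2)"
    have upper: "u1 x + u2 y - g j (x, y) \<le> B' - real j / 2 * (norm (x - y))\<^sup>2 - \<alpha> * (norm (x - x0))\<^sup>2"
      if xy: "x \<in> slab \<nu>" "y \<in> slab \<nu>" for x y j
    proof -
      have "\<bar>c * ((x - y) \<bullet> \<nu>)\<bar> \<le> \<bar>c\<bar> * 1" unfolding abs_mult using slab_inner_le_1[OF xy] by (intro mult_left_mono) auto
      then have "- (c * ((x - y) \<bullet> \<nu>)) \<le> \<bar>c\<bar>" by (simp add: abs_le_iff)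
      moreover have "u1 x \<le> \<bar>B\<bar>" "u2 y \<le> \<bar>B\<bar>" using bd(1)[OF xy(1)] bd(2)[OF xy(2)] by auto
      ultimately show ?thesis using \<beta>0[OF xy(1)] by (simp add: g_def B'_def)
    qed
    have gx0: "u1 x0 + u2 x0 - g j (x0, x0) = w x0" for j by (simp add: g_def w_def)
    define R where "R = B' / \<alpha> + 1"
    define R' where "R' = 2 * B' + 1"
    define K where "K = {(x, y). x \<in> slab \<nu> \<and> y \<in> slab \<nu> \<and> norm (x - x0) \<le> R \<and> norm (x - y) \<le> R'}"
    have K: "compact K" unfolding K_def by (rule compact_doubling_region)
    have x0K: "(x0, x0) \<in> K" using x0 B' \<alpha> by (simp add: K_def R_def R'_def add_nonneg_nonneg)
    have "\<exists>a b. (a, b) \<in> K \<and> (\<forall>x y. (x, y) \<in> K \<longrightarrow> u1 x + u2 y - g j (x, y) \<le> u1 a + u2 b - g j (a, b))" for j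
    proof -
      have cg: "continuous_on K (g j)" unfolding g_def \<beta>_def split_beta by (intro continuous_intros)
      have "K \<subseteq> slab \<nu> \<times> slab \<nu>" by (auto simp: K_def)
      moreover have "K \<noteq> {}" using x0K by blast
      ultimately show ?thesis using usc_sum_attains_max[OF K _ _ usc cg] by metis
    qed
    then obtain a b where abK: "\<And>j. (a j, b j) \<in> K"
      and max: "\<And>j x y. (x, y) \<in> K \<Longrightarrow> u1 x + u2 y - g j (x, y) \<le> u1 (a j) + u2 (b j) - g j (a j, b j)" by metis
    have as: "a j \<in> slab \<nu>" and bs: "b j \<in> slab \<nu>" for j using abK[of j] by (auto simp: K_def)
    have w0: "w x0 \<le> u1 (a j) + u2 (b j) - g j (a j, b j)" for j using max[OF x0K, of j] gx0 by simp
    have gmax: "u1 x + u2 y - g j (x, y) \<le> u1 (a j) + u2 (b j) - g j (a j, b j)"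
      if xy: "x \<in> slab \<nu>" "y \<in> slab \<nu>" and j: "1 \<le> j" for x y j
    proof (cases "(x, y) \<in> K")
      case False
      then consider "R < norm (x - x0)" | "R' < norm (x - y)" using xy by (auto simp: K_def)
      then have "B' - real j / 2 * (norm (x - y))\<^sup>2 - \<alpha> * (norm (x - x0))\<^sup>2 \<le> 0"
      proof cases
        case 1
        have "1 \<le> R" using B' \<alpha> by (simp add: R_def)
        then have "R \<le> (norm (x - x0))\<^sup>2" using 1 mult_mono[of R "norm (x - x0)" 1 "norm (x - x0)"] by (simp add: power2_eq_square)
        then have "\<alpha> * R \<le> \<alpha> * (norm (x - x0))\<^sup>2" using \<alpha> by (intro mult_left_mono) auto
        moreover have "B' \<le> \<alpha> * R" using \<alpha> by (simp add: R_def distrib_left)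
        moreover have "0 \<le> real j / 2 * (norm (x - y))\<^sup>2" by simp
        ultimately show ?thesis by linarith
      next
        case 2
        have "1 \<le> R'" using B' by (simp add: R'_def)
        then have "R' \<le> (norm (x - y))\<^sup>2" using 2 mult_mono[of R' "norm (x - y)" 1 "norm (x - y)"] by (simp add: power2_eq_square)
        then have "R' \<le> real j * (norm (x - y))\<^sup>2" using j mult_mono[of 1 "real j" R' "(norm (x - y))\<^sup>2"] \<open>1 \<le> R'\<close> by simp
        moreover have "0 \<le> \<alpha> * (norm (x - x0))\<^sup>2" using \<alpha> by simp
        ultimately show ?thesis by (simp add: R'_def)
      qed
      then show ?thesis using upper[OF xy, of j] w0[of j] x0(2) by simp
    qed (use max in blast)
    obtain r' q where q: "q \<in> K" and r': "strict_mono (r' :: nat \<Rightarrow> nat)" "((\<lambda>j. (a j, b j)) \<circ> r') \<longlonglongrightarrow> q"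
      using K abK unfolding compact_def by (metis (no_types, lifting))
    define z where "z = fst q"
    have za: "(\<lambda>j. a (r' j)) \<longlonglongrightarrow> z" using tendsto_fst[OF r'(2)] by (simp add: o_def z_def)
    have ab0: "(\<lambda>j. a (r' j) - b (r' j)) \<longlonglongrightarrow> 0"
    proof -
      have "(\<lambda>j. (norm (a j - b j))\<^sup>2) \<longlonglongrightarrow> 0"
      proof (rule Lim_null_comparison)
        show "\<forall>\<^sub>F j in sequentially. norm ((norm (a j - b j))\<^sup>2) \<le> 2 * B' * inverse (real j)"
          unfolding eventually_sequentially
        proof (intro exI[of _ 1] allI impI)
          fix j :: nat assume j: "1 \<le> j"
          have "0 \<le> \<alpha> * (norm (a j - x0))\<^sup>2" using \<alpha> by simp
          then have "real j / 2 * (norm (a j - b j))\<^sup>2 \<le> B'" using upper[OF as bs, of j j j] w0[of j] x0(2) by simp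
          then show "norm ((norm (a j - b j))\<^sup>2) \<le> 2 * B' * inverse (real j)" using j by (simp add: field_simps)
        qed
        show "(\<lambda>j. 2 * B' * inverse (real j)) \<longlonglongrightarrow> 0"
          by (rule tendsto_mult_right_zero[OF lim_inverse_n])
      qed
      then have "(\<lambda>j. sqrt ((norm (a j - b j))\<^sup>2)) \<longlonglongrightarrow> sqrt 0" by (intro tendsto_intros)
      then have "(\<lambda>j. a j - b j) \<longlonglongrightarrow> 0" by (simp add: tendsto_norm_zero_iff)
      then show ?thesis using LIMSEQ_subseq_LIMSEQ[OF _ r'(1)] by (auto simp: o_def)
    qed
    have zb: "(\<lambda>j. b (r' j)) \<longlonglongrightarrow> z" using tendsto_diff[OF za ab0] by simp
    have zs: "z \<in> slab \<nu>" using q by (auto simp: K_def z_def)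
    have wz: "w x0 \<le> w z - \<alpha> * (norm (z - x0))\<^sup>2"
    proof (rule field_le_epsilon)
      fix e :: real assume "0 < e"
      then have e: "0 < e / 2" by simp
      obtain d1 where d1: "0 < d1" "\<And>y. y \<in> slab \<nu> \<Longrightarrow> dist y z < d1 \<Longrightarrow> u1 y < u1 z + e / 2"
        by (rule usc_onD[OF usc(1) zs e]) (rule that; assumption)
      obtain d2 where d2: "0 < d2" "\<And>y. y \<in> slab \<nu> \<Longrightarrow> dist y z < d2 \<Longrightarrow> u2 y < u2 z + e / 2"
        by (rule usc_onD[OF usc(2) zs e]) (rule that; assumption)
      have ev: "\<forall>\<^sub>F j in sequentially. w x0 \<le> u1 z + u2 z + e - (c * ((a (r' j) - b (r' j)) \<bullet> \<nu>) + \<beta> (a (r' j)) + \<alpha> * (norm (a (r' j) - x0))\<^sup>2)"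
        using tendstoD[OF za d1(1)] tendstoD[OF zb d2(1)]
      proof eventually_elim
        case (elim j)
        have "u1 (a (r' j)) < u1 z + e / 2" "u2 (b (r' j)) < u2 z + e / 2" using d1(2)[OF as] d2(2)[OF bs] elim by auto
        moreover have "0 \<le> real (r' j) / 2 * (norm (a (r' j) - b (r' j)))\<^sup>2" by simp
        ultimately show ?case using w0[of "r' j"] unfolding g_def split_conv by linarith
      qed
      have "(\<lambda>j. u1 z + u2 z + e - (c * ((a (r' j) - b (r' j)) \<bullet> \<nu>) + \<beta> (a (r' j)) + \<alpha> * (norm (a (r' j) - x0))\<^sup>2))
          \<longlonglongrightarrow> u1 z + u2 z + e - (c * (0 \<bullet> \<nu>) + \<beta> z + \<alpha> * (norm (z - x0))\<^sup>2)"
        unfolding \<beta>_def by (intro tendsto_intros za ab0)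
      from tendsto_lowerbound[OF this ev] show "w x0 \<le> w z - \<alpha> * (norm (z - x0))\<^sup>2 + e" by (simp add: w_def)
    qed
    have zx0: "norm (z - x0) < r"
    proof -
      have "\<alpha> * (norm (z - x0))\<^sup>2 < \<alpha> * r\<^sup>2" using wz W[OF zs] x0(2) by simp
      then have "(norm (z - x0))\<^sup>2 < r\<^sup>2" using \<alpha> by simp
      then show ?thesis using r by (simp add: power2_less_imp_less)
    qed
    have z1: "z \<bullet> \<nu> < 1"
    proof (rule ccontr)
      assume "\<not> z \<bullet> \<nu> < 1"
      then have "z \<bullet> \<nu> = 1" using zs by (simp add: slab_def)
      then have "u1 z \<le> 0" "u2 z \<le> 0" "\<beta> z = 0" using u1 u2 by (auto simp: jet_subsolution_def \<beta>_def)
      moreover have "0 \<le> \<alpha> * (norm (z - x0))\<^sup>2" using \<alpha> by simp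
      ultimately show False using wz x0(2) by (simp add: w_def)
    qed
    have "0 < min r (1 - z \<bullet> \<nu>)" using r z1 by simp
    then have "\<forall>\<^sub>F j in sequentially. dist (a (r' j)) z < min r (1 - z \<bullet> \<nu>) \<and> dist (b (r' j)) z < min r (1 - z \<bullet> \<nu>) \<and> 1 \<le> j"
      using tendstoD[OF za] tendstoD[OF zb] eventually_ge_at_top[of 1] by (intro eventually_conj) blast+
    then obtain j0 where j0: "dist (a (r' j0)) z < min r (1 - z \<bullet> \<nu>)" "dist (b (r' j0)) z < min r (1 - z \<bullet> \<nu>)" "1 \<le> j0"
      using eventually_happens'[OF sequentially_bot] by blast
    define j where "j = r' j0"
    have j: "1 \<le> j" using j0(3) seq_suble[OF r'(1), of j0] by (simp add: j_def)
    define A where "A = a j"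
    define Bp where "Bp = b j"
    have near: "y \<bullet> \<nu> < 1" "norm (y - x0) < 2 * r" if "dist y z < min r (1 - z \<bullet> \<nu>)" for y
    proof -
      have "(y - z) \<bullet> \<nu> \<le> norm (y - z) * norm \<nu>" by (rule norm_cauchy_schwarz)
      then show "y \<bullet> \<nu> < 1" using that \<nu> by (simp add: inner_diff_left dist_norm)
      show "norm (y - x0) < 2 * r" using that zx0 norm_triangle_ineq[of "y - z" "z - x0"] by (simp add: dist_norm)
    qed
    have A: "A \<in> slab \<nu>" "A \<bullet> \<nu> < 1" "norm (A - x0) < 2 * r" using as near[OF j0(1)] by (auto simp: A_def j_def)
    have Bq: "Bp \<in> slab \<nu>" "Bp \<bullet> \<nu> < 1" "norm (Bp - x0) < 2 * r" using bs near[OF j0(2)] by (auto simp: Bp_def j_def)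
    define M where "M = doubling_hessian (real j / 2) 0 \<nu> (- \<kappa>) 0 \<nu> \<alpha>"
    define p0 where "p0 = real j *\<^sub>R (A - Bp) + (c - (\<delta> + \<kappa>) - 2 * \<kappa> * (A \<bullet> \<nu>)) *\<^sub>R \<nu> + (2 * \<alpha>) *\<^sub>R (A - x0)"
    define q0 where "q0 = - (real j *\<^sub>R (A - Bp)) - c *\<^sub>R \<nu>"
    have exp: "g j (x, y) = g j (A, Bp) + p0 \<bullet> (x - A) + q0 \<bullet> (y - Bp) + quad M (x - A, y - Bp)" for x y
    proof -
      have 1: "real j / 2 * (norm (x - y))\<^sup>2 = real j / 2 * (norm (A - Bp))\<^sup>2 + real j * ((A - Bp) \<bullet> (x - A)) - real j * ((A - Bp) \<bullet> (y - Bp)) + real j / 2 * (norm ((x - A) - (y - Bp)))\<^sup>2"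
        unfolding norm_diff_sq[of x y A Bp] inner_diff_right[of "A - Bp" "x - A"] by (simp add: algebra_simps)
      have 2: "\<alpha> * (norm (x - x0))\<^sup>2 = \<alpha> * (norm (A - x0))\<^sup>2 + 2 * \<alpha> * ((A - x0) \<bullet> (x - A)) + \<alpha> * (norm (x - A))\<^sup>2"
        unfolding norm_diff_sq[of x x0 A x0] by (simp add: algebra_simps)
      have 3: "x \<bullet> \<nu> = A \<bullet> \<nu> + \<nu> \<bullet> (x - A)" "y \<bullet> \<nu> = Bp \<bullet> \<nu> + \<nu> \<bullet> (y - Bp)" by (simp_all add: inner_diff_right inner_commute)
      have 4: "\<beta> x = \<beta> A - (\<delta> + \<kappa>) * (\<nu> \<bullet> (x - A)) - 2 * \<kappa> * (A \<bullet> \<nu>) * (\<nu> \<bullet> (x - A)) - \<kappa> * (\<nu> \<bullet> (x - A))\<^sup>2"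
        unfolding \<beta>_def 3(1) by (simp add: power2_eq_square algebra_simps)
      have 5: "(x - y) \<bullet> \<nu> = (A - Bp) \<bullet> \<nu> + \<nu> \<bullet> (x - A) - \<nu> \<bullet> (y - Bp)"
        by (simp add: inner_diff_left inner_diff_right inner_commute)
      show ?thesis
        unfolding g_def split_conv 1 2 4 5 M_def quad_doubling_hessian p0_def q0_def
        by (simp add: inner_add_left inner_diff_left inner_commute[of _ \<nu>] inner_commute[of "x - A" \<nu>] algebra_simps)
    qed
    define e where "e = min (min r (\<kappa> / (16 * (real j + 1)))) (\<kappa> * lam / (4 * N))"
    have e: "0 < e" "e \<le> r" "(real j + 1) * e \<le> \<kappa> / 16" "4 * (e * N) \<le> \<kappa> * lam"
    proof -
      show "0 < e" "e \<le> r" using r \<kappa> lam N by (auto simp: e_def)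
      have "(real j + 1) * e \<le> (real j + 1) * (\<kappa> / (16 * (real j + 1)))" by (intro mult_left_mono) (auto simp: e_def)
      also have "\<dots> = \<kappa> / 16" by (simp add: field_simps)
      finally show "(real j + 1) * e \<le> \<kappa> / 16" .
      have "e * (4 * N) \<le> \<kappa> * lam / (4 * N) * (4 * N)" using N by (intro mult_right_mono) (auto simp: e_def)
      then show "4 * (e * N) \<le> \<kappa> * lam" using N by (simp add: algebra_simps)
    qed
    have hgt: "y \<bullet> \<nu> \<le> e" if "x \<bullet> \<nu> = 0" "norm (x - y) < e" for x y
    proof -
      have "(y - x) \<bullet> \<nu> \<le> norm (y - x) * norm \<nu>" by (rule norm_cauchy_schwarz)
      then show ?thesis using that \<nu> by (simp add: inner_diff_left norm_minus_commute)
    qed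
    obtain X Y where XY: "X \<in> \<Gamma>1" "Y \<in> \<Gamma>2" "symmetric_matrix X" "symmetric_matrix Y"
      and le: "\<And>h k. h \<bullet> (X *v h) + k \<bullet> (Y *v k) \<le> 2 * quad M (h, k) + e * ((norm h)\<^sup>2 + (norm k)\<^sup>2)"
    proof (rule doubling_jets[OF \<nu> u1 u2 A(1,2) Bq(1,2) zero_less_one, of M p0 q0 e])
      show "selfadjoint M" unfolding M_def by (rule selfadjoint_doubling_hessian)
      show "0 < e" by (rule e)
      show "u1 x + u2 y \<le> u1 A + u2 Bp + p0 \<bullet> (x - A) + q0 \<bullet> (y - Bp) + quad M (x - A, y - Bp)"
        if "x \<in> slab \<nu>" "y \<in> slab \<nu>" for x y
        using gmax[OF that j] exp[of x y] by (simp add: A_def Bp_def)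
      show "p \<bullet> \<nu> < h1 x" if x: "x \<bullet> \<nu> = 0" "norm (x - A) < e" and p: "p \<bullet> \<nu> < p0 \<bullet> \<nu> + e" for x p
      proof -
        have "real j * ((A - Bp) \<bullet> \<nu>) \<le> real j * e"
          using hgt[OF x] Bq(1) by (intro mult_left_mono) (auto simp: slab_def inner_diff_left)
        moreover have "0 \<le> 2 * \<kappa> * (A \<bullet> \<nu>)" using A(1) \<kappa> by (simp add: slab_def)
        moreover have "2 * \<alpha> * ((A - x0) \<bullet> \<nu>) \<le> \<kappa> / 16"
        proof -
          have "(A - x0) \<bullet> \<nu> \<le> 2" using norm_cauchy_schwarz[of "A - x0" \<nu>] \<nu> A(3) r by simp
          then have "2 * \<alpha> * ((A - x0) \<bullet> \<nu>) \<le> 2 * \<alpha> * 2" using \<alpha> by (intro mult_left_mono) auto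
          then show ?thesis using \<alpha>(2) by linarith
        qed
        moreover have "\<bar>h2 x - h2 x0'\<bar> < \<kappa> / 4"
        proof (rule d(2)[OF x(1) x0'])
          have "norm (x - x0') \<le> norm (x - x0)" by (rule proj[OF x(1)])
          also have "\<dots> \<le> norm (x - A) + norm (A - x0)" using norm_triangle_ineq[of "x - A" "A - x0"] by simp
          finally show "norm (x - x0') < d" using x(2) A(3) e(2) r by linarith
        qed
        moreover have "p0 \<bullet> \<nu> = real j * ((A - Bp) \<bullet> \<nu>) + (c - (\<delta> + \<kappa>) - 2 * \<kappa> * (A \<bullet> \<nu>)) + 2 * \<alpha> * ((A - x0) \<bullet> \<nu>)"
          by (simp add: p0_def inner_add_left \<nu>\<nu>)
        moreover have "real j * e + e \<le> \<kappa> / 16" using e(3) by (simp add: distrib_right)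
        moreover have "- \<delta> \<le> h1 x + h2 x" by (rule h[OF x(1)])
        ultimately show ?thesis using p \<kappa> unfolding c_def by linarith
      qed
      show "q \<bullet> \<nu> < h2 y" if y: "y \<bullet> \<nu> = 0" "norm (y - Bp) < e" and q: "q \<bullet> \<nu> < q0 \<bullet> \<nu> + e" for y q
      proof -
        have "real j * ((Bp - A) \<bullet> \<nu>) \<le> real j * e"
          using hgt[OF y] A(1) by (intro mult_left_mono) (auto simp: slab_def inner_diff_left)
        moreover have "\<bar>h2 y - h2 x0'\<bar> < \<kappa> / 4"
        proof (rule d(2)[OF y(1) x0'])
          have "norm (y - x0') \<le> norm (y - x0)" by (rule proj[OF y(1)])
          also have "\<dots> \<le> norm (y - Bp) + norm (Bp - x0)" using norm_triangle_ineq[of "y - Bp" "Bp - x0"] by simp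
          finally show "norm (y - x0') < d" using y(2) Bq(3) e(2) r by linarith
        qed
        moreover have "q0 \<bullet> \<nu> = real j * ((Bp - A) \<bullet> \<nu>) - c"
          by (simp add: q0_def inner_diff_left \<nu>\<nu> algebra_simps)
        moreover have "real j * e + e \<le> \<kappa> / 16" using e(3) by (simp add: distrib_right)
        ultimately show ?thesis using q \<kappa> unfolding c_def by linarith
      qed
    qed blast
    have hh: "h \<bullet> (X *v h) + h \<bullet> (Y *v h) \<le> 2 * (\<alpha> + e) * (norm h)\<^sup>2 - 2 * \<kappa> * (h \<bullet> \<nu>)\<^sup>2" for h
      using le[of h h] by (simp add: M_def quad_doubling_hessian algebra_simps)
    have "lam * (2 * \<kappa>) \<le> 2 * (\<alpha> + e) * (real CARD('n) * Lam)"
    proof (rule no_common_strict[OF XY(3,1,4,2) _ _ \<nu>])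
      show "0 \<le> 2 * (\<alpha> + e)" using \<alpha> e by simp
      show "x \<bullet> (X *v x) + x \<bullet> (Y *v x) \<le> 2 * (\<alpha> + e) * (norm x)\<^sup>2" for x
      proof -
        have "0 \<le> 2 * \<kappa> * (x \<bullet> \<nu>)\<^sup>2" using \<kappa> by simp
        then show ?thesis using hh[of x] by linarith
      qed
      show "\<nu> \<bullet> (X *v \<nu>) + \<nu> \<bullet> (Y *v \<nu>) \<le> 2 * (\<alpha> + e) - 2 * \<kappa>" using hh[of \<nu>] \<nu> \<nu>\<nu> by simp
    qed
    then have "2 * (\<kappa> * lam) \<le> 2 * (\<alpha> * N) + 2 * (e * N)" by (simp add: N_def algebra_simps)
    moreover have "0 < \<kappa> * lam" using \<kappa> lam by simp
    ultimately show False using \<alpha>(3) e(4) by linarith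
  qed
  have "((\<lambda>\<kappa>. (\<delta> + \<kappa>) * (1 - x \<bullet> \<nu>) + \<kappa> * (1 - (x \<bullet> \<nu>)\<^sup>2)) \<longlongrightarrow> (\<delta> + 0) * (1 - x \<bullet> \<nu>) + 0 * (1 - (x \<bullet> \<nu>)\<^sup>2)) (at_right 0)"
    by (intro tendsto_intros)
  then have "u1 x + u2 x \<le> (\<delta> + 0) * (1 - x \<bullet> \<nu>) + 0 * (1 - (x \<bullet> \<nu>)\<^sup>2)"
    by (rule tendsto_lowerbound) (use main in \<open>auto simp: eventually_at_right_less intro: eventually_mono[OF eventually_at_right_less[of 0]]\<close>)
  then show ?thesis by simp
qed

end

section \<open>Equicontinuity on the bottom\<close>

text \<open>
  A quadratic upper bound on the norm that is linear in the direction \<open>e\<close> of \<open>z\<close>. It follows from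
  \<open>sqrt (s\<^sup>2 + q) \<le> s + q / (2 s)\<close> with \<open>s = norm z + e \<bullet> w \<ge> norm z / 2\<close>.
\<close>
lemma norm_add_le_quadratic:
  fixes z w :: "'a::real_inner"
  assumes z: "z \<noteq> 0" and w: "norm w \<le> norm z / 2"
  defines "e \<equiv> z /\<^sub>R norm z"
  shows "norm (z + w) \<le> norm z + e \<bullet> w + ((norm w)\<^sup>2 - (e \<bullet> w)\<^sup>2) / norm z"
proof -
  define r where "r = norm z"
  have r: "0 < r" using z by (simp add: r_def)
  have e: "norm e = 1" "z = r *\<^sub>R e" using z by (auto simp: e_def r_def)
  have ew: "\<bar>e \<bullet> w\<bar> \<le> norm w" using Cauchy_Schwarz_ineq2[of e w] e by simp
  define s where "s = r + e \<bullet> w"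
  define q where "q = (norm w)\<^sup>2 - (e \<bullet> w)\<^sup>2"
  have s: "r / 2 \<le> s" using ew w by (simp add: s_def r_def)
  have q: "0 \<le> q" using power_mono[OF ew, of 2] by (simp add: q_def)
  have "(norm (z + w))\<^sup>2 = r\<^sup>2 + 2 * r * (e \<bullet> w) + (norm w)\<^sup>2"
    unfolding e(2) power2_norm_eq_inner using e(1)
    by (simp add: inner_add_left inner_add_right inner_commute norm_eq_1 power2_eq_square)
  also have "\<dots> = s\<^sup>2 + q" by (simp add: s_def q_def power2_eq_square algebra_simps)
  also have "\<dots> \<le> (s + q / r)\<^sup>2"
  proof -
    have "q * 1 \<le> q * (2 * s / r)" using s r q by (intro mult_left_mono) (auto simp: field_simps)
    moreover have "(s + q / r)\<^sup>2 = s\<^sup>2 + q * (2 * s / r) + (q / r)\<^sup>2"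
      using r by (simp add: power2_eq_square field_simps)
    moreover have "0 \<le> (q / r)\<^sup>2" by simp
    ultimately show ?thesis by linarith
  qed
  finally have "norm (z + w) \<le> s + q / r"
    by (rule power2_le_imp_le) (use s q r in auto)
  then show ?thesis by (simp add: s_def q_def r_def)
qed

context elliptic_pair begin

text \<open>
  If the estimate fails, then \<open>u1 x + u2 y - \<omega> (norm (x - y)) - \<psi> x - \<psi> y\<close>, slightly localised, has a positive maximum \<open>(a, b)\<close>. By the
  choice of \<open>\<omega>\<close> it has \<open>0 < norm (a - b) < r0\<close>. The functions \<open>\<psi>\<close> have the slope \<open>-2 K\<close> at the bottom, which violates the
  Neumann conditions; that they grow towards the top is harmless, since the estimate concerns the bottom. Testing the
  Hessian inequality with \<open>(h, h)\<close> bounds \<open>X + Y\<close> by a constant, whereas testing it with \<open>(e, -e)\<close> detects the concavity \<open>- M\<close>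
  of \<open>\<omega>\<close> with the factor \<open>4\<close>. As \<open>M = 4 K / r0\<^sup>2\<close>, ellipticity is contradicted for small \<open>r0\<close>.
\<close>
lemma ishii_lions:
  assumes \<nu>: "norm \<nu> = 1" and u1: "jet_subsolution \<Gamma>1 \<nu> h1 u1" and u2: "jet_subsolution \<Gamma>2 \<nu> h2 u2"
    and K: "0 < K" and h1: "\<And>x. x \<bullet> \<nu> = 0 \<Longrightarrow> - K \<le> h1 x" and h2: "\<And>x. x \<bullet> \<nu> = 0 \<Longrightarrow> - K \<le> h2 x"
    and bar: "\<And>x. x \<in> slab \<nu> \<Longrightarrow> u1 x \<le> K * (1 - x \<bullet> \<nu>)" "\<And>x. x \<in> slab \<nu> \<Longrightarrow> u2 x \<le> K * (1 - x \<bullet> \<nu>)"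
    and diag: "\<And>x. x \<in> slab \<nu> \<Longrightarrow> u1 x + u2 x \<le> 0"
    and \<delta>: "0 < \<delta>" and r0: "0 < r0" "r0 \<le> 1"
    and large: "(4 * (K\<^sup>2 / \<delta>) + 4) * (real CARD('n) * Lam) < lam * (16 * K / r0\<^sup>2)"
    and x0: "x0 \<bullet> \<nu> = 0" and y0: "y0 \<bullet> \<nu> = 0"
  shows "u1 x0 + u2 y0 \<le> 4 * K / r0 * norm (x0 - y0) + 2 * \<delta>"
proof (rule ccontr)
  assume "\<not> ?thesis"
  then have contra: "4 * K / r0 * norm (x0 - y0) + 2 * \<delta> < u1 x0 + u2 y0" by simp
  define L where "L = 4 * K / r0"
  define M where "M = 4 * K / r0\<^sup>2"
  define B where "B = K\<^sup>2 / \<delta>"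
  define \<alpha> where "\<alpha> = min 1 (K / 32)"
  have L: "0 < L" "L * r0 = 4 * K" "M * r0 = L" using K r0 by (auto simp: L_def M_def power2_eq_square)
  have M: "0 < M" "M * r0\<^sup>2 = 4 * K" using K r0 by (auto simp: M_def)
  have B: "0 < B" using K \<delta> by (simp add: B_def)
  have \<alpha>: "0 < \<alpha>" "\<alpha> \<le> 1" "32 * \<alpha> \<le> K" using K by (auto simp: \<alpha>_def)
  have \<nu>\<nu>: "\<nu> \<bullet> \<nu> = 1" using \<nu> by (simp add: norm_eq_1)
  have usc: "usc_on (slab \<nu>) u1" "usc_on (slab \<nu>) u2" using u1 u2 by (auto simp: jet_subsolution_def)
  have x0s: "x0 \<in> slab \<nu>" and y0s: "y0 \<in> slab \<nu>" using x0 y0 by (auto simp: slab_def)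
  have uK: "u1 x \<le> K" "u2 x \<le> K" if "x \<in> slab \<nu>" for x
  proof -
    have "K * (1 - x \<bullet> \<nu>) \<le> K * 1" using that K by (intro mult_left_mono) (auto simp: slab_def)
    then show "u1 x \<le> K" "u2 x \<le> K" using bar[OF that] by auto
  qed
  \<comment> \<open>increasing on \<open>[0, r0]\<close>, with \<open>\<omega> r0 = 2 K\<close>, the bound of the sum\<close>
  define \<omega> where "\<omega> = (\<lambda>r. L * r - M / 2 * r\<^sup>2)"
  have \<omega>_ge: "L / 2 * r \<le> \<omega> r" if "0 \<le> r" "r \<le> r0" for r
  proof -
    have "M * r \<le> M * r0" using that M by (intro mult_left_mono) auto
    then have "M * r \<le> L" unfolding L(3) .
    then have "M * r * r \<le> L * r" using that(1) by (rule mult_right_mono)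
    then show ?thesis by (simp add: \<omega>_def power2_eq_square)
  qed
  define \<psi> where "\<psi> = (\<lambda>x. \<delta> - 2 * K * (x \<bullet> \<nu>) + B * (x \<bullet> \<nu>)\<^sup>2)"
  \<comment> \<open>\<open>\<psi>\<close> is a perfect square with \<open>\<psi> = \<delta>\<close> and slope \<open>- 2 K\<close> on the bottom\<close>
  have \<psi>0: "0 \<le> \<psi> x" for x
  proof -
    have "\<psi> x = (\<delta> - K * (x \<bullet> \<nu>))\<^sup>2 / \<delta>" using \<delta> by (simp add: \<psi>_def B_def power2_eq_square field_simps)
    then show ?thesis using \<delta> by simp
  qed
  define g where "g = (\<lambda>(x, y). \<omega> (norm (x - y)) + \<psi> x + \<psi> y + \<alpha> * (norm (x - x0))\<^sup>2)"
  have near0: "norm (x0 - y0) < r0"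
  proof (rule ccontr)
    assume "\<not> ?thesis"
    then have "L * r0 \<le> L * norm (x0 - y0)" using L by (intro mult_left_mono) auto
    then show False using contra uK[OF x0s] uK[OF y0s] \<delta> K L(2) unfolding L_def[symmetric] by linarith
  qed
  have start: "0 < u1 x0 + u2 y0 - g (x0, y0)"
  proof -
    have "0 \<le> M / 2 * (norm (x0 - y0))\<^sup>2" using M by simp
    then have "g (x0, y0) \<le> L * norm (x0 - y0) + 2 * \<delta>"
      using x0 y0 unfolding g_def split_conv \<omega>_def \<psi>_def by simp
    then show ?thesis using contra unfolding L_def[symmetric] by linarith
  qed
  define R where "R = 2 * K / \<alpha> + 1"
  define D where "D = {(x, y). x \<in> slab \<nu> \<and> y \<in> slab \<nu> \<and> norm (x - x0) \<le> R \<and> norm (x - y) \<le> r0}"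
  have D: "compact D" unfolding D_def by (rule compact_doubling_region)
  have D0: "(x0, y0) \<in> D" using x0s y0s near0 K \<alpha> by (simp add: D_def R_def add_nonneg_nonneg)
  have Ds: "D \<subseteq> slab \<nu> \<times> slab \<nu>" by (auto simp: D_def)
  have gc: "continuous_on D g" unfolding g_def \<omega>_def \<psi>_def split_beta by (intro continuous_intros)
  have "D \<noteq> {}" using D0 by blast
  obtain a b where abD: "(a, b) \<in> D"
    and max: "\<And>x y. (x, y) \<in> D \<Longrightarrow> u1 x + u2 y - g (x, y) \<le> u1 a + u2 b - g (a, b)"
    by (rule usc_sum_attains_max[OF D \<open>D \<noteq> {}\<close> Ds usc gc]) (rule that; assumption)
  have as: "a \<in> slab \<nu>" and bs: "b \<in> slab \<nu>" and abr: "norm (a - b) \<le> r0" using abD by (auto simp: D_def)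
  have pos: "0 < u1 a + u2 b - g (a, b)" using max[OF D0] start by linarith
  have pen: "0 \<le> \<alpha> * (norm (a - x0))\<^sup>2" using \<alpha> by simp
  have \<omega>a: "L / 2 * norm (a - b) \<le> \<omega> (norm (a - b))" by (rule \<omega>_ge) (use abr in auto)
  have excess: "\<omega> (norm (a - b)) + \<alpha> * (norm (a - x0))\<^sup>2 < u1 a + u2 b"
    using pos \<psi>0[of a] \<psi>0[of b] unfolding g_def split_conv by linarith
  have penK: "\<alpha> * (norm (a - x0))\<^sup>2 < 2 * K"
  proof -
    have "0 \<le> L / 2 * norm (a - b)" using L by simp
    then show ?thesis using excess \<omega>a uK[OF as] uK[OF bs] by linarith
  qed
  have aR: "norm (a - x0) < R"
  proof (rule ccontr)
    assume "\<not> ?thesis"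
    then have "R \<le> norm (a - x0)" by simp
    moreover have "1 \<le> R" using K \<alpha> by (simp add: R_def)
    ultimately have "R \<le> (norm (a - x0))\<^sup>2" using mult_mono[of R "norm (a - x0)" 1 "norm (a - x0)"] by (simp add: power2_eq_square)
    then have "\<alpha> * R \<le> \<alpha> * (norm (a - x0))\<^sup>2" using \<alpha> by (intro mult_left_mono) auto
    moreover have "2 * K \<le> \<alpha> * R" using \<alpha> by (simp add: R_def distrib_left)
    ultimately show False using penK by linarith
  qed
  have abr': "norm (a - b) < r0"
  proof (rule ccontr)
    assume "\<not> ?thesis"
    then have "norm (a - b) = r0" using abr by simp
    then have "2 * K \<le> \<omega> (norm (a - b))" using \<omega>a L by simp
    then show False using excess pen uK[OF as] uK[OF bs] by linarith
  qed
  have ab: "a \<noteq> b"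
  proof
    assume "a = b"
    then have "u1 a + u2 b \<le> 0" using diag[OF as] by simp
    then show False using excess pen \<open>a = b\<close> by (simp add: \<omega>_def)
  qed
  have L2K: "2 * K \<le> L" using r0 K by (simp add: L_def field_simps)
  have gap: "\<bar>(a - b) \<bullet> \<nu>\<bar> \<le> norm (a - b)" using Cauchy_Schwarz_ineq2[of "a - b" \<nu>] \<nu> by simp
  \<comment> \<open>if \<open>a\<close> or \<open>b\<close> were at height \<open>1\<close>, the linear barriers would bound the sum by \<open>K \<bar>(a - b) \<bullet> \<nu>\<bar>\<close>\<close>
  have nottop: "K * \<bar>(a - b) \<bullet> \<nu>\<bar> < u1 a + u2 b"
  proof -
    have "K * \<bar>(a - b) \<bullet> \<nu>\<bar> \<le> L / 2 * norm (a - b)" using gap L2K K by (intro mult_mono) auto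
    then show ?thesis using excess pen \<omega>a by linarith
  qed
  have a1: "a \<bullet> \<nu> < 1"
  proof (rule ccontr)
    assume "\<not> ?thesis"
    then have a1: "a \<bullet> \<nu> = 1" using as by (simp add: slab_def)
    then have "u1 a \<le> 0" using u1 by (simp add: jet_subsolution_def)
    moreover have "\<bar>(a - b) \<bullet> \<nu>\<bar> = 1 - b \<bullet> \<nu>" using a1 bs by (simp add: inner_diff_left slab_def)
    ultimately show False using nottop bar(2)[OF bs] by simp
  qed
  have b1: "b \<bullet> \<nu> < 1"
  proof (rule ccontr)
    assume "\<not> ?thesis"
    then have b1: "b \<bullet> \<nu> = 1" using bs by (simp add: slab_def)
    then have "u2 b \<le> 0" using u2 by (simp add: jet_subsolution_def)
    moreover have "\<bar>(a - b) \<bullet> \<nu>\<bar> = 1 - a \<bullet> \<nu>" using b1 as by (simp add: inner_diff_left slab_def)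
    ultimately show False using nottop bar(1)[OF as] by simp
  qed
  define r where "r = norm (a - b)"
  have r: "0 < r" "r < r0" using ab abr' by (auto simp: r_def)
  define e where "e = (a - b) /\<^sub>R r"
  have e: "norm e = 1" using r by (simp add: e_def r_def)
  define s where "s = L / r - M"
  have s: "0 \<le> s"
  proof -
    have "M * r \<le> L" unfolding L(3)[symmetric] using r M by (intro mult_left_mono) auto
    then show ?thesis using r by (simp add: s_def field_simps)
  qed
  define H where "H = doubling_hessian (L / r - M / 2) (L / r) e B B \<nu> \<alpha>"
  define p0 where "p0 = s *\<^sub>R (a - b) + (2 * B * (a \<bullet> \<nu>) - 2 * K) *\<^sub>R \<nu> + (2 * \<alpha>) *\<^sub>R (a - x0)"
  define q0 where "q0 = (2 * B * (b \<bullet> \<nu>) - 2 * K) *\<^sub>R \<nu> - s *\<^sub>R (a - b)"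
  have gle: "g (x, y) \<le> g (a, b) + p0 \<bullet> (x - a) + q0 \<bullet> (y - b) + quad H (x - a, y - b)"
    if small: "norm ((x - a) - (y - b)) \<le> r / 2" for x y
  proof -
    define h k where "h = x - a" and "k = y - b"
    define w where "w = h - k"
    have xy: "x - y = (a - b) + w" by (simp add: w_def h_def k_def)
    have "norm ((a - b) + w) \<le> norm (a - b) + ((a - b) /\<^sub>R norm (a - b)) \<bullet> w + ((norm w)\<^sup>2 - (((a - b) /\<^sub>R norm (a - b)) \<bullet> w)\<^sup>2) / norm (a - b)"
      by (rule norm_add_le_quadratic) (use ab small in \<open>auto simp: r_def w_def h_def k_def\<close>)
    then have "norm (x - y) \<le> r + e \<bullet> w + ((norm w)\<^sup>2 - (e \<bullet> w)\<^sup>2) / r"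
      unfolding xy e_def r_def .
    then have "L * norm (x - y) \<le> L * (r + e \<bullet> w + ((norm w)\<^sup>2 - (e \<bullet> w)\<^sup>2) / r)" using L by (intro mult_left_mono) auto
    also have "\<dots> = L * r + L / r * ((a - b) \<bullet> w) + L / r * (norm w)\<^sup>2 - L / r * (e \<bullet> w)\<^sup>2"
    proof -
      have "L * (e \<bullet> w) = L / r * ((a - b) \<bullet> w)" by (simp add: e_def divide_inverse)
      moreover have "L * (r + E + (N2 - E2) / r) = L * r + L * E + L / r * N2 - L / r * E2" for E N2 E2
        using r by (simp add: field_simps)
      ultimately show ?thesis by simp
    qed
    finally have 1: "L * norm (x - y) \<le> L * r + L / r * ((a - b) \<bullet> w) + L / r * (norm w)\<^sup>2 - L / r * (e \<bullet> w)\<^sup>2" .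
    have 2: "M / 2 * (norm (x - y))\<^sup>2 = M / 2 * r\<^sup>2 + M * ((a - b) \<bullet> w) + M / 2 * (norm w)\<^sup>2"
      unfolding norm_diff_sq[of x y a b] r_def w_def h_def k_def by (simp add: algebra_simps)
    have 3: "\<alpha> * (norm (x - x0))\<^sup>2 = \<alpha> * (norm (a - x0))\<^sup>2 + 2 * \<alpha> * ((a - x0) \<bullet> h) + \<alpha> * (norm h)\<^sup>2"
      unfolding norm_diff_sq[of x x0 a x0] h_def by (simp add: algebra_simps)
    have x\<nu>: "x \<bullet> \<nu> = a \<bullet> \<nu> + h \<bullet> \<nu>" "y \<bullet> \<nu> = b \<bullet> \<nu> + k \<bullet> \<nu>" by (simp_all add: h_def k_def inner_diff_left)
    have 4: "\<psi> x = \<psi> a + (2 * B * (a \<bullet> \<nu>) - 2 * K) * (h \<bullet> \<nu>) + B * (h \<bullet> \<nu>)\<^sup>2"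
      "\<psi> y = \<psi> b + (2 * B * (b \<bullet> \<nu>) - 2 * K) * (k \<bullet> \<nu>) + B * (k \<bullet> \<nu>)\<^sup>2"
      unfolding \<psi>_def x\<nu> by (simp_all add: power2_eq_square algebra_simps)
    have 5: "p0 \<bullet> h = s * ((a - b) \<bullet> h) + (2 * B * (a \<bullet> \<nu>) - 2 * K) * (h \<bullet> \<nu>) + 2 * \<alpha> * ((a - x0) \<bullet> h)"
      by (simp add: p0_def inner_add_left inner_commute[of \<nu>])
    have 6: "q0 \<bullet> k = (2 * B * (b \<bullet> \<nu>) - 2 * K) * (k \<bullet> \<nu>) - s * ((a - b) \<bullet> k)"
      by (simp add: q0_def inner_diff_left[of _ "s *\<^sub>R (a - b)"] inner_commute[of \<nu>])
    have 7: "quad H (h, k) = (L / r * (norm w)\<^sup>2 - M / 2 * (norm w)\<^sup>2) - L / r * (e \<bullet> w)\<^sup>2 + B * (h \<bullet> \<nu>)\<^sup>2 + B * (k \<bullet> \<nu>)\<^sup>2 + \<alpha> * (norm h)\<^sup>2"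
      unfolding H_def quad_doubling_hessian w_def by (simp only: left_diff_distrib)
    have 8: "L / r * ((a - b) \<bullet> w) - M * ((a - b) \<bullet> w) = s * ((a - b) \<bullet> h) - s * ((a - b) \<bullet> k)"
      unfolding s_def w_def inner_diff_right[of "a - b" h k] by (simp add: algebra_simps)
    show ?thesis
      using 1 2 3 4 5 6 7 8
      unfolding g_def split_conv \<omega>_def h_def[symmetric] k_def[symmetric] r_def[symmetric] by linarith
  qed
  define e1 where "e1 = min 1 (K / (4 * (1 + s + 2 * B)))"
  have e1: "0 < e1" "e1 \<le> 1" "e1 * (1 + s + 2 * B) \<le> K / 4"
  proof -
    show "0 < e1" "e1 \<le> 1" using K s B by (auto simp: e1_def intro!: divide_pos_pos)
    have "e1 * (1 + s + 2 * B) \<le> K / (4 * (1 + s + 2 * B)) * (1 + s + 2 * B)" using s B by (intro mult_right_mono) (auto simp: e1_def)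
    also have "\<dots> = K / 4" using s B by (simp add: field_simps)
    finally show "e1 * (1 + s + 2 * B) \<le> K / 4" .
  qed
  have e1': "e1 + s * e1 + 2 * B * e1 \<le> K / 4" using e1(3) by (simp add: algebra_simps)
  have hgt: "y \<bullet> \<nu> \<le> e1" if "x \<bullet> \<nu> = 0" "norm (x - y) < e1" for x y
  proof -
    have "(y - x) \<bullet> \<nu> \<le> norm (y - x) * norm \<nu>" by (rule norm_cauchy_schwarz)
    then show ?thesis using that \<nu> by (simp add: inner_diff_left norm_minus_commute)
  qed
  define \<rho> where "\<rho> = min (r / 4) (min ((r0 - r) / 2) (R - norm (a - x0)))"
  have \<rho>: "0 < \<rho>" "\<rho> \<le> r / 4" "\<rho> \<le> (r0 - r) / 2" "\<rho> \<le> R - norm (a - x0)" using r aR unfolding \<rho>_def min_def by auto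
  obtain X Y where XY: "X \<in> \<Gamma>1" "Y \<in> \<Gamma>2" "symmetric_matrix X" "symmetric_matrix Y"
    and le: "\<And>h k. h \<bullet> (X *v h) + k \<bullet> (Y *v k) \<le> 2 * quad H (h, k) + e1 * ((norm h)\<^sup>2 + (norm k)\<^sup>2)"
  proof (rule doubling_jets[OF \<nu> u1 u2 as a1 bs b1 \<rho>(1), of H p0 q0 e1])
    show "selfadjoint H" unfolding H_def by (rule selfadjoint_doubling_hessian)
    show "0 < e1" by (rule e1)
    show "u1 x + u2 y \<le> u1 a + u2 b + p0 \<bullet> (x - a) + q0 \<bullet> (y - b) + quad H (x - a, y - b)"
      if xy: "x \<in> slab \<nu>" "y \<in> slab \<nu>" "norm (x - a) \<le> \<rho>" "norm (y - b) \<le> \<rho>" for x y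
    proof -
      have d: "norm ((x - a) - (y - b)) \<le> 2 * \<rho>" using norm_triangle_ineq4[of "x - a" "y - b"] xy by linarith
      have "norm (x - x0) \<le> norm (x - a) + norm (a - x0)" using norm_triangle_ineq[of "x - a" "a - x0"] by simp
      then have "norm (x - x0) \<le> R" using xy \<rho> by linarith
      moreover have "norm (x - y) \<le> r0"
      proof -
        have "x - y = (a - b) + ((x - a) - (y - b))" by simp
        then have "norm (x - y) \<le> r + norm ((x - a) - (y - b))" using norm_triangle_ineq[of "a - b" "(x - a) - (y - b)"] by (simp add: r_def)
        then show ?thesis using d \<rho>(3) by argo
      qed
      ultimately have "(x, y) \<in> D" using xy by (simp add: D_def)
      then have "u1 x + u2 y - g (x, y) \<le> u1 a + u2 b - g (a, b)" by (rule max)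
      moreover have "g (x, y) \<le> g (a, b) + p0 \<bullet> (x - a) + q0 \<bullet> (y - b) + quad H (x - a, y - b)"
        by (rule gle) (use d \<rho> in linarith)
      ultimately show ?thesis by linarith
    qed
    show "p \<bullet> \<nu> < h1 x" if x: "x \<bullet> \<nu> = 0" "norm (x - a) < e1" and p: "p \<bullet> \<nu> < p0 \<bullet> \<nu> + e1" for x p
    proof -
      have a\<nu>: "a \<bullet> \<nu> \<le> e1" by (rule hgt[OF x])
      then have "s * ((a - b) \<bullet> \<nu>) \<le> s * e1"
        using bs s by (intro mult_left_mono) (auto simp: slab_def inner_diff_left)
      moreover have "2 * B * (a \<bullet> \<nu>) \<le> 2 * B * e1" using a\<nu> B by (intro mult_left_mono) auto
      moreover have "2 * \<alpha> * ((a - x0) \<bullet> \<nu>) \<le> K / 2"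
      proof -
        have "(\<alpha> * norm (a - x0))\<^sup>2 = \<alpha> * (\<alpha> * (norm (a - x0))\<^sup>2)" by (simp add: power2_eq_square)
        also have "\<dots> \<le> (K / 32) * (2 * K)" by (rule mult_mono) (use \<alpha> penK K in auto)
        also have "\<dots> = (K / 4)\<^sup>2" by (simp add: power2_eq_square)
        finally have "\<alpha> * norm (a - x0) \<le> K / 4" by (rule power2_le_imp_le) (use K in simp)
        moreover have "(a - x0) \<bullet> \<nu> \<le> norm (a - x0)" using norm_cauchy_schwarz[of "a - x0" \<nu>] \<nu> by simp
        then have "\<alpha> * ((a - x0) \<bullet> \<nu>) \<le> \<alpha> * norm (a - x0)" using \<alpha> by (intro mult_left_mono) auto
        ultimately show ?thesis by linarith
      qed
      moreover have "p0 \<bullet> \<nu> = s * ((a - b) \<bullet> \<nu>) + 2 * B * (a \<bullet> \<nu>) - 2 * K + 2 * \<alpha> * ((a - x0) \<bullet> \<nu>)"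
        by (simp add: p0_def inner_add_left \<nu>\<nu>)
      ultimately show ?thesis using p e1' h1[OF x(1)] K by linarith
    qed
    show "q \<bullet> \<nu> < h2 y" if y: "y \<bullet> \<nu> = 0" "norm (y - b) < e1" and q: "q \<bullet> \<nu> < q0 \<bullet> \<nu> + e1" for y q
    proof -
      have b\<nu>: "b \<bullet> \<nu> \<le> e1" by (rule hgt[OF y])
      then have "s * ((b - a) \<bullet> \<nu>) \<le> s * e1"
        using as s by (intro mult_left_mono) (auto simp: slab_def inner_diff_left)
      moreover have "2 * B * (b \<bullet> \<nu>) \<le> 2 * B * e1" using b\<nu> B by (intro mult_left_mono) auto
      moreover have "q0 \<bullet> \<nu> = s * ((b - a) \<bullet> \<nu>) + 2 * B * (b \<bullet> \<nu>) - 2 * K"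
        by (simp add: q0_def inner_diff_left \<nu>\<nu> algebra_simps)
      ultimately show ?thesis using q e1' h2[OF y(1)] K by linarith
    qed
  qed blast
  define c where "c = 4 * B + 4"
  have \<nu>h: "(h \<bullet> \<nu>)\<^sup>2 \<le> (norm h)\<^sup>2" for h
  proof -
    have "\<bar>h \<bullet> \<nu>\<bar> \<le> norm h" using Cauchy_Schwarz_ineq2[of h \<nu>] \<nu> by simp
    from power_mono[OF this, of 2] show ?thesis by simp
  qed
  have "lam * (4 * M) \<le> c * (real CARD('n) * Lam)"
  proof (rule no_common_strict[OF XY(3,1,4,2) _ _ e])
    show "0 \<le> c" using B by (simp add: c_def)
    show "h \<bullet> (X *v h) + h \<bullet> (Y *v h) \<le> c * (norm h)\<^sup>2" for h
    proof -
      have "h \<bullet> (X *v h) + h \<bullet> (Y *v h) \<le> 4 * (B * (h \<bullet> \<nu>)\<^sup>2) + 2 * (\<alpha> * (norm h)\<^sup>2) + 2 * (e1 * (norm h)\<^sup>2)"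
        using le[of h h] by (simp add: H_def quad_doubling_hessian algebra_simps)
      moreover have "B * (h \<bullet> \<nu>)\<^sup>2 \<le> B * (norm h)\<^sup>2" using \<nu>h B by (intro mult_left_mono) auto
      moreover have "\<alpha> * (norm h)\<^sup>2 \<le> 1 * (norm h)\<^sup>2" "e1 * (norm h)\<^sup>2 \<le> 1 * (norm h)\<^sup>2"
        by (rule mult_right_mono[OF \<alpha>(2)] mult_right_mono[OF e1(2)], simp)+
      moreover have "c * (norm h)\<^sup>2 = 4 * (B * (norm h)\<^sup>2) + 4 * (norm h)\<^sup>2" by (simp add: c_def algebra_simps)
      ultimately show ?thesis by linarith
    qed
    show "e \<bullet> (X *v e) + e \<bullet> (Y *v e) \<le> c - 4 * M"
    proof -
      have ee: "e \<bullet> e = 1" using e by (simp add: norm_eq_1)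
      have "quad H (e, - e) = (L / r - M / 2) * 4 - L / r * 4 + 2 * (B * (e \<bullet> \<nu>)\<^sup>2) + \<alpha>"
      proof -
        have "e - - e = 2 *\<^sub>R e" by (simp add: scaleR_2)
        then show ?thesis unfolding H_def quad_doubling_hessian using e ee by (simp add: power_mult_distrib)
      qed
      then have "quad H (e, - e) = 2 * (B * (e \<bullet> \<nu>)\<^sup>2) + \<alpha> - 2 * M" by (simp add: algebra_simps)
      moreover have "B * (e \<bullet> \<nu>)\<^sup>2 \<le> B * 1" using \<nu>h[of e] B e by (intro mult_left_mono) auto
      moreover have "e \<bullet> (X *v e) + e \<bullet> (Y *v e) \<le> 2 * quad H (e, - e) + 2 * e1"
      proof -
        have "(- e) \<bullet> (Y *v (- e)) = e \<bullet> (Y *v e)"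
          using matrix_vector_mult_scaleR[of Y "-1" e] by simp
        then show ?thesis using le[of e "- e"] e by simp
      qed
      ultimately show ?thesis using \<alpha> e1 unfolding c_def by linarith
    qed
  qed
  moreover have "4 * M = 16 * K / r0\<^sup>2" by (simp add: M_def)
  ultimately show False using large unfolding c_def B_def by simp
qed

text \<open>
  The constant \<open>L\<close> depends on the pair only through its ellipticity constants, and on the data only through \<open>K\<close>. It
  therefore serves for all \<open>\<epsilon>\<close> at once.
\<close>
lemma equicontinuity_at_bottom:
  assumes \<nu>: "norm \<nu> = 1" and K: "0 < K" and \<delta>: "0 < \<delta>"
  shows "\<exists>L\<ge>0. \<forall>u1 u2 h1 h2.
     jet_subsolution \<Gamma>1 \<nu> h1 u1 \<and> jet_subsolution \<Gamma>2 \<nu> h2 u2 \<and>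
     (\<forall>x. x \<bullet> \<nu> = 0 \<longrightarrow> - K \<le> h1 x \<and> - K \<le> h2 x) \<and>
     (\<forall>x\<in>slab \<nu>. u1 x \<le> K * (1 - x \<bullet> \<nu>) \<and> u2 x \<le> K * (1 - x \<bullet> \<nu>) \<and> u1 x + u2 x \<le> 0) \<longrightarrow>
     (\<forall>x y. x \<bullet> \<nu> = 0 \<longrightarrow> y \<bullet> \<nu> = 0 \<longrightarrow> u1 x + u2 y \<le> L * norm (x - y) + \<delta>)"
proof -
  define c where "c = (4 * (K\<^sup>2 / (\<delta> / 2)) + 4) * (real CARD('n) * Lam)"
  have c: "0 < c" using K \<delta> lam by (simp add: c_def add_pos_pos)
  define r0 where "r0 = min 1 (lam * K / c)"
  have r0: "0 < r0" "r0 \<le> 1" using lam K c by (auto simp: r0_def)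
  have "c < lam * (16 * K / r0\<^sup>2)"
  proof -
    have "r0\<^sup>2 \<le> r0" using r0 by (simp add: power2_eq_square mult_left_le)
    also have "\<dots> \<le> lam * K / c" by (simp add: r0_def)
    finally have "c * r0\<^sup>2 \<le> lam * K" using c by (simp add: field_simps)
    also have "\<dots> < lam * (16 * K)" using lam K by simp
    finally show ?thesis using r0 by (simp add: field_simps)
  qed
  note large = this[unfolded c_def]
  show ?thesis
  proof (intro exI[of _ "4 * K / r0"] conjI allI impI)
    show "0 \<le> 4 * K / r0" using K r0 by simp
    fix u1 u2 h1 h2 x y
    assume A: "jet_subsolution \<Gamma>1 \<nu> h1 u1 \<and> jet_subsolution \<Gamma>2 \<nu> h2 u2 \<and>
     (\<forall>x. x \<bullet> \<nu> = 0 \<longrightarrow> - K \<le> h1 x \<and> - K \<le> h2 x) \<and>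
     (\<forall>x\<in>slab \<nu>. u1 x \<le> K * (1 - x \<bullet> \<nu>) \<and> u2 x \<le> K * (1 - x \<bullet> \<nu>) \<and> u1 x + u2 x \<le> 0)"
      and xy: "x \<bullet> \<nu> = 0" "y \<bullet> \<nu> = 0"
    have "u1 x + u2 y \<le> 4 * K / r0 * norm (x - y) + 2 * (\<delta> / 2)"
      by (rule ishii_lions[OF \<nu> _ _ K _ _ _ _ _ _ r0 large xy, of h1 u1 h2 u2]) (use A \<delta> in auto)
    then show "u1 x + u2 y \<le> 4 * K / r0 * norm (x - y) + \<delta>" by simp
  qed
qed

end

section \<open>Linear barriers and glued subsolutions\<close>

text \<open>
  Adding the touching inequality at \<open>x + t v\<close> and at \<open>x - t v\<close> cancels the first-order terms.
\<close>
lemma psd_of_touching_affine: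
  assumes sj: "superjet D u x p X" and d: "0 < d" "ball x d \<subseteq> D"
    and ge: "\<And>y. y \<in> ball x d \<Longrightarrow> c + b \<bullet> y \<le> u y" and eq: "u x = c + b \<bullet> x"
  shows "0 \<le> v \<bullet> (X *v v)"
proof -
  obtain r where X: "symmetric_matrix X" and r: "0 < r"
    and le: "\<And>y. y \<in> D \<inter> ball x r \<Longrightarrow> u y \<le> u x + p \<bullet> (y - x) + quad ((*v) X) (y - x)"
    using sj unfolding superjet_def by blast
  define t where "t = min d r / (2 * (norm v + 1))"
  have nv: "0 < norm v + 1" using norm_ge_zero[of v] by linarith
  have t: "0 < t" using d r nv by (simp add: t_def)
  have tv: "t * norm v < min d r"
  proof -
    have "t * norm v \<le> t * (norm v + 1)" using t by (intro mult_left_mono) auto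
    also have "\<dots> = min d r / 2"
    proof -
      have "a / (2 * b) * b = a / 2" if "0 < b" for a b :: real using that by simp
      then show ?thesis unfolding t_def using nv by blast
    qed
    also have "\<dots> < min d r" using d r by (simp add: min_def)
    finally show ?thesis .
  qed
  have one: "t * (b \<bullet> w) \<le> t * (p \<bullet> w) + t\<^sup>2 * quad ((*v) X) w" if w: "norm w = norm v" for w
  proof -
    have "dist x (x + t *\<^sub>R w) < min d r" using tv t w by (simp add: dist_norm)
    then have "x + t *\<^sub>R w \<in> ball x d" "x + t *\<^sub>R w \<in> ball x r" by auto
    then have "c + b \<bullet> (x + t *\<^sub>R w) \<le> u (x + t *\<^sub>R w)" "u (x + t *\<^sub>R w) \<le> u x + p \<bullet> (t *\<^sub>R w) + quad ((*v) X) (t *\<^sub>R w)"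
      using ge[of "x + t *\<^sub>R w"] le[of "x + t *\<^sub>R w"] d(2) by auto
    then show ?thesis using eq by (simp add: inner_add_right quad_scaleR[OF selfadjoint_matrix[OF X]])
  qed
  have "quad ((*v) X) (- v) = quad ((*v) X) v" using quad_scaleR[OF selfadjoint_matrix[OF X], of "-1" v] by simp
  then have "0 \<le> 2 * (t\<^sup>2 * quad ((*v) X) v)" using one[of v] one[of "- v"] by simp
  then have "0 \<le> quad ((*v) X) v" using t by (simp add: zero_le_mult_iff)
  then show ?thesis by (simp add: quad_def)
qed

lemma ball_subset_slab:
  assumes \<nu>: "norm \<nu> = 1" and x: "0 < x \<bullet> \<nu>" "x \<bullet> \<nu> < 1"
  shows "ball x (min (x \<bullet> \<nu>) (1 - x \<bullet> \<nu>)) \<subseteq> slab \<nu>"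
proof
  fix y assume y: "y \<in> ball x (min (x \<bullet> \<nu>) (1 - x \<bullet> \<nu>))"
  have "\<bar>(y - x) \<bullet> \<nu>\<bar> \<le> norm (y - x) * norm \<nu>" by (rule Cauchy_Schwarz_ineq2)
  then show "y \<in> slab \<nu>"
    using y \<nu> by (auto simp: slab_def dist_norm norm_minus_commute inner_diff_left abs_le_iff)
qed

lemma usc_onI:
  fixes u :: "real^'n \<Rightarrow> real"
  assumes "\<And>x e. x \<in> D \<Longrightarrow> 0 < e \<Longrightarrow> \<exists>d>0. \<forall>y\<in>D. dist y x < d \<longrightarrow> u y < u x + e"
  shows "usc_on D u"
  unfolding usc_on_def openin_euclidean_subtopology_iff
proof (intro allI conjI ballI)
  fix t x assume x: "x \<in> {x \<in> D. u x < t}"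
  then obtain d where "0 < d" "\<forall>y\<in>D. dist y x < d \<longrightarrow> u y < u x + (t - u x)"
    using assms[of x "t - u x"] by auto
  then show "\<exists>d>0. \<forall>y\<in>D. dist y x < d \<longrightarrow> y \<in> {x \<in> D. u x < t}" by auto
qed auto

lemma affine_continuous_near:
  assumes e: "0 < e"
  obtains d where "0 < d" "\<And>y. dist y x < d \<Longrightarrow> s * (1 - y \<bullet> \<nu>) < s * (1 - x \<bullet> \<nu>) + e"
proof -
  have "isCont (\<lambda>y. s * (1 - y \<bullet> \<nu>)) x" by (intro continuous_intros)
  then obtain d where d: "0 < d" "\<And>y. dist y x < d \<Longrightarrow> dist (s * (1 - y \<bullet> \<nu>)) (s * (1 - x \<bullet> \<nu>)) < e"
    using e unfolding continuous_at_eps_delta by metis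
  show thesis
  proof (rule that[OF d(1)])
    fix y assume "dist y x < d"
    from d(2)[OF this] show "s * (1 - y \<bullet> \<nu>) < s * (1 - x \<bullet> \<nu>) + e" unfolding dist_real_def by linarith
  qed
qed

text \<open>
  Superjets in the interior are positive semidefinite; those at the bottom need not be, but their normal slope is at least that
  of the linear function.
\<close>
lemma jet_subsolution_linear:
  fixes \<nu> :: "real^'n"
  assumes \<nu>: "norm \<nu> = 1" and psd: "\<And>X. symmetric_matrix X \<Longrightarrow> (\<And>x. 0 \<le> x \<bullet> (X *v x)) \<Longrightarrow> X \<in> \<Gamma>"
  shows "jet_subsolution \<Gamma> \<nu> (\<lambda>_. - s) (\<lambda>x. s * (1 - x \<bullet> \<nu>))"
  unfolding jet_subsolution_def
proof (intro conjI allI impI)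
  show "usc_on (slab \<nu>) (\<lambda>x. s * (1 - x \<bullet> \<nu>))"
  proof (rule usc_onI)
    fix x e :: real and z :: "real^'n" assume e: "0 < e"
    obtain d where "0 < d" "\<And>y. dist y z < d \<Longrightarrow> s * (1 - y \<bullet> \<nu>) < s * (1 - z \<bullet> \<nu>) + e"
      by (rule affine_continuous_near[OF e]) (rule that; assumption)
    then show "\<exists>d>0. \<forall>y\<in>slab \<nu>. dist y z < d \<longrightarrow> s * (1 - y \<bullet> \<nu>) < s * (1 - z \<bullet> \<nu>) + e" by blast
  qed
  show "s * (1 - x \<bullet> \<nu>) \<le> 0" if "x \<bullet> \<nu> = 1" for x using that by simp
  fix x p X assume sj: "superjet (slab \<nu>) (\<lambda>x. s * (1 - x \<bullet> \<nu>)) x p X" and x1: "x \<bullet> \<nu> < 1"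
  have \<nu>\<nu>: "\<nu> \<bullet> \<nu> = 1" using \<nu> by (simp add: norm_eq_1)
  obtain r where xs: "x \<in> slab \<nu>" and X: "symmetric_matrix X" and r: "0 < r"
    and le: "\<And>y. y \<in> slab \<nu> \<inter> ball x r \<Longrightarrow> s * (1 - y \<bullet> \<nu>) \<le> s * (1 - x \<bullet> \<nu>) + p \<bullet> (y - x) + quad ((*v) X) (y - x)"
    using sj unfolding superjet_def by blast
  show "X \<in> \<Gamma> \<or> x \<bullet> \<nu> = 0 \<and> - s \<le> p \<bullet> \<nu>"
  proof (cases "x \<bullet> \<nu> = 0")
    case True
    have "- s \<le> p \<bullet> \<nu> + t * quad ((*v) X) \<nu>" if t: "0 < t" "t < min r 1" for t
    proof -
      have "x + t *\<^sub>R \<nu> \<in> slab \<nu> \<inter> ball x r" using t True \<nu> \<nu>\<nu> by (auto simp: slab_def inner_add_left dist_norm)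
      from le[OF this] have "t * (- s) \<le> t * (p \<bullet> \<nu> + t * quad ((*v) X) \<nu>)"
        using True \<nu>\<nu> by (simp add: inner_add_left quad_scaleR[OF selfadjoint_matrix[OF X]] power2_eq_square algebra_simps)
      then show ?thesis using t by (simp only: mult_le_cancel_left_pos)
    qed
    then have "\<forall>\<^sub>F t in at_right 0. - s \<le> p \<bullet> \<nu> + t * quad ((*v) X) \<nu>"
      using r unfolding eventually_at_right_field by (intro exI[of _ "min r 1"]) auto
    moreover have "((\<lambda>t. p \<bullet> \<nu> + t * quad ((*v) X) \<nu>) \<longlongrightarrow> p \<bullet> \<nu> + 0 * quad ((*v) X) \<nu>) (at_right 0)"
      by (intro tendsto_intros)
    ultimately have "- s \<le> p \<bullet> \<nu> + 0 * quad ((*v) X) \<nu>" by (intro tendsto_lowerbound) auto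
    then show ?thesis using True by simp
  next
    case False
    then have x0: "0 < x \<bullet> \<nu>" using xs by (simp add: slab_def)
    have "0 \<le> v \<bullet> (X *v v)" for v
      by (rule psd_of_touching_affine[OF sj _ ball_subset_slab[OF \<nu> x0 x1], where c = s and b = "(- s) *\<^sub>R \<nu>"])
         (use x0 x1 in \<open>auto simp: algebra_simps inner_commute\<close>)
    then show ?thesis using psd[OF X] by blast
  qed
qed

lemma jet_subsolution_translate:
  assumes u: "jet_subsolution \<Gamma> \<nu> h u" and \<tau>: "\<tau> \<bullet> \<nu> = 0"
  shows "jet_subsolution \<Gamma> \<nu> (\<lambda>x. h (x + \<tau>)) (\<lambda>x. u (x + \<tau>))"
proof -
  have sl: "(\<lambda>x. x - \<tau>) ` slab \<nu> = slab \<nu>"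
  proof
    show "(\<lambda>x. x - \<tau>) ` slab \<nu> \<subseteq> slab \<nu>" using \<tau> by (auto simp: slab_def inner_diff_left)
    show "slab \<nu> \<subseteq> (\<lambda>x. x - \<tau>) ` slab \<nu>"
    proof
      fix x assume "x \<in> slab \<nu>"
      then have "x + \<tau> \<in> slab \<nu>" using \<tau> by (simp add: slab_def inner_add_left)
      then show "x \<in> (\<lambda>x. x - \<tau>) ` slab \<nu>" by (rule rev_image_eqI) simp
    qed
  qed
  show ?thesis
    unfolding jet_subsolution_def
  proof (intro conjI allI impI)
    have "usc_on (slab \<nu>) u" using u by (simp add: jet_subsolution_def)
    from usc_on_translate[OF this, of \<tau> 0 0] show "usc_on (slab \<nu>) (\<lambda>x. u (x + \<tau>))" by (simp add: sl)
    show "u (x + \<tau>) \<le> 0" if "x \<bullet> \<nu> = 1" for x using u that \<tau> by (simp add: jet_subsolution_def inner_add_left)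
    fix x p X assume sj: "superjet (slab \<nu>) (\<lambda>x. u (x + \<tau>)) x p X" and x1: "x \<bullet> \<nu> < 1"
    have "superjet (slab \<nu>) u (x + \<tau>) (p + 0) X"
      by (rule superjet_translate[where c = 0]) (use sj in \<open>simp add: sl\<close>)
    moreover have "(x + \<tau>) \<bullet> \<nu> = x \<bullet> \<nu>" using \<tau> by (simp add: inner_add_left)
    ultimately show "X \<in> \<Gamma> \<or> x \<bullet> \<nu> = 0 \<and> h (x + \<tau>) \<le> p \<bullet> \<nu>"
      using u x1 unfolding jet_subsolution_def by (metis add_0_right)
  qed
qed

context elliptic_pair begin

text \<open>
  Comparison with the linear function of slope \<open>- K\<close>, which has the constant Neumann data \<open>- K\<close>.
\<close>
lemma linear_barrier:
  assumes \<nu>: "norm \<nu> = 1" and u: "jet_subsolution \<Gamma>1 \<nu> h u" and bd: "\<And>x. x \<in> slab \<nu> \<Longrightarrow> u x \<le> B"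
    and h: "\<And>x. x \<bullet> \<nu> = 0 \<Longrightarrow> - K \<le> h x" and x: "x \<in> slab \<nu>"
  shows "u x \<le> K * (1 - x \<bullet> \<nu>)"
proof -
  have lin: "jet_subsolution \<Gamma>2 \<nu> (\<lambda>_. - (- K)) (\<lambda>x. (- K) * (1 - x \<bullet> \<nu>))"
    by (rule jet_subsolution_linear[OF \<nu> psd2])
  have "(- K) * (1 - y \<bullet> \<nu>) \<le> \<bar>K\<bar>" if "y \<in> slab \<nu>" for y
  proof -
    have "\<bar>(- K) * (1 - y \<bullet> \<nu>)\<bar> \<le> \<bar>K\<bar> * 1" unfolding abs_mult using that by (intro mult_mono) (auto simp: slab_def)
    then show ?thesis by simp
  qed
  then have "u x + (- K) * (1 - x \<bullet> \<nu>) \<le> 0 * (1 - x \<bullet> \<nu>)"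
  proof (intro comparison[OF \<nu> u lin, of "max B \<bar>K\<bar>"])
    show "- 0 \<le> h x + - (- K)" if "x \<bullet> \<nu> = 0" for x using h[OF that] by simp
  qed (use bd x in \<open>auto intro: max.coboundedI1 max.coboundedI2 exI[of _ 1]\<close>)
  then show ?thesis by simp
qed

text \<open>
  The constant added to the rescaled function is such that this function exceeds the linear one by at least \<open>\<theta> \<eta>\<close> on
  the bottom and stays below it by at least \<open>\<theta> \<eta>\<close> at height \<open>\<theta>\<close>. Hence a superjet at the bottom is a superjet of the rescaled function, and
  the gluing at height \<open>\<theta>\<close> neither destroys semicontinuity nor creates superjets.
\<close>
lemma glued_subsolution:
  assumes \<nu>: "norm \<nu> = 1" and u: "jet_subsolution \<Gamma>1 \<nu> h u" and \<theta>: "0 < \<theta>" "\<theta> < 1" and \<eta>: "0 < \<eta>"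
    and m: "\<And>x. x \<bullet> \<nu> = 0 \<Longrightarrow> m \<le> u x"
  defines "s \<equiv> m - 2 * \<eta>"
  shows "jet_subsolution \<Gamma>1 \<nu> (\<lambda>x. h (x /\<^sub>R \<theta>))
    (\<lambda>x. if x \<bullet> \<nu> < \<theta> then max (\<theta> * u (x /\<^sub>R \<theta>) + (s * (1 - \<theta>) - \<theta> * \<eta>)) (s * (1 - x \<bullet> \<nu>)) else s * (1 - x \<bullet> \<nu>))"
    (is "jet_subsolution _ _ _ ?z")
proof -
  define c where "c = s * (1 - \<theta>) - \<theta> * \<eta>"
  define v where "v = (\<lambda>x. \<theta> * u (x /\<^sub>R \<theta>) + c)"
  define l where "l = (\<lambda>x. s * (1 - x \<bullet> \<nu>))"
  define z where "z = (\<lambda>x. if x \<bullet> \<nu> < \<theta> then max (v x) (l x) else l x)"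
  have zeq: "?z = z" unfolding z_def v_def l_def c_def by (rule refl)
  have lz: "l x \<le> z x" for x by (simp add: z_def)
  have usc: "usc_on (slab \<nu>) u" using u by (simp add: jet_subsolution_def)
  have scale: "x /\<^sub>R \<theta> \<in> slab \<nu>" if "x \<in> slab \<nu>" "x \<bullet> \<nu> \<le> \<theta>" for x
    using that \<theta> by (simp add: slab_def field_simps)
  have v_usc: "\<exists>d>0. \<forall>y\<in>slab \<nu>. y \<bullet> \<nu> \<le> \<theta> \<longrightarrow> dist y x < d \<longrightarrow> v y < v x + e"
    if x: "x \<in> slab \<nu>" "x \<bullet> \<nu> \<le> \<theta>" and e: "0 < e" for x e
  proof -
    have e': "0 < e / \<theta>" using e \<theta> by simp
    obtain d where d: "0 < d" "\<And>y. y \<in> slab \<nu> \<Longrightarrow> dist y (x /\<^sub>R \<theta>) < d \<Longrightarrow> u y < u (x /\<^sub>R \<theta>) + e / \<theta>"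
      by (rule usc_onD[OF usc scale[OF x] e']) (rule that; assumption)
    have "v y < v x + e" if y: "y \<in> slab \<nu>" "y \<bullet> \<nu> \<le> \<theta>" "dist y x < \<theta> * d" for y
    proof -
      have "dist (y /\<^sub>R \<theta>) (x /\<^sub>R \<theta>) = dist y x / \<theta>"
        using \<theta> by (simp add: dist_norm divide_inverse mult.commute flip: scaleR_diff_right)
      also have "\<dots> < d" using y(3) \<theta> by (simp add: field_simps)
      finally have "u (y /\<^sub>R \<theta>) < u (x /\<^sub>R \<theta>) + e / \<theta>" using d(2)[OF scale[OF y(1,2)]] by blast
      then have "\<theta> * u (y /\<^sub>R \<theta>) < \<theta> * (u (x /\<^sub>R \<theta>) + e / \<theta>)" using \<theta> by (simp only: mult_less_cancel_left_pos)
      then show ?thesis using \<theta> by (simp add: v_def distrib_left)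
    qed
    then show ?thesis using d \<theta> by (intro exI[of _ "\<theta> * d"]) auto
  qed
  have close\<nu>: "\<bar>y \<bullet> \<nu> - x \<bullet> \<nu>\<bar> \<le> dist y x" for x y
    using Cauchy_Schwarz_ineq2[of "y - x" \<nu>] \<nu> by (simp add: dist_norm inner_diff_left)
  have "jet_subsolution \<Gamma>1 \<nu> (\<lambda>x. h (x /\<^sub>R \<theta>)) z"
    unfolding jet_subsolution_def
  proof (intro conjI allI impI)
    show "usc_on (slab \<nu>) z"
    proof (rule usc_onI)
      fix x and e :: real assume x: "x \<in> slab \<nu>" and e: "0 < e"
      obtain d1 where d1_pos: "0 < d1" and "\<And>y. dist y x < d1 \<Longrightarrow> s * (1 - y \<bullet> \<nu>) < s * (1 - x \<bullet> \<nu>) + e"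
        by (rule affine_continuous_near[OF e, of x s \<nu>]) (rule that; assumption)
      then have "\<And>y. dist y x < d1 \<Longrightarrow> l y < l x + e" by (simp add: l_def)
      note d1 = d1_pos this
      show "\<exists>d>0. \<forall>y\<in>slab \<nu>. dist y x < d \<longrightarrow> z y < z x + e"
      proof (cases "x \<bullet> \<nu> \<le> \<theta>")
        case False
        have "z y < z x + e" if "y \<in> slab \<nu>" "dist y x < min d1 (x \<bullet> \<nu> - \<theta>)" for y
        proof -
          have "\<theta> < y \<bullet> \<nu>" using close\<nu>[of y x] that(2) unfolding abs_le_iff min_less_iff_conj by linarith
          then show ?thesis using d1(2)[of y] that(2) False by (simp add: z_def)
        qed
        then show ?thesis using d1 False by (intro exI[of _ "min d1 (x \<bullet> \<nu> - \<theta>)"]) auto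
      next
        case True
        define e2 where "e2 = min e (\<theta> * \<eta>)"
        have e2: "0 < e2" using e \<theta> \<eta> by (simp add: e2_def)
        obtain d2 where d2: "0 < d2" "\<And>y. y \<in> slab \<nu> \<Longrightarrow> y \<bullet> \<nu> \<le> \<theta> \<Longrightarrow> dist y x < d2 \<Longrightarrow> v y < v x + e2"
          using v_usc[OF x True e2] by blast
        have vz: "v x + e2 \<le> z x + e"
        proof (cases "x \<bullet> \<nu> < \<theta>")
          case True
          then show ?thesis by (simp add: z_def e2_def)
        next
          case False
          then have "x \<bullet> \<nu> = \<theta>" using True by simp
          moreover from this have "(x /\<^sub>R \<theta>) \<bullet> \<nu> = 1" using \<theta> by simp
          then have "u (x /\<^sub>R \<theta>) \<le> 0" using u unfolding jet_subsolution_def by blast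
          then have "v x \<le> c" using \<theta> by (simp add: v_def mult_le_0_iff)
          moreover have "e2 \<le> \<theta> * \<eta>" by (simp add: e2_def)
          ultimately show ?thesis using e by (simp add: z_def l_def c_def)
        qed
        have "z y < z x + e" if y: "y \<in> slab \<nu>" "dist y x < min d1 d2" for y
        proof -
          have "l y < z x + e" using d1(2)[of y] y lz[of x] by simp
          moreover have "v y < z x + e" if "y \<bullet> \<nu> < \<theta>" using d2(2)[of y] y vz that by simp
          ultimately show ?thesis by (simp add: z_def)
        qed
        then show ?thesis using d1 d2 by (intro exI[of _ "min d1 d2"]) auto
      qed
    qed
    show "z x \<le> 0" if "x \<bullet> \<nu> = 1" for x using that \<theta> by (simp add: z_def l_def)
    fix x p X assume sj: "superjet (slab \<nu>) z x p X" and x1: "x \<bullet> \<nu> < 1"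
    obtain r where xs: "x \<in> slab \<nu>" and X: "symmetric_matrix X" and r: "0 < r"
      and le: "\<And>y. y \<in> slab \<nu> \<inter> ball x r \<Longrightarrow> z y \<le> z x + p \<bullet> (y - x) + quad ((*v) X) (y - x)"
      using sj unfolding superjet_def by blast
    show "X \<in> \<Gamma>1 \<or> x \<bullet> \<nu> = 0 \<and> h (x /\<^sub>R \<theta>) \<le> p \<bullet> \<nu>"
    proof (cases "x \<bullet> \<nu> < \<theta> \<and> l x \<le> v x")
      case True
      then have zx: "z x = v x" by (simp add: z_def)
      define \<rho> where "\<rho> = min (r / \<theta>) ((\<theta> - x \<bullet> \<nu>) / \<theta>)"
      have \<rho>: "0 < \<rho>" using r \<theta> True by (simp add: \<rho>_def)
      have "superjet (slab \<nu>) u (x /\<^sub>R \<theta>) p (\<theta> *\<^sub>R X)"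
        unfolding superjet_def
      proof (intro conjI exI[of _ \<rho>] ballI \<rho>)
        show "x /\<^sub>R \<theta> \<in> slab \<nu>" using scale[OF xs] True by simp
        show "symmetric_matrix (\<theta> *\<^sub>R X)" by (rule symmetric_matrix_scaleR[OF X])
        fix y assume y: "y \<in> slab \<nu> \<inter> ball (x /\<^sub>R \<theta>) \<rho>"
        define y' where "y' = \<theta> *\<^sub>R y"
        have yy': "y = y' /\<^sub>R \<theta>" using \<theta> by (simp add: y'_def)
        have diff: "y' - x = \<theta> *\<^sub>R (y - x /\<^sub>R \<theta>)" using \<theta> by (simp add: y'_def scaleR_diff_right)
        then have "dist y' x = \<theta> * dist y (x /\<^sub>R \<theta>)" using \<theta> by (simp add: dist_norm)
        also have "\<dots> < \<theta> * \<rho>" using y \<theta> by (simp add: dist_commute)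
        finally have dy: "dist y' x < \<theta> * \<rho>" .
        have "\<theta> * \<rho> \<le> r" "\<theta> * \<rho> \<le> \<theta> - x \<bullet> \<nu>" using \<theta> by (auto simp: \<rho>_def min_mult_distrib_left)
        then have d': "dist y' x < r" "y' \<bullet> \<nu> < \<theta>" using dy close\<nu>[of y' x] by linarith+
        have "0 \<le> \<theta> * (y \<bullet> \<nu>)" using y \<theta> by (simp add: slab_def)
        moreover have "\<theta> * (y \<bullet> \<nu>) \<le> 1 * 1" by (rule mult_mono) (use y \<theta> in \<open>auto simp: slab_def\<close>)
        ultimately have "y' \<in> slab \<nu>" by (simp add: y'_def slab_def)
        then have "z y' \<le> z x + p \<bullet> (y' - x) + quad ((*v) X) (y' - x)" using le[of y'] d' by (simp add: dist_commute)
        moreover have "v y' \<le> z y'" using d' by (simp add: z_def)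
        ultimately have "v y' \<le> v x + p \<bullet> (y' - x) + quad ((*v) X) (y' - x)" using zx by simp
        then have "\<theta> * u y \<le> \<theta> * u (x /\<^sub>R \<theta>) + \<theta> * (p \<bullet> (y - x /\<^sub>R \<theta>)) + \<theta>\<^sup>2 * quad ((*v) X) (y - x /\<^sub>R \<theta>)"
          unfolding v_def yy'[symmetric] diff quad_scaleR[OF selfadjoint_matrix[OF X]] by simp
        also have "\<theta>\<^sup>2 * quad ((*v) X) (y - x /\<^sub>R \<theta>) = \<theta> * quad ((*v) (\<theta> *\<^sub>R X)) (y - x /\<^sub>R \<theta>)"
          unfolding quad_def by (simp add: power2_eq_square scaleR_matrix_vector_assoc[symmetric])
        finally have "\<theta> * u y \<le> \<theta> * (u (x /\<^sub>R \<theta>) + p \<bullet> (y - x /\<^sub>R \<theta>) + quad ((*v) (\<theta> *\<^sub>R X)) (y - x /\<^sub>R \<theta>))"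
          by (simp only: distrib_left)
        then show "u y \<le> u (x /\<^sub>R \<theta>) + p \<bullet> (y - x /\<^sub>R \<theta>) + quad ((*v) (\<theta> *\<^sub>R X)) (y - x /\<^sub>R \<theta>)"
          using \<theta> by (simp only: mult_le_cancel_left_pos)
      qed
      moreover have "(x /\<^sub>R \<theta>) \<bullet> \<nu> < 1" using True \<theta> by (simp add: field_simps)
      ultimately have "\<theta> *\<^sub>R X \<in> \<Gamma>1 \<or> (x /\<^sub>R \<theta>) \<bullet> \<nu> = 0 \<and> h (x /\<^sub>R \<theta>) \<le> p \<bullet> \<nu>"
        using u unfolding jet_subsolution_def by blast
      moreover have "X \<in> \<Gamma>1" if "\<theta> *\<^sub>R X \<in> \<Gamma>1"
        using cone1[OF symmetric_matrix_scaleR[OF X, of \<theta>] that, of "1 / \<theta>"] \<theta> by simp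
      ultimately show ?thesis using \<theta> by auto
    next
      case False
      have zx: "z x = l x" using False by (auto simp: z_def max_def)
      have "x \<bullet> \<nu> \<noteq> 0"
      proof
        assume x0: "x \<bullet> \<nu> = 0"
        then have "(x /\<^sub>R \<theta>) \<bullet> \<nu> = 0" by simp
        then have "\<theta> * m \<le> \<theta> * u (x /\<^sub>R \<theta>)" using m \<theta> by (intro mult_left_mono) auto
        moreover have "\<theta> * m + c = s + \<theta> * \<eta>" by (simp add: c_def s_def algebra_simps)
        moreover have "0 < \<theta> * \<eta>" using \<theta> \<eta> by simp
        ultimately have "l x \<le> v x" using x0 by (simp add: l_def v_def)
        then show False using False x0 \<theta> by simp
      qed
      then have x0: "0 < x \<bullet> \<nu>" using xs by (simp add: slab_def)
      have "0 \<le> w \<bullet> (X *v w)" for w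
      proof (rule psd_of_touching_affine[OF sj _ ball_subset_slab[OF \<nu> x0 x1], where c = s and b = "(- s) *\<^sub>R \<nu>"])
        show "0 < min (x \<bullet> \<nu>) (1 - x \<bullet> \<nu>)" using x0 x1 by simp
        show "s + (- s) *\<^sub>R \<nu> \<bullet> y \<le> z y" for y using lz[of y] by (simp add: l_def algebra_simps inner_commute)
        show "z x = s + (- s) *\<^sub>R \<nu> \<bullet> x" using zx by (simp add: l_def algebra_simps inner_commute)
      qed
      then show ?thesis using psd1[OF X] by blast
    qed
  qed
  then show ?thesis unfolding zeq .
qed

text \<open>
  Compare the glued subsolution, whose Neumann data oscillate on the finer scale, with the negative of \<open>w\<close>. As
  \<open>\<eta>\<close> tends to \<open>0\<close>, the values of the glued function on the bottom become at least \<open>m\<close>.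
\<close>
lemma bottom_infimum_monotone:
  assumes \<nu>: "norm \<nu> = 1" and u: "jet_subsolution \<Gamma>1 \<nu> h u" and w: "jet_subsolution \<Gamma>2 \<nu> h2 w"
    and \<theta>: "0 < \<theta>" "\<theta> < 1" and h: "\<And>x. x \<bullet> \<nu> = 0 \<Longrightarrow> 0 \<le> h (x /\<^sub>R \<theta>) + h2 x"
    and uc: "\<And>e. 0 < e \<Longrightarrow> \<exists>d>0. \<forall>x y. x \<bullet> \<nu> = 0 \<longrightarrow> y \<bullet> \<nu> = 0 \<longrightarrow> norm (x - y) < d \<longrightarrow> \<bar>h2 x - h2 y\<bar> < e"
    and bd: "\<And>x. x \<in> slab \<nu> \<Longrightarrow> u x \<le> B" "\<And>x. x \<in> slab \<nu> \<Longrightarrow> w x \<le> B"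
    and m: "\<And>x. x \<bullet> \<nu> = 0 \<Longrightarrow> m \<le> u x" and x: "x \<bullet> \<nu> = 0"
  shows "m + w x \<le> 0"
proof (rule field_le_epsilon)
  fix e :: real assume "0 < e"
  define \<eta> where "\<eta> = e / 2"
  have \<eta>: "0 < \<eta>" using \<open>0 < e\<close> by (simp add: \<eta>_def)
  define s where "s = m - 2 * \<eta>"
  define z where "z = (\<lambda>x. if x \<bullet> \<nu> < \<theta> then max (\<theta> * u (x /\<^sub>R \<theta>) + (s * (1 - \<theta>) - \<theta> * \<eta>)) (s * (1 - x \<bullet> \<nu>)) else s * (1 - x \<bullet> \<nu>))"
  have z: "jet_subsolution \<Gamma>1 \<nu> (\<lambda>x. h (x /\<^sub>R \<theta>)) z"
    unfolding z_def s_def by (rule glued_subsolution[OF \<nu> u \<theta> \<eta> m])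
  define B' where "B' = \<bar>B\<bar> + \<bar>s\<bar>"
  have lb: "s * (1 - y \<bullet> \<nu>) \<le> \<bar>s\<bar>" if "y \<in> slab \<nu>" for y
  proof -
    have "\<bar>s * (1 - y \<bullet> \<nu>)\<bar> \<le> \<bar>s\<bar> * 1" unfolding abs_mult using that by (intro mult_mono) (auto simp: slab_def)
    then show ?thesis by simp
  qed
  have zb: "z y \<le> B'" if y: "y \<in> slab \<nu>" for y
  proof -
    have "\<theta> * u (y /\<^sub>R \<theta>) + (s * (1 - \<theta>) - \<theta> * \<eta>) \<le> B'" if "y \<bullet> \<nu> < \<theta>"
    proof -
      have "y /\<^sub>R \<theta> \<in> slab \<nu>" using y that \<theta> by (simp add: slab_def field_simps)
      then have "u (y /\<^sub>R \<theta>) \<le> \<bar>B\<bar>" using bd(1) abs_ge_self order_trans by blast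
      then have "\<theta> * u (y /\<^sub>R \<theta>) \<le> \<theta> * \<bar>B\<bar>" using \<theta> by (intro mult_left_mono) auto
      also have "\<dots> \<le> 1 * \<bar>B\<bar>" using \<theta> by (intro mult_right_mono) auto
      finally have "\<theta> * u (y /\<^sub>R \<theta>) \<le> \<bar>B\<bar>" by simp
      moreover have "\<bar>s * (1 - \<theta>)\<bar> \<le> \<bar>s\<bar> * 1" unfolding abs_mult using \<theta> by (intro mult_mono) auto
      moreover have "0 \<le> \<theta> * \<eta>" using \<theta> \<eta> by simp
      ultimately show ?thesis unfolding B'_def by linarith
    qed
    then show ?thesis using lb[OF y] by (auto simp: z_def B'_def)
  qed
  have xs: "x \<in> slab \<nu>" using x by (simp add: slab_def)
  have "z x + w x \<le> 0 * (1 - x \<bullet> \<nu>)"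
    by (rule comparison[OF \<nu> z w, of "max B' B"]) (use zb bd(2) uc h xs in \<open>auto intro: max.coboundedI1 max.coboundedI2\<close>)
  moreover have "m - e \<le> z x"
  proof -
    have "(x /\<^sub>R \<theta>) \<bullet> \<nu> = 0" using x by simp
    then have "\<theta> * m \<le> \<theta> * u (x /\<^sub>R \<theta>)" using m \<theta> by (intro mult_left_mono) auto
    moreover have "\<theta> * m + (s * (1 - \<theta>) - \<theta> * \<eta>) = s + \<theta> * \<eta>" by (simp add: s_def algebra_simps)
    moreover have "0 \<le> \<theta> * \<eta>" using \<theta> \<eta> by simp
    moreover have "s = m - e" by (simp add: s_def \<eta>_def)
    ultimately show ?thesis using x \<theta> by (simp add: z_def)
  qed
  ultimately show "m + w x \<le> 0 + e" by simp
qed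

end

section \<open>Almost periods\<close>

lemma trig_polynomial_translation:
  assumes K: "finite K"
  shows "cmod ((\<Sum>\<xi>\<in>K. c \<xi> * cis (\<xi> \<bullet> (x + (z - z')))) - (\<Sum>\<xi>\<in>K. c \<xi> * cis (\<xi> \<bullet> x)))
      \<le> (\<Sum>\<xi>\<in>K. cmod (c \<xi>) * cmod (cis (\<xi> \<bullet> z) - cis (\<xi> \<bullet> z')))"
proof -
  have "(\<Sum>\<xi>\<in>K. c \<xi> * cis (\<xi> \<bullet> (x + (z - z')))) - (\<Sum>\<xi>\<in>K. c \<xi> * cis (\<xi> \<bullet> x))
      = (\<Sum>\<xi>\<in>K. c \<xi> * (cis (\<xi> \<bullet> x - \<xi> \<bullet> z') * (cis (\<xi> \<bullet> z) - cis (\<xi> \<bullet> z'))))"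
    unfolding sum_subtractf[symmetric]
    by (intro sum.cong refl) (simp add: inner_add_right inner_diff_right right_diff_distrib cis_mult algebra_simps)
  also have "cmod \<dots> \<le> (\<Sum>\<xi>\<in>K. cmod (c \<xi>) * cmod (cis (\<xi> \<bullet> z) - cis (\<xi> \<bullet> z')))"
    by (rule order_trans[OF norm_sum]) (simp add: norm_mult)
  finally show ?thesis .
qed

text \<open>
  If points \<open>z n\<close> had no almost period within distance \<open>n\<close>, pass to a subsequence along which the finitely many
  characters of an approximating trigonometric polynomial converge. Then differences of two late members of the subsequence are almost
  periods, and with one member fixed they contradict the choice of the other.
\<close>
lemma relatively_dense_almost_periods:
  fixes g :: "real^'n \<Rightarrow> real"
  assumes ap: "almost_periodic_on (hyperplane \<nu> 0) g" and \<delta>: "0 < \<delta>"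
  obtains L where "0 \<le> L" "\<And>z. z \<bullet> \<nu> = 0 \<Longrightarrow> \<exists>\<tau>. \<tau> \<bullet> \<nu> = 0 \<and> norm (z - \<tau>) \<le> L \<and> (\<forall>x. x \<bullet> \<nu> = 0 \<longrightarrow> \<bar>g (x + \<tau>) - g x\<bar> \<le> \<delta>)"
proof -
  have "0 < \<delta> / 4" using \<delta> by simp
  obtain p where "trig_polynomial p" and p: "\<And>x. x \<bullet> \<nu> = 0 \<Longrightarrow> cmod (complex_of_real (g x) - p x) \<le> \<delta> / 4"
    using ap[unfolded almost_periodic_on_def, rule_format, OF \<open>0 < \<delta> / 4\<close>] unfolding hyperplane_def by blast
  then obtain K c where K: "finite K" and pK: "p = (\<lambda>x. \<Sum>\<xi>\<in>K. c \<xi> * cis (\<xi> \<bullet> x))"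
    unfolding trig_polynomial_def by blast
  define S where "S = (\<Sum>\<xi>\<in>K. cmod (c \<xi>)) + 1"
  have S: "0 < S" unfolding S_def by (intro add_nonneg_pos sum_nonneg) auto
  define good where "good = (\<lambda>L z. \<exists>\<tau>. \<tau> \<bullet> \<nu> = 0 \<and> norm (z - \<tau>) \<le> L \<and> (\<forall>x. x \<bullet> \<nu> = 0 \<longrightarrow> \<bar>g (x + \<tau>) - g x\<bar> \<le> \<delta>))"
  have "\<exists>n::nat. \<forall>z. z \<bullet> \<nu> = 0 \<longrightarrow> good (real n) z"
  proof (rule ccontr)
    assume "\<not> ?thesis"
    then obtain z where z: "\<And>n::nat. z n \<bullet> \<nu> = 0" "\<And>n. \<not> good (real n) (z n)" by metis
    have bnd: "norm (cis (\<xi> \<bullet> z n)) \<le> 1" for n \<xi> by simp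
    obtain r where r: "strict_mono (r :: nat \<Rightarrow> nat)" "\<And>\<xi>. \<xi> \<in> K \<Longrightarrow> \<exists>l. (\<lambda>n. cis (\<xi> \<bullet> z (r n))) \<longlonglongrightarrow> l"
      by (rule function_convergent_subsequence[of K "\<lambda>n \<xi>. cis (\<xi> \<bullet> z n)" 1])
         ((rule countable_finite[OF K]), (rule bnd), (rule that; assumption))
    have pos: "0 < \<delta> / (2 * S)" using \<delta> S by simp
    have "\<forall>\<xi>\<in>K. \<exists>N. \<forall>m\<ge>N. \<forall>n\<ge>N. cmod (cis (\<xi> \<bullet> z (r m)) - cis (\<xi> \<bullet> z (r n))) < \<delta> / (2 * S)"
    proof
      fix \<xi> assume "\<xi> \<in> K"
      then have "Cauchy (\<lambda>n. cis (\<xi> \<bullet> z (r n)))" using r(2) LIMSEQ_imp_Cauchy by blast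
      from CauchyD[OF this pos] show "\<exists>N. \<forall>m\<ge>N. \<forall>n\<ge>N. cmod (cis (\<xi> \<bullet> z (r m)) - cis (\<xi> \<bullet> z (r n))) < \<delta> / (2 * S)" .
    qed
    then obtain N where N: "\<And>\<xi> m n. \<xi> \<in> K \<Longrightarrow> N \<xi> \<le> m \<Longrightarrow> N \<xi> \<le> n \<Longrightarrow> cmod (cis (\<xi> \<bullet> z (r m)) - cis (\<xi> \<bullet> z (r n))) < \<delta> / (2 * S)"
      by metis
    define m where "m = (\<Sum>\<xi>\<in>K. N \<xi>)"
    have Nm: "N \<xi> \<le> m" if "\<xi> \<in> K" for \<xi> unfolding m_def using K that by (intro member_le_sum) auto
    obtain k :: nat where k: "norm (z (r m)) \<le> real k" using real_arch_simple by blast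
    define n where "n = max m k"
    have nr: "n \<le> r n" by (rule seq_suble[OF r(1)])
    have "good (real (r n)) (z (r n))"
      unfolding good_def
    proof (intro exI[of _ "z (r n) - z (r m)"] conjI allI impI)
      show "(z (r n) - z (r m)) \<bullet> \<nu> = 0" using z(1) by (simp add: inner_diff_left)
      have "real k \<le> real (r n)" using nr by (simp add: n_def)
      then show "norm (z (r n) - (z (r n) - z (r m))) \<le> real (r n)" using k by simp
      fix x assume x: "x \<bullet> \<nu> = 0"
      let ?x' = "x + (z (r n) - z (r m))"
      have x': "?x' \<bullet> \<nu> = 0" using x z(1) by (simp add: inner_add_left inner_diff_left)
      have "cmod (p ?x' - p x) \<le> (\<Sum>\<xi>\<in>K. cmod (c \<xi>) * cmod (cis (\<xi> \<bullet> z (r n)) - cis (\<xi> \<bullet> z (r m))))"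
        unfolding pK by (rule trig_polynomial_translation[OF K])
      also have "\<dots> \<le> (\<Sum>\<xi>\<in>K. cmod (c \<xi>) * (\<delta> / (2 * S)))"
      proof (intro sum_mono mult_left_mono)
        fix \<xi> assume "\<xi> \<in> K"
        moreover from this have "N \<xi> \<le> n" "N \<xi> \<le> m" using Nm[of \<xi>] by (auto simp: n_def le_max_iff_disj)
        ultimately show "cmod (cis (\<xi> \<bullet> z (r n)) - cis (\<xi> \<bullet> z (r m))) \<le> \<delta> / (2 * S)"
          using N[of \<xi> n m] by (simp add: less_imp_le)
      qed simp
      also have "\<dots> = (S - 1) * (\<delta> / (2 * S))" unfolding sum_distrib_right[symmetric] by (simp add: S_def)
      also have "\<dots> \<le> S * (\<delta> / (2 * S))" using pos by (intro mult_right_mono) auto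
      also have "\<dots> = \<delta> / 2" using S by simp
      finally have pp: "cmod (p ?x' - p x) \<le> \<delta> / 2" .
      have "complex_of_real (g ?x' - g x) = (complex_of_real (g ?x') - p ?x') + ((p ?x' - p x) - (complex_of_real (g x) - p x))"
        by simp
      then have "cmod (complex_of_real (g ?x' - g x)) \<le> cmod (complex_of_real (g ?x') - p ?x') + (cmod (p ?x' - p x) + cmod (complex_of_real (g x) - p x))"
        by (simp only:) (rule order_trans[OF norm_triangle_ineq add_left_mono[OF norm_triangle_ineq4]])
      then have "\<bar>g ?x' - g x\<bar> \<le> \<delta> / 4 + (\<delta> / 2 + \<delta> / 4)"
        using p[OF x] p[OF x'] pp unfolding norm_of_real by linarith
      then show "\<bar>g ?x' - g x\<bar> \<le> \<delta>" by simp
    qed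
    with z(2) show False by blast
  qed
  then obtain n :: nat where n: "\<And>z. z \<bullet> \<nu> = 0 \<Longrightarrow> good (real n) z" by blast
  show thesis by (rule that[of "real n"]) (use n in \<open>auto simp: good_def\<close>)
qed

lemma holder_space_uniformly_continuous:
  fixes g :: "real^'n \<Rightarrow> real"
  assumes g: "g \<in> holder_space \<gamma> (hyperplane \<nu> 0)" and \<gamma>: "0 < \<gamma>" and e: "0 < e"
  shows "\<exists>d>0. \<forall>x y. x \<bullet> \<nu> = 0 \<longrightarrow> y \<bullet> \<nu> = 0 \<longrightarrow> norm (x - y) < d \<longrightarrow> \<bar>g x - g y\<bar> < e"
proof -
  obtain C where C: "\<And>x y. x \<bullet> \<nu> = 0 \<Longrightarrow> y \<bullet> \<nu> = 0 \<Longrightarrow> \<bar>g x - g y\<bar> \<le> C * norm (x - y) powr \<gamma>"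
    using g unfolding holder_space_def hyperplane_def by blast
  define C' where "C' = \<bar>C\<bar> + 1"
  have C': "0 < C'" "C \<le> C'" by (auto simp: C'_def)
  define d where "d = (e / C') powr (1 / \<gamma>)"
  have d: "0 < d" using e C' by (simp add: d_def)
  have "\<bar>g x - g y\<bar> < e" if xy: "x \<bullet> \<nu> = 0" "y \<bullet> \<nu> = 0" "norm (x - y) < d" for x y
  proof -
    have "\<bar>g x - g y\<bar> \<le> C * norm (x - y) powr \<gamma>" by (rule C[OF xy(1,2)])
    also have "\<dots> \<le> C' * norm (x - y) powr \<gamma>" using C' by (intro mult_right_mono) auto
    also have "\<dots> < C' * d powr \<gamma>" using C' xy(3) \<gamma> by (intro mult_strict_left_mono powr_less_mono2) auto
    also have "d powr \<gamma> = e / C'" using e C' \<gamma> by (simp add: d_def powr_powr)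
    finally show ?thesis using C' by simp
  qed
  then show ?thesis using d by blast
qed

section \<open>The homogenized constant\<close>

lemma uniformly_continuous_rescaled:
  fixes g :: "real^'n \<Rightarrow> real"
  assumes uc: "\<And>e. 0 < e \<Longrightarrow> \<exists>d>0. \<forall>x y. x \<bullet> \<nu> = 0 \<longrightarrow> y \<bullet> \<nu> = 0 \<longrightarrow> norm (x - y) < d \<longrightarrow> \<bar>g x - g y\<bar> < e"
    and \<epsilon>: "0 < \<epsilon>" and e: "0 < e"
  shows "\<exists>d>0. \<forall>x y. x \<bullet> \<nu> = 0 \<longrightarrow> y \<bullet> \<nu> = 0 \<longrightarrow> norm (x - y) < d \<longrightarrow> \<bar>g (x /\<^sub>R \<epsilon>) - g (y /\<^sub>R \<epsilon>)\<bar> < e"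
proof -
  obtain d where d: "0 < d" "\<And>x y. x \<bullet> \<nu> = 0 \<Longrightarrow> y \<bullet> \<nu> = 0 \<Longrightarrow> norm (x - y) < d \<Longrightarrow> \<bar>g x - g y\<bar> < e"
    using uc[OF e] by blast
  have "\<bar>g (x /\<^sub>R \<epsilon>) - g (y /\<^sub>R \<epsilon>)\<bar> < e" if "x \<bullet> \<nu> = 0" "y \<bullet> \<nu> = 0" "norm (x - y) < \<epsilon> * d" for x y
  proof (rule d(2))
    have "norm (x /\<^sub>R \<epsilon> - y /\<^sub>R \<epsilon>) = norm (x - y) / \<epsilon>"
      using \<epsilon> by (simp add: divide_inverse mult.commute flip: scaleR_diff_right)
    also have "\<dots> < d" using that(3) \<epsilon> by (simp add: field_simps)
    finally show "norm (x /\<^sub>R \<epsilon> - y /\<^sub>R \<epsilon>) < d" .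
  qed (use that in auto)
  then show ?thesis using d \<epsilon> by (intro exI[of _ "\<epsilon> * d"]) auto
qed

lemma nested_intervals_limit:
  fixes m M :: "real \<Rightarrow> real"
  assumes le: "\<And>\<epsilon>. 0 < \<epsilon> \<Longrightarrow> m \<epsilon> \<le> M \<epsilon>"
    and mono: "\<And>\<epsilon> \<epsilon>'. 0 < \<epsilon>' \<Longrightarrow> \<epsilon>' < \<epsilon> \<Longrightarrow> m \<epsilon> \<le> m \<epsilon>' \<and> M \<epsilon>' \<le> M \<epsilon>"
  obtains I where "\<And>\<epsilon>. 0 < \<epsilon> \<Longrightarrow> m \<epsilon> \<le> I \<and> I \<le> M \<epsilon>"
proof -
  have cross: "m \<epsilon> \<le> M \<epsilon>'" if "0 < \<epsilon>" "0 < \<epsilon>'" for \<epsilon> \<epsilon>'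
  proof -
    consider "\<epsilon> < \<epsilon>'" | "\<epsilon> = \<epsilon>'" | "\<epsilon>' < \<epsilon>" by linarith
    then show ?thesis
    proof cases
      case 1
      then show ?thesis using mono[of \<epsilon> \<epsilon>'] le[of \<epsilon>] that by linarith
    next
      case 2
      then show ?thesis using le that by simp
    next
      case 3
      then show ?thesis using mono[of \<epsilon>' \<epsilon>] le[of \<epsilon>'] that by linarith
    qed
  qed
  define I where "I = (SUP \<epsilon>\<in>{0<..}. m \<epsilon>)"
  have bdd: "bdd_above (m ` {0<..})" using cross[of _ 1] by (auto simp: bdd_above_def)
  show thesis
  proof (rule that, intro conjI)
    fix \<epsilon> :: real assume "0 < \<epsilon>"
    then show "m \<epsilon> \<le> I" unfolding I_def using bdd by (intro cSUP_upper) auto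
    show "I \<le> M \<epsilon>" unfolding I_def using cross \<open>0 < \<epsilon>\<close> by (intro cSUP_least) (auto intro: exI[of _ 1])
  qed
qed

text \<open>
  The traces on the bottom lie in the intervals \<open>[m \<epsilon>, M \<epsilon>]\<close>, which are nested by monotonicity and shrink by the
  oscillation estimate.
\<close>
theorem theorem1p4:
  fixes \<nu> :: "real^'n"
    and F :: "real^'n^'n \<Rightarrow> real"
    and g :: "real^'n \<Rightarrow> real"
    and \<gamma> :: real
    and u :: "real \<Rightarrow> real^'n \<Rightarrow> real"
  assumes "CARD('n) \<ge> 2"
    and "norm \<nu> = 1"
    and "uniformly_elliptic F"
    and "positively_homogeneous F"
    and "0 < \<gamma>" and "\<gamma> < 1"
    and "g \<in> holder_space \<gamma> (hyperplane \<nu> 0)"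
    and "almost_periodic_on (hyperplane \<nu> 0) g"
    and "\<And>\<epsilon>. 0 < \<epsilon> \<Longrightarrow> bounded_visc_solution F \<nu> 1 (\<lambda>x. g (x /\<^sub>R \<epsilon>)) (u \<epsilon>)"
  shows "\<exists>!I0::real. ((\<lambda>\<epsilon>. SUP x\<in>hyperplane \<nu> 0. \<bar>u \<epsilon> x - I0\<bar>) \<longlongrightarrow> 0) (at_right 0)"
proof -
  note \<nu> = assms(2)
  let ?H = "hyperplane \<nu> 0"
  have H: "x \<in> ?H \<longleftrightarrow> x \<bullet> \<nu> = 0" for x by (simp add: hyperplane_def)
  have H0: "0 \<in> ?H" by (simp add: H)
  then have Hne: "?H \<noteq> {}" by blast
  have Hs: "x \<in> slab \<nu>" if "x \<bullet> \<nu> = 0" for x using that by (simp add: slab_def)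
  obtain lam Lam where pair: "elliptic_pair {X. 0 \<le> F X} {Y. F (- Y) \<le> 0} lam Lam"
    by (rule elliptic_pair_of_operator[OF assms(3,4)])
  let ?\<Gamma>1 = "{X. 0 \<le> F X}" and ?\<Gamma>2 = "{Y. F (- Y) \<le> 0}"
  interpret P: elliptic_pair ?\<Gamma>1 ?\<Gamma>2 lam Lam by (rule pair)
  interpret Q: elliptic_pair ?\<Gamma>2 ?\<Gamma>1 lam Lam by (rule P.swap)
  have uc: "\<exists>d>0. \<forall>x y. x \<bullet> \<nu> = 0 \<longrightarrow> y \<bullet> \<nu> = 0 \<longrightarrow> norm (x - y) < d \<longrightarrow> \<bar>g x - g y\<bar> < e" if "0 < e" for e
    by (rule holder_space_uniformly_continuous[OF assms(7,5) that])
  have uc1: "\<exists>d>0. \<forall>x y. x \<bullet> \<nu> = 0 \<longrightarrow> y \<bullet> \<nu> = 0 \<longrightarrow> norm (x - y) < d \<longrightarrow> \<bar>g (x /\<^sub>R \<epsilon>) - g (y /\<^sub>R \<epsilon>)\<bar> < e"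
    if "0 < \<epsilon>" "0 < e" for \<epsilon> e
    by (rule uniformly_continuous_rescaled[OF uc that])
  have uc2: "\<exists>d>0. \<forall>x y. x \<bullet> \<nu> = 0 \<longrightarrow> y \<bullet> \<nu> = 0 \<longrightarrow> norm (x - y) < d \<longrightarrow> \<bar>(- g (x /\<^sub>R \<epsilon>)) - (- g (y /\<^sub>R \<epsilon>))\<bar> < e"
    if "0 < \<epsilon>" "0 < e" for \<epsilon> e
    using uc1[OF that] by (simp add: abs_minus_commute)
  obtain K where K: "0 < K" and gK: "\<And>x. x \<bullet> \<nu> = 0 \<Longrightarrow> \<bar>g x\<bar> \<le> K"
  proof -
    have "bounded (g ` ?H)" using assms(7) by (simp add: holder_space_def)
    then obtain b where "0 < b" "\<forall>y\<in>g ` ?H. norm y \<le> b" using bounded_pos by blast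
    then show thesis using that[of b] by (auto simp: H)
  qed
  have sub: "jet_subsolution ?\<Gamma>1 \<nu> (\<lambda>x. g (x /\<^sub>R \<epsilon>)) (u \<epsilon>)"
    and super: "jet_subsolution ?\<Gamma>2 \<nu> (\<lambda>x. - g (x /\<^sub>R \<epsilon>)) (\<lambda>x. - u \<epsilon> x)" if "0 < \<epsilon>" for \<epsilon>
    using assms(9)[OF that] visc_subsolution_imp_jet[OF \<nu>] visc_supersolution_imp_jet[OF \<nu>]
    by (auto simp: bounded_visc_solution_def)
  have data: "- K \<le> g (x /\<^sub>R \<epsilon>)" "- K \<le> - g (x /\<^sub>R \<epsilon>)" if "x \<bullet> \<nu> = 0" for x \<epsilon>
    using gK[of "x /\<^sub>R \<epsilon>"] that by (simp_all add: abs_le_iff)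
  have bar: "u \<epsilon> x \<le> K * (1 - x \<bullet> \<nu>)" "- u \<epsilon> x \<le> K * (1 - x \<bullet> \<nu>)" if \<epsilon>: "0 < \<epsilon>" and x: "x \<in> slab \<nu>" for \<epsilon> x
  proof -
    have "bounded (u \<epsilon> ` slab \<nu>)" using assms(9)[OF \<epsilon>] by (simp add: bounded_visc_solution_def closure_strip[OF \<nu>])
    then obtain B where "\<forall>y\<in>u \<epsilon> ` slab \<nu>. norm y \<le> B" unfolding bounded_iff by blast
    then have B: "u \<epsilon> y \<le> B" "- u \<epsilon> y \<le> B" if "y \<in> slab \<nu>" for y using that by (auto simp: abs_le_iff)
    show "u \<epsilon> x \<le> K * (1 - x \<bullet> \<nu>)" by (rule P.linear_barrier[OF \<nu> sub[OF \<epsilon>] B(1) data(1) x])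
    show "- u \<epsilon> x \<le> K * (1 - x \<bullet> \<nu>)" by (rule Q.linear_barrier[OF \<nu> super[OF \<epsilon>] B(2) data(2) x])
  qed
  have uK: "\<bar>u \<epsilon> x\<bar> \<le> K" if \<epsilon>: "0 < \<epsilon>" and x: "x \<in> slab \<nu>" for \<epsilon> x
  proof -
    have "K * (1 - x \<bullet> \<nu>) \<le> K * 1" using x K by (intro mult_left_mono) (auto simp: slab_def)
    then show ?thesis using bar[OF \<epsilon> x] by (simp add: abs_le_iff)
  qed
  have uK': "u \<epsilon> x \<le> K" "- u \<epsilon> x \<le> K" if "0 < \<epsilon>" "x \<in> slab \<nu>" for \<epsilon> x
    using uK[OF that] by (auto simp: abs_le_iff)
  define m where "m = (\<lambda>\<epsilon>. INF x\<in>?H. u \<epsilon> x)"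
  define M where "M = (\<lambda>\<epsilon>. SUP x\<in>?H. u \<epsilon> x)"
  have bdd: "bdd_below (u \<epsilon> ` ?H)" "bdd_above (u \<epsilon> ` ?H)" if "0 < \<epsilon>" for \<epsilon>
  proof -
    have "- K \<le> u \<epsilon> x" "u \<epsilon> x \<le> K" if "x \<in> ?H" for x
      using uK[OF \<open>0 < \<epsilon>\<close> Hs, of x] that by (auto simp: H abs_le_iff)
    then show "bdd_below (u \<epsilon> ` ?H)" "bdd_above (u \<epsilon> ` ?H)" unfolding bdd_below_def bdd_above_def by blast+
  qed
  have mM: "m \<epsilon> \<le> u \<epsilon> x" "u \<epsilon> x \<le> M \<epsilon>" if "0 < \<epsilon>" "x \<bullet> \<nu> = 0" for \<epsilon> x
    unfolding m_def M_def using bdd[OF that(1)] that(2) by (auto intro!: cINF_lower cSUP_upper simp: H)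
  have ratio: "x /\<^sub>R (\<epsilon>' / \<epsilon>) /\<^sub>R \<epsilon> = x /\<^sub>R \<epsilon>'" if "0 < \<epsilon>'" "0 < \<epsilon>" for \<epsilon> \<epsilon>' and x :: "real^'n"
    using that by (simp add: field_simps)
  have mono: "m \<epsilon> \<le> m \<epsilon>' \<and> M \<epsilon>' \<le> M \<epsilon>" if \<epsilon>': "0 < \<epsilon>'" "\<epsilon>' < \<epsilon>" for \<epsilon> \<epsilon>'
  proof -
    have \<epsilon>: "0 < \<epsilon>" using \<epsilon>' by simp
    have \<theta>: "0 < \<epsilon>' / \<epsilon>" "\<epsilon>' / \<epsilon> < 1" using \<epsilon>' by auto
    have "m \<epsilon> \<le> u \<epsilon>' x" if x: "x \<bullet> \<nu> = 0" for x
    proof -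
      have "m \<epsilon> + - u \<epsilon>' x \<le> 0"
      proof (rule P.bottom_infimum_monotone[OF \<nu> sub[OF \<epsilon>] super[OF \<epsilon>'(1)] \<theta> _ uc2[OF \<epsilon>'(1)] uK'(1)[OF \<epsilon>] uK'(2)[OF \<epsilon>'(1)] mM(1)[OF \<epsilon>] x])
        show "0 \<le> g (y /\<^sub>R (\<epsilon>' / \<epsilon>) /\<^sub>R \<epsilon>) + - g (y /\<^sub>R \<epsilon>')" for y unfolding ratio[OF \<epsilon>'(1) \<epsilon>] by simp
      qed
      then show ?thesis by simp
    qed
    then have "m \<epsilon> \<le> m \<epsilon>'" unfolding m_def by (intro cINF_greatest Hne) (simp add: H)
    moreover have "u \<epsilon>' x \<le> M \<epsilon>" if x: "x \<bullet> \<nu> = 0" for x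
    proof -
      have "- M \<epsilon> + u \<epsilon>' x \<le> 0"
      proof (rule Q.bottom_infimum_monotone[OF \<nu> super[OF \<epsilon>] sub[OF \<epsilon>'(1)] \<theta> _ uc1[OF \<epsilon>'(1)] uK'(2)[OF \<epsilon>] uK'(1)[OF \<epsilon>'(1)] _ x])
        show "0 \<le> - g (y /\<^sub>R (\<epsilon>' / \<epsilon>) /\<^sub>R \<epsilon>) + g (y /\<^sub>R \<epsilon>')" for y unfolding ratio[OF \<epsilon>'(1) \<epsilon>] by simp
        show "- M \<epsilon> \<le> - u \<epsilon> y" if "y \<bullet> \<nu> = 0" for y using mM(2)[OF \<epsilon> that] by simp
      qed
      then show ?thesis by simp
    qed
    then have "M \<epsilon>' \<le> M \<epsilon>" unfolding M_def by (intro cSUP_least Hne) (simp add: H)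
    ultimately show ?thesis by blast
  qed
  have osc: "\<forall>\<^sub>F \<epsilon> in at_right 0. M \<epsilon> - m \<epsilon> \<le> \<delta>" if \<delta>: "0 < \<delta>" for \<delta>
  proof -
    have \<delta>3: "0 < \<delta> / 3" using \<delta> by simp
    obtain A where A: "0 \<le> A" "\<And>z. z \<bullet> \<nu> = 0 \<Longrightarrow> \<exists>\<tau>. \<tau> \<bullet> \<nu> = 0 \<and> norm (z - \<tau>) \<le> A \<and> (\<forall>x. x \<bullet> \<nu> = 0 \<longrightarrow> \<bar>g (x + \<tau>) - g x\<bar> \<le> \<delta> / 3)"
      by (rule relatively_dense_almost_periods[OF assms(8) \<delta>3]) (rule that; assumption)
    obtain L where L: "0 \<le> L" and equi: "\<forall>u1 u2 h1 h2.
     jet_subsolution ?\<Gamma>1 \<nu> h1 u1 \<and> jet_subsolution ?\<Gamma>2 \<nu> h2 u2 \<and>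
     (\<forall>x. x \<bullet> \<nu> = 0 \<longrightarrow> - K \<le> h1 x \<and> - K \<le> h2 x) \<and>
     (\<forall>x\<in>slab \<nu>. u1 x \<le> K * (1 - x \<bullet> \<nu>) \<and> u2 x \<le> K * (1 - x \<bullet> \<nu>) \<and> u1 x + u2 x \<le> 0) \<longrightarrow>
     (\<forall>x y. x \<bullet> \<nu> = 0 \<longrightarrow> y \<bullet> \<nu> = 0 \<longrightarrow> u1 x + u2 y \<le> L * norm (x - y) + \<delta> / 3)"
      using P.equicontinuity_at_bottom[OF \<nu> K \<delta>3] by blast
    have diff: "u \<epsilon> x - u \<epsilon> y \<le> \<delta>" if \<epsilon>: "0 < \<epsilon>" "L * (\<epsilon> * A) \<le> \<delta> / 3" and x: "x \<bullet> \<nu> = 0" and y: "y \<bullet> \<nu> = 0" for \<epsilon> x y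
    proof -
      have "((x - y) /\<^sub>R \<epsilon>) \<bullet> \<nu> = 0" using x y by (simp add: inner_diff_left)
      then obtain \<tau> where \<tau>: "\<tau> \<bullet> \<nu> = 0" "norm ((x - y) /\<^sub>R \<epsilon> - \<tau>) \<le> A" "\<And>x. x \<bullet> \<nu> = 0 \<Longrightarrow> \<bar>g (x + \<tau>) - g x\<bar> \<le> \<delta> / 3"
        using A(2) by blast
      define t where "t = \<epsilon> *\<^sub>R \<tau>"
      have t: "t \<bullet> \<nu> = 0" using \<tau>(1) by (simp add: t_def)
      have ys: "y \<in> slab \<nu>" using Hs[OF y] .
      have tr: "jet_subsolution ?\<Gamma>1 \<nu> (\<lambda>x. g ((x + t) /\<^sub>R \<epsilon>)) (\<lambda>x. u \<epsilon> (x + t))"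
        using jet_subsolution_translate[OF sub[OF \<epsilon>(1)] t] .
      have "u \<epsilon> (y + t) + - u \<epsilon> y \<le> \<delta> / 3 * (1 - y \<bullet> \<nu>)"
      proof (rule P.comparison[OF \<nu> tr super[OF \<epsilon>(1)], of K])
        show "u \<epsilon> (x + t) \<le> K" if "x \<in> slab \<nu>" for x
          using uK'(1)[OF \<epsilon>(1), of "x + t"] that t by (simp add: slab_def inner_add_left)
        show "- u \<epsilon> x \<le> K" if "x \<in> slab \<nu>" for x using uK'(2)[OF \<epsilon>(1) that] .
        show "- (\<delta> / 3) \<le> g ((x + t) /\<^sub>R \<epsilon>) + - g (x /\<^sub>R \<epsilon>)" if x: "x \<bullet> \<nu> = 0" for x
        proof -
          have "(x + t) /\<^sub>R \<epsilon> = x /\<^sub>R \<epsilon> + \<tau>" using \<epsilon> by (simp add: t_def scaleR_add_right)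
          moreover have "\<bar>g (x /\<^sub>R \<epsilon> + \<tau>) - g (x /\<^sub>R \<epsilon>)\<bar> \<le> \<delta> / 3" using x by (intro \<tau>(3)) simp
          ultimately show ?thesis unfolding abs_le_iff by simp
        qed
      qed (use \<delta> ys uc2[OF \<epsilon>(1)] in auto)
      moreover have "u \<epsilon> x + - u \<epsilon> (y + t) \<le> L * norm (x - (y + t)) + \<delta> / 3"
      proof (rule equi[rule_format], intro conjI allI impI ballI)
        show "jet_subsolution ?\<Gamma>1 \<nu> (\<lambda>x. g (x /\<^sub>R \<epsilon>)) (u \<epsilon>)" by (rule sub[OF \<epsilon>(1)])
        show "jet_subsolution ?\<Gamma>2 \<nu> (\<lambda>x. - g (x /\<^sub>R \<epsilon>)) (\<lambda>x. - u \<epsilon> x)" by (rule super[OF \<epsilon>(1)])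
      qed (use data bar[OF \<epsilon>(1)] x y t in \<open>simp_all add: inner_add_left\<close>)
      moreover have "L * norm (x - (y + t)) \<le> \<delta> / 3"
      proof -
        have "x - (y + t) = \<epsilon> *\<^sub>R ((x - y) /\<^sub>R \<epsilon> - \<tau>)" using \<epsilon> by (simp add: t_def scaleR_diff_right)
        then have "norm (x - (y + t)) \<le> \<epsilon> * A" using \<tau>(2) \<epsilon> by simp
        then have "L * norm (x - (y + t)) \<le> L * (\<epsilon> * A)" using L by (rule mult_left_mono)
        then show ?thesis using \<epsilon>(2) by simp
      qed
      ultimately show ?thesis using y by simp
    qed
    have "((\<lambda>\<epsilon>. L * (\<epsilon> * A)) \<longlongrightarrow> L * (0 * A)) (at_right 0)" by (intro tendsto_intros)
    then have "\<forall>\<^sub>F \<epsilon> in at_right 0. L * (\<epsilon> * A) < \<delta> / 3" using \<delta> by (intro order_tendstoD) auto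
    then show ?thesis
      using eventually_at_right_less[of "0::real"]
    proof eventually_elim
      case (elim \<epsilon>)
      have "M \<epsilon> \<le> u \<epsilon> y + \<delta>" if y: "y \<bullet> \<nu> = 0" for y
        unfolding M_def
      proof (rule cSUP_least[OF Hne])
        fix x assume "x \<in> ?H"
        then show "u \<epsilon> x \<le> u \<epsilon> y + \<delta>"
          using diff[OF elim(2) less_imp_le[OF elim(1)] _ y, of x] by (simp add: H)
      qed
      then have "M \<epsilon> - \<delta> \<le> m \<epsilon>" unfolding m_def by (intro cINF_greatest Hne) (simp add: H algebra_simps)
      then show ?case by simp
    qed
  qed
  have le: "m \<epsilon> \<le> M \<epsilon>" if "0 < \<epsilon>" for \<epsilon> using mM[OF that, of 0] by simp
  obtain I where I: "\<And>\<epsilon>. 0 < \<epsilon> \<Longrightarrow> m \<epsilon> \<le> I \<and> I \<le> M \<epsilon>"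
    by (rule nested_intervals_limit[of m M]) ((rule le; assumption), (rule mono; assumption), (rule that; assumption))
  have bddI: "bdd_above ((\<lambda>x. \<bar>u \<epsilon> x - J\<bar>) ` ?H)" if "0 < \<epsilon>" for \<epsilon> J
    unfolding bdd_above_def using uK[OF that Hs] by (intro exI[of _ "K + \<bar>J\<bar>"]) (fastforce simp: H)
  have le_sup: "\<bar>u \<epsilon> 0 - J\<bar> \<le> (SUP x\<in>?H. \<bar>u \<epsilon> x - J\<bar>)" if "0 < \<epsilon>" for \<epsilon> J
    by (rule cSUP_upper[OF H0 bddI[OF that]])
  show ?thesis
  proof (rule ex1I[of _ I])
    show "((\<lambda>\<epsilon>. SUP x\<in>?H. \<bar>u \<epsilon> x - I\<bar>) \<longlongrightarrow> 0) (at_right 0)"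
    proof (rule tendstoI)
      fix e :: real assume "0 < e"
      then have "0 < e / 2" by simp
      from osc[OF this] show "\<forall>\<^sub>F \<epsilon> in at_right 0. dist (SUP x\<in>?H. \<bar>u \<epsilon> x - I\<bar>) 0 < e"
        using eventually_at_right_less[of "0::real"]
      proof eventually_elim
        case (elim \<epsilon>)
        have "\<bar>u \<epsilon> x - I\<bar> \<le> e / 2" if "x \<bullet> \<nu> = 0" for x
          using mM[OF elim(2) that] I[OF elim(2)] elim(1) unfolding abs_le_iff by linarith
        then have "(SUP x\<in>?H. \<bar>u \<epsilon> x - I\<bar>) \<le> e / 2" by (intro cSUP_least Hne) (simp add: H)
        moreover have "0 \<le> (SUP x\<in>?H. \<bar>u \<epsilon> x - I\<bar>)" using le_sup[OF elim(2), of I] by linarith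
        ultimately show ?case using \<open>0 < e\<close> by (simp add: dist_real_def)
      qed
    qed
  next
    fix J assume J: "((\<lambda>\<epsilon>. SUP x\<in>?H. \<bar>u \<epsilon> x - J\<bar>) \<longlongrightarrow> 0) (at_right 0)"
    have "((\<lambda>\<epsilon>. u \<epsilon> 0 - J) \<longlongrightarrow> 0) (at_right 0)"
      by (rule Lim_null_comparison[OF _ J]) (use le_sup in \<open>auto intro: eventually_mono[OF eventually_at_right_less[of "0::real"]]\<close>)
    moreover have "((\<lambda>\<epsilon>. u \<epsilon> 0 - I) \<longlongrightarrow> 0) (at_right 0)"
    proof (rule tendstoI)
      fix e :: real assume "0 < e"
      then have "0 < e / 2" by simp
      from osc[OF this] show "\<forall>\<^sub>F \<epsilon> in at_right 0. dist (u \<epsilon> 0 - I) 0 < e"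
        using eventually_at_right_less[of "0::real"]
      proof eventually_elim
        case (elim \<epsilon>)
        have "m \<epsilon> \<le> u \<epsilon> 0" "u \<epsilon> 0 \<le> M \<epsilon>" by (rule mM[OF elim(2)], simp)+
        then show ?case using I[OF elim(2)] elim(1) \<open>0 < e\<close>
          unfolding dist_real_def abs_less_iff by linarith
      qed
    qed
    ultimately have "((\<lambda>\<epsilon>. (u \<epsilon> 0 - I) - (u \<epsilon> 0 - J)) \<longlongrightarrow> 0 - 0) (at_right 0)" by (intro tendsto_diff)
    then have "((\<lambda>\<epsilon>::real. J - I) \<longlongrightarrow> 0) (at_right 0)" by simp
    then show "J = I" by (simp add: tendsto_const_iff)
  qed
qed

end
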